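(* Let $\mathbb{K}_1,\mathbb{K}_2$ be any two real composition algebras and let $L_3(\mathbb{K}_1,\mathbb{K}_2)$ be Tits's magic-square Lie algebra. Then $L_3(\mathbb{K}_1,\mathbb{K}_2)$ is isomorphic, as a Lie algebra, to the vector space $$\bigl(\mathrm{Tri}\,\mathbb{K}_1\oplus \mathrm{Tri}\,\mathbb{K}_2\bigr)\;\dot{+}\;3\,(\mathbb{K}_1\otimes\mathbb{K}_2)$$ equipped with the following brackets. The direct sum of Lie algebras $\mathrm{Tri}\,\mathbb{K}_1\oplus\mathrm{Tri}\,\mathbb{K}_2$ is a Lie subalgebra. For $T_\alpha=(T_{\alpha1},\overline{T}_{\alpha2},\overline{T}_{\alpha3})\in\mathrm{Tri}\,\mathbb{K}_\alpha$ ($\alpha=1,2$), $x_\alpha,y_\alpha\in\mathbb{K}_\alpha$ and $i\in\{1,2,3\}$: $$[T_1,F_i(x_1\otimes x_2)]=F_i(T_{1i}x_1\otimes x_2),\qquad [T_2,F_i(x_1\otimes x_2)]=F_i(x_1\otimes T_{2i}x_2);$$ if $(i,j,k)$ is a cyclic permutation of $(1,2,3)$, $$[F_i(x_1\otimes x_2),F_j(y_1\otimes y_2)]=F_k(\bar y_1\bar x_1\otimes\bar y_2\bar x_2);$$ and $$[F_i(x_1\otimes x_2),F_i(y_1\otimes y_2)]=\langle x_2,y_2\rangle\,\theta^{1-i}T_{x_1,y_1}+\langle x_1,y_1\rangle\,\theta^{1-i}T_{x_2,y_2}\in\mathrm{Tri}\,\mathbb{K}_1\oplus\mathrm{Tri}\,\mathbb{K}_2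 .$$
   Context: $\dot{+}$ denotes direct sum of vector spaces, $\oplus$ direct sum of Lie algebras. A real composition algebra $\mathbb{K}$ is a unital (not necessarily associative) real algebra with a non-degenerate quadratic form $x\mapsto|x|^2$ satisfying $|xy|^2=|x|^2|y|^2$. $\mathbb{R}\subset\mathbb{K}$ is the span of the identity, $\mathbb{K}'$ its orthogonal complement, $\mathbb{K}=\mathbb{R}\,\dot{+}\,\mathbb{K}'$, with projections $\mathrm{Re},\mathrm{Im}$; conjugation $x\mapsto\bar x$ is $+1$ on $\mathbb{R}$ and $-1$ on $\mathbb{K}'$; $\langle x,y\rangle=\frac12(|x+y|^2-|x|^2-|y|^2)=\mathrm{Re}(x\bar y)$; $[x,y]=xy-yx$. $L_x(z)=xz$, $R_x(z)=zx$. $\mathfrak{so}(\mathbb{K})$ is the Lie algebra of linear maps $\mathbb{K}\to\mathbb{K}$ antisymmetric with respect to $\langle\cdot,\cdot\rangle$. $\mathrm{Der}\,A$ is the derivation algebra of an algebra $A$. For $x,y\in\mathbb{K}$, $D_{x,y}=[L_x,L_y]+[L_x,R_y]+[R_x,R_y]\in\mathrm{Der}\,\mathbb{K}$. Triality algebra: $\mathrm{Tri}\,\mathbb{K}=\{(A,B,C)\in\mathfrak{so}(\mathbb{K})^3: A(xy)=x(By)+(Cx)y\ \ \forall x,y\in\mathbb{K}\}$ with componentwise brackets. For a linear map $A:\mathbb{K}\to\mathbb{K}$, $\overline{A}(x)=\overline{A(\bar x)}$. An element $T=(A,B,C)\in\mathrm{Tri}\,\mathbb{K}$ is written $T=(T_1,\overline{T}_2,\overline{T}_3)$,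 i.e. $T_1=A$, $T_2=\overline{B}$, $T_3=\overline{C}$. $\theta$ is the Lie algebra automorphism of $\mathrm{Tri}\,\mathbb{K}$ given by $\theta(A,B,C)=(\overline{B},C,\overline{A})$. For $x,y\in\mathbb{K}$, $T_{x,y}=(4S_{x,y},\,R_yR_{\bar x}-R_xR_{\bar y},\,L_yL_{\bar x}-L_xL_{\bar y})\in\mathrm{Tri}\,\mathbb{K}$, where $S_{x,y}(z)=\langle x,z\rangle y-\langle y,z\rangle x$. $3V=V\,\dot{+}\,V\,\dot{+}\,V$; for $V=\mathbb{K}_1\otimes\mathbb{K}_2$, $F_i:V\to 3V$ denotes the inclusion of the $i$-th summand. $H_3(\mathbb{K})$ is the Jordan algebra of hermitian $3\times3$ matrices over $\mathbb{K}$ (hermitian conjugate $(X^\dagger)_{ij}=\overline{X_{ji}}$) with product $A\cdot B=AB+BA$; $H_3'(\mathbb{K})$ is its subspace of traceless matrices. Tits's Lie algebra is $L_3(\mathbb{K}_1,\mathbb{K}_2)=\mathrm{Der}\,H_3(\mathbb{K}_1)\,\dot{+}\,H_3'(\mathbb{K}_1)\otimes\mathbb{K}_2'\,\dot{+}\,\mathrm{Der}\,\mathbb{K}_2$, in which $\mathrm{Der}\,H_3(\mathbb{K}_1)$ and $\mathrm{Der}\,\mathbb{K}_2$ are Lie subalgebras and $[D,A\otimes x]=D(A)\otimes x$, $[E,A\otimes x]=A\otimes E(x)$, $[D,E]=0$, $[A\otimes x,B\otimes y]=\frac16\langle A,B\rangle D_{x,y}+(A\ast B)\otimes\frac12[x,y]-\langle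 x,y\rangle[L_A,L_B]$, for $D\in\mathrm{Der}\,H_3(\mathbb{K}_1)$, $E\in\mathrm{Der}\,\mathbb{K}_2$, $A,B\in H_3'(\mathbb{K}_1)$, $x,y\in\mathbb{K}_2'$. Here $\langle A,B\rangle=\mathrm{Re}\,\mathrm{tr}(A\cdot B)$, $A\ast B=A\cdot B-\frac13\mathrm{tr}(A\cdot B)I$, and $L_A$ is multiplication by $A$ in the Jordan algebra $H_3(\mathbb{K}_1)$. *)

theory Defs
  imports "HOL-Analysis.Analysis" "HOL-Library.Function_Algebras"
begin

section \<open>Linear algebra\<close>

instantiation "fun" :: (type, real_vector) real_vector
begin

definition "scaleR r f = (\<lambda>x. r *\<^sub>R f x)"

instance
  by standard (simp_all add: scaleR_fun_def plus_fun_def fun_eq_iff scaleR_add_right scaleR_add_left)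

end

lemma scaleR_fun_apply [simp]: "(r *\<^sub>R f) x = r *\<^sub>R f x"
  by (simp add: scaleR_fun_def)

subsection \<open>The algebraic tensor product of real vector spaces\<close>

text \<open>The quotient of the free real vector space on \<open>'a \<times> 'b\<close> (realised as the span of the point
  masses in \<open>'a \<times> 'b \<Rightarrow> real\<close>) by the subspace that the bilinearity relations generate.\<close>

definition point_mass :: "'a \<Rightarrow> 'b \<Rightarrow> 'a \<times> 'b \<Rightarrow> real" where
  "point_mass a b = (\<lambda>p. if p = (a, b) then 1 else 0)"

definition tensor_free :: "('a \<times> 'b \<Rightarrow> real) set" where
  "tensor_free = span (range (\<lambda>(a, b). point_mass a b))"

definition tensor_relators :: "('a::real_vector \<times> 'b::real_vector \<Rightarrow> real) set" where
  "tensor_relators =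
     {point_mass (a + a') b - point_mass a b - point_mass a' b | a a' b. True} \<union>
     {point_mass a (b + b') - point_mass a b - point_mass a b' | a b b'. True} \<union>
     {point_mass (r *\<^sub>R a) b - r *\<^sub>R point_mass a b | r a b. True} \<union>
     {point_mass a (r *\<^sub>R b) - r *\<^sub>R point_mass a b | r a b. True}"

definition tensor_rel ::
    "('a::real_vector \<times> 'b::real_vector \<Rightarrow> real) \<Rightarrow> ('a \<times> 'b \<Rightarrow> real) \<Rightarrow> bool" where
  "tensor_rel f g \<longleftrightarrow> f \<in> tensor_free \<and> g \<in> tensor_free \<and> f - g \<in> span tensor_relators"

lemma point_mass_free: "point_mass a b \<in> tensor_free"
  unfolding tensor_free_def by (rule span_base) auto

lemma part_equivp_tensor_rel: "part_equivp (tensor_rel :: ('a::real_vector \<times> 'b::real_vector \<Rightarrow> real) \<Rightarrow> _)"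
proof (rule part_equivpI)
  show "\<exists>f :: 'a \<times> 'b \<Rightarrow> real. tensor_rel f f"
    by (rule exI [of _ 0]) (simp add: tensor_rel_def tensor_free_def span_zero)
  show "symp (tensor_rel :: ('a \<times> 'b \<Rightarrow> real) \<Rightarrow> _)"
    unfolding symp_def tensor_rel_def by (metis minus_diff_eq span_neg)
  show "transp (tensor_rel :: ('a \<times> 'b \<Rightarrow> real) \<Rightarrow> _)"
  proof (rule transpI)
    fix f g h :: "'a \<times> 'b \<Rightarrow> real"
    assume "tensor_rel f g" "tensor_rel g h"
    moreover have "f - h = (f - g) + (g - h)"
      by (simp add: fun_eq_iff)
    ultimately show "tensor_rel f h"
      unfolding tensor_rel_def by (metis span_add)
  qed
qed

quotient_type (overloaded) ('a, 'b) tensor =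
    "'a::real_vector \<times> 'b::real_vector \<Rightarrow> real" / partial: tensor_rel
  by (rule part_equivp_tensor_rel)

instantiation tensor :: (real_vector, real_vector) real_vector
begin

lift_definition zero_tensor :: "('a, 'b) tensor" is 0
  by (simp add: tensor_rel_def tensor_free_def span_zero)

lift_definition plus_tensor :: "('a, 'b) tensor \<Rightarrow> ('a, 'b) tensor \<Rightarrow> ('a, 'b) tensor"
  is "\<lambda>f g. f + g"
  unfolding tensor_rel_def tensor_free_def by (simp add: add_diff_add span_add)

lift_definition uminus_tensor :: "('a, 'b) tensor \<Rightarrow> ('a, 'b) tensor" is "\<lambda>f. - f"
proof -
  fix f g :: "'a \<times> 'b \<Rightarrow> real"
  assume "tensor_rel f g"
  moreover have "- f - - g = - (f - g)"
    by (rule ext) simp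
  ultimately show "tensor_rel (- f) (- g)"
    unfolding tensor_rel_def tensor_free_def by (simp only: span_neg simp_thms)
qed

lift_definition minus_tensor :: "('a, 'b) tensor \<Rightarrow> ('a, 'b) tensor \<Rightarrow> ('a, 'b) tensor"
  is "\<lambda>f g. f - g"
proof -
  fix f f' g g' :: "'a \<times> 'b \<Rightarrow> real"
  assume "tensor_rel f f'" "tensor_rel g g'"
  moreover have "f - g - (f' - g') = (f - f') - (g - g')"
    by (rule ext) simp
  ultimately show "tensor_rel (f - g) (f' - g')"
    unfolding tensor_rel_def tensor_free_def by (simp only: span_diff simp_thms)
qed

lift_definition scaleR_tensor :: "real \<Rightarrow> ('a, 'b) tensor \<Rightarrow> ('a, 'b) tensor"
  is "\<lambda>r f. r *\<^sub>R f"
  unfolding tensor_rel_def tensor_free_def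
  by (simp only: scaleR_diff_right [symmetric] span_scale simp_thms)

instance
proof
  note rel = tensor_rel_def tensor_free_def
  fix a b c :: "('a, 'b) tensor" and r s :: real
  show "a + b + c = a + (b + c)"
    by transfer (simp add: rel span_zero span_add add.assoc)
  show "a + b = b + a"
    by transfer (simp add: rel span_zero span_add add.commute)
  show "0 + a = a"
    by transfer (simp add: rel span_zero)
  show "- a + a = 0"
    by transfer (simp add: rel span_zero)
  show "a - b = a + - b"
    by transfer (simp add: rel span_zero span_diff)
  show "r *\<^sub>R (a + b) = r *\<^sub>R a + r *\<^sub>R b"
    by transfer (simp add: rel span_zero span_add span_scale scaleR_add_right)
  show "(r + s) *\<^sub>R a = r *\<^sub>R a + s *\<^sub>R a"
    by transfer (simp add: rel span_zero span_add span_scale scaleR_add_left)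
  show "r *\<^sub>R s *\<^sub>R a = (r * s) *\<^sub>R a"
    by transfer (simp add: rel span_zero span_scale)
  show "1 *\<^sub>R a = a"
    by transfer (simp add: rel span_zero)
qed

end

lift_definition tensor_pure :: "'a::real_vector \<Rightarrow> 'b::real_vector \<Rightarrow> ('a, 'b) tensor"
    (infixr "\<otimes>" 75) is point_mass
  by (simp add: tensor_rel_def point_mass_free span_zero)

lemma bilinear_tensor_pure: "bilinear (\<lambda>a b. a \<otimes> b)"
proof -
  note free = point_mass_free point_mass_free [THEN span_add [of _ "range (\<lambda>(a, b). point_mass a b)",
      folded tensor_free_def], OF point_mass_free]
    point_mass_free [THEN span_scale [of _ "range (\<lambda>(a, b). point_mass a b)", folded tensor_free_def]]
  have 1: "(a + a') \<otimes> b = a \<otimes> b + a' \<otimes> b" for a a' :: 'a and b :: 'b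
  proof transfer
    fix a a' :: 'a and b :: 'b
    have "point_mass (a + a') b - (point_mass a b + point_mass a' b) \<in> tensor_relators"
      unfolding tensor_relators_def diff_diff_eq [symmetric] by blast
    then show "tensor_rel (point_mass (a + a') b) (point_mass a b + point_mass a' b)"
      unfolding tensor_rel_def by (intro conjI free span_base)
  qed
  have 2: "a \<otimes> (b + b') = a \<otimes> b + a \<otimes> b'" for a :: 'a and b b' :: 'b
  proof transfer
    fix a :: 'a and b b' :: 'b
    have "point_mass a (b + b') - (point_mass a b + point_mass a b') \<in> tensor_relators"
      unfolding tensor_relators_def diff_diff_eq [symmetric] by blast
    then show "tensor_rel (point_mass a (b + b')) (point_mass a b + point_mass a b')"
      unfolding tensor_rel_def by (intro conjI free span_base)
  qed
  have 3: "(r *\<^sub>R a) \<otimes> b = r *\<^sub>R (a \<otimes> b)" for r :: real and a :: 'a and b :: 'b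
  proof transfer
    fix r :: real and a :: 'a and b :: 'b
    have "point_mass (r *\<^sub>R a) b - (r *\<^sub>R point_mass a b) \<in> tensor_relators"
      unfolding tensor_relators_def diff_diff_eq [symmetric] by blast
    then show "tensor_rel (point_mass (r *\<^sub>R a) b) (r *\<^sub>R point_mass a b)"
      unfolding tensor_rel_def by (intro conjI free span_base)
  qed
  have 4: "a \<otimes> (r *\<^sub>R b) = r *\<^sub>R (a \<otimes> b)" for r :: real and a :: 'a and b :: 'b
  proof transfer
    fix r :: real and a :: 'a and b :: 'b
    have "point_mass a (r *\<^sub>R b) - (r *\<^sub>R point_mass a b) \<in> tensor_relators"
      unfolding tensor_relators_def diff_diff_eq [symmetric] by blast
    then show "tensor_rel (point_mass a (r *\<^sub>R b)) (r *\<^sub>R point_mass a b)"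
      unfolding tensor_rel_def by (intro conjI free span_base)
  qed
  show ?thesis
    unfolding bilinear_def by (auto intro!: linearI simp: 1 2 3 4)
qed

lemma span_tensor_pure: "span (range (\<lambda>(a, b). a \<otimes> b)) = UNIV"
proof -
  let ?S = "span (range (\<lambda>(a :: 'a, b :: 'b). a \<otimes> b))"
  have *: "f \<in> tensor_free \<and> abs_tensor f \<in> ?S"
    if "f \<in> span (range (\<lambda>(a, b). point_mass a b))" for f :: "'a \<times> 'b \<Rightarrow> real"
    using that
  proof (induction f rule: span_induct_alt)
    case base
    have "abs_tensor 0 \<in> ?S"
      unfolding zero_tensor.abs_eq [symmetric] by (rule span_zero)
    moreover have "(0 :: 'a \<times> 'b \<Rightarrow> real) \<in> tensor_free"
      unfolding tensor_free_def by (rule span_zero)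
    ultimately show ?case by (rule conjI [rotated])
  next
    case (step c x y)
    then obtain a b where x: "x = point_mass a b" by auto
    have fx: "x \<in> tensor_free"
      by (simp add: x point_mass_free)
    have fc: "c *\<^sub>R x \<in> tensor_free"
      using fx unfolding tensor_free_def by (rule span_scale)
    have fy: "y \<in> tensor_free"
      using step.IH ..
    have rx: "tensor_rel x x" and ry: "tensor_rel y y" and rc: "tensor_rel (c *\<^sub>R x) (c *\<^sub>R x)"
      using fx fc fy by (simp_all add: tensor_rel_def span_zero)
    have "abs_tensor (c *\<^sub>R x + y) = abs_tensor (c *\<^sub>R x) + abs_tensor y"
      using plus_tensor.abs_eq [OF rc ry] by (rule sym)
    also have "abs_tensor (c *\<^sub>R x) = c *\<^sub>R abs_tensor x"
      using scaleR_tensor.abs_eq [OF rx] by (rule sym)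
    also have "abs_tensor x = a \<otimes> b"
      by (simp add: x tensor_pure.abs_eq)
    finally have "abs_tensor (c *\<^sub>R x + y) = c *\<^sub>R (a \<otimes> b) + abs_tensor y" .
    moreover have "a \<otimes> b \<in> ?S"
      by (rule span_base) auto
    ultimately have "abs_tensor (c *\<^sub>R x + y) \<in> ?S"
      using step.IH by (simp only: span_add span_scale simp_thms)
    moreover have "c *\<^sub>R x + y \<in> tensor_free"
      using fc fy unfolding tensor_free_def by (rule span_add)
    ultimately show ?case by (rule conjI [rotated])
  qed
  have "t \<in> ?S" for t
  proof (induction t rule: tensor.abs_induct)
    case (1 f)
    then show ?case
      using * [of f] by (simp add: tensor_rel_def tensor_free_def)
  qed
  then show ?thesis by blast
qed

text \<open>The linear map out of the tensor product that a bilinear map induces.\<close>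

definition tensor_lift ::
    "('a::real_vector \<Rightarrow> 'b::real_vector \<Rightarrow> 'c::real_vector) \<Rightarrow> ('a, 'b) tensor \<Rightarrow> 'c" where
  "tensor_lift f = (THE g. linear g \<and> (\<forall>a b. g (a \<otimes> b) = f a b))"

lemma tensor_linear_eqI:
  assumes "linear g" "linear h" "\<And>a b. g (a \<otimes> b) = h (a \<otimes> b)"
  shows "g = h"
proof
  fix t
  show "g t = h t"
    by (rule linear_eq_on [OF assms(1,2), of t "range (\<lambda>(a, b). a \<otimes> b)"])
      (use assms(3) span_tensor_pure in auto)
qed

lemma independent_point_mass: "independent (range (\<lambda>(a, b). point_mass a b))"
proof -
  have "f (a, b) = 0" if "f \<in> span (range (\<lambda>(a, b). point_mass a b) - {point_mass a b})" for f a b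
    using that
  proof (induction f rule: span_induct_alt)
    case base
    then show ?case by simp
  next
    case (step c x y)
    then show ?case by (auto simp: point_mass_def split: if_splits)
  qed
  moreover have "point_mass a b (a, b) \<noteq> 0" for a b
    by (simp add: point_mass_def)
  ultimately show ?thesis
    unfolding dependent_def by fastforce
qed

lemma tensor_lift_ex:
  assumes f: "bilinear f"
  shows "\<exists>g. linear g \<and> (\<forall>a b. g (a \<otimes> b) = f a b)"
proof -
  define P where "P = inv (\<lambda>(a :: 'a, b :: 'b). point_mass a b)"
  have "inj (\<lambda>(a :: 'a, b :: 'b). point_mass a b)"
  proof (rule injI)
    fix p q :: "'a \<times> 'b"
    assume "(\<lambda>(a, b). point_mass a b) p = (\<lambda>(a, b). point_mass a b) q"
    then have "(\<lambda>(a, b). point_mass a b) p q = (1 :: real)"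
      by (simp add: point_mass_def split: prod.splits)
    then show "p = q"
      by (simp add: point_mass_def split: prod.splits if_splits)
  qed
  from inv_f_f [OF this] have P: "P (point_mass a b) = (a, b)" for a b
    unfolding P_def by (metis (no_types, lifting) case_prod_conv)
  obtain G where G: "linear G"
      "\<forall>x\<in>range (\<lambda>(a, b). point_mass a b). G x = (case P x of (a, b) \<Rightarrow> f a b)"
    using linear_independent_extend [OF independent_point_mass, of "\<lambda>x. case P x of (a, b) \<Rightarrow> f a b"]
    by (elim exE conjE) (rule that)
  have Gp: "G (point_mass a b) = f a b" for a b
  proof -
    have "point_mass a b \<in> range (\<lambda>(a, b). point_mass a b)" by auto
    then have "G (point_mass a b) = (case P (point_mass a b) of (a, b) \<Rightarrow> f a b)"
      using G(2) by blast
    then show ?thesis by (simp add: P)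
  qed
  have ker: "G h = 0" if "h \<in> span tensor_relators" for h
  proof (rule linear_eq_0_on_span [OF G(1) _ that])
    fix x :: "'a \<times> 'b \<Rightarrow> real"
    assume "x \<in> tensor_relators"
    then consider a a' b where "x = point_mass (a + a') b - point_mass a b - point_mass a' b"
      | a b b' where "x = point_mass a (b + b') - point_mass a b - point_mass a b'"
      | r a b where "x = point_mass (r *\<^sub>R a) b - r *\<^sub>R point_mass a b"
      | r a b where "x = point_mass a (r *\<^sub>R b) - r *\<^sub>R point_mass a b"
      unfolding tensor_relators_def by blast
    then show "G x = 0"
      by cases (simp_all only: linear_diff [OF G(1)] linear_scale [OF G(1)] Gp
          bilinear_ladd [OF f] bilinear_radd [OF f] bilinear_lmul [OF f] bilinear_rmul [OF f]
          diff_add_cancel add_diff_cancel_left' diff_self)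
  qed
  have eq: "G (rep_tensor (abs_tensor h)) = G h" if "tensor_rel h h" for h
  proof -
    have "tensor_rel (rep_tensor (abs_tensor h)) h"
      using Quotient3_rep_abs [OF Quotient3_tensor] that by blast
    then have "G (rep_tensor (abs_tensor h) - h) = 0"
      unfolding tensor_rel_def using ker by blast
    then show ?thesis
      by (simp only: linear_diff [OF G(1)] right_minus_eq)
  qed
  have rep: "\<exists>h. t = abs_tensor h \<and> tensor_rel h h" for t
  proof (induction t rule: tensor.abs_induct)
    case (1 h)
    then show ?case by (intro exI [of _ h] conjI refl)
  qed
  have "linear (\<lambda>t. G (rep_tensor t))"
  proof (rule linearI)
    fix s t :: "('a, 'b) tensor"
    obtain h k where hk: "s = abs_tensor h" "tensor_rel h h" "t = abs_tensor k" "tensor_rel k k"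
      using rep [of s] rep [of t] by blast
    have "tensor_rel (h + k) (h + k)"
      using hk(2,4) unfolding tensor_rel_def tensor_free_def by (simp only: span_add diff_self span_zero simp_thms)
    then show "G (rep_tensor (s + t)) = G (rep_tensor s) + G (rep_tensor t)"
      by (simp only: hk(1,3) plus_tensor.abs_eq [OF hk(2,4)] eq hk(2,4) linear_add [OF G(1)])
  next
    fix r and t :: "('a, 'b) tensor"
    obtain k where k: "t = abs_tensor k" "tensor_rel k k"
      using rep [of t] by blast
    have "tensor_rel (r *\<^sub>R k) (r *\<^sub>R k)"
      using k(2) unfolding tensor_rel_def tensor_free_def by (simp only: span_scale diff_self span_zero simp_thms)
    then show "G (rep_tensor (r *\<^sub>R t)) = r *\<^sub>R G (rep_tensor t)"
      by (simp only: k(1) scaleR_tensor.abs_eq [OF k(2)] eq k(2) linear_scale [OF G(1)])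
  qed
  moreover have "G (rep_tensor (a \<otimes> b)) = f a b" for a b
  proof -
    have "tensor_rel (point_mass a b) (point_mass a b)"
      unfolding tensor_rel_def diff_self by (intro conjI point_mass_free span_zero)
    then show ?thesis
      by (simp only: tensor_pure.abs_eq eq Gp)
  qed
  ultimately show ?thesis by blast
qed

lemma
  assumes "bilinear f"
  shows linear_tensor_lift: "linear (tensor_lift f)"
    and tensor_lift_pure: "tensor_lift f (a \<otimes> b) = f a b"
proof -
  have "\<exists>!g. linear g \<and> (\<forall>a b. g (a \<otimes> b) = f a b)"
    using tensor_lift_ex [OF assms] tensor_linear_eqI by (metis (no_types, lifting))
  from theI' [OF this]
  show "linear (tensor_lift f)" "tensor_lift f (a \<otimes> b) = f a b"
    unfolding tensor_lift_def by blast+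
qed

definition tensor_map ::
    "('a::real_vector \<Rightarrow> 'c::real_vector) \<Rightarrow> ('b::real_vector \<Rightarrow> 'd::real_vector) \<Rightarrow>
     ('a, 'b) tensor \<Rightarrow> ('c, 'd) tensor" where
  "tensor_map f g = tensor_lift (\<lambda>a b. f a \<otimes> g b)"

lemma tensor_map_pure:
  assumes "linear f" "linear g"
  shows "tensor_map f g (a \<otimes> b) = f a \<otimes> g b"
proof -
  have "bilinear (\<lambda>a b. f a \<otimes> g b)"
    using bilinear_tensor_pure assms unfolding bilinear_def
    by (auto intro: linear_compose [unfolded o_def])
  then show ?thesis
    unfolding tensor_map_def by (rule tensor_lift_pure)
qed

text \<open>Bilinear extension of a map given on pairs of pure tensors.\<close>

definition tensor_lift2 ::
    "('a::real_vector \<Rightarrow> 'b::real_vector \<Rightarrow> 'c::real_vector \<Rightarrow> 'd::real_vector \<Rightarrow> 'e::real_vector) \<Rightarrow>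
     ('a, 'b) tensor \<Rightarrow> ('c, 'd) tensor \<Rightarrow> 'e" where
  "tensor_lift2 f u v = tensor_lift (\<lambda>a b. tensor_lift (f a b) v) u"

lemma
  assumes "\<And>a b. bilinear (f a b)" and "\<And>c d. bilinear (\<lambda>a b. f a b c d)"
  shows bilinear_tensor_lift2: "bilinear (tensor_lift2 f)"
    and tensor_lift2_pure: "tensor_lift2 f (a \<otimes> b) (c \<otimes> d) = f a b c d"
proof -
  have lin: "linear (\<lambda>v. tensor_lift (f a b) v)" for a b
    using linear_tensor_lift [OF assms(1)] .
  have bil: "bilinear (\<lambda>a b. tensor_lift (f a b) v)" for v
  proof -
    have "v \<in> span (range (\<lambda>(c, d). c \<otimes> d))"
      by (simp add: span_tensor_pure)
    then show ?thesis
    proof (induction v rule: span_induct_alt)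
      case base
      then show ?case
        by (simp add: linear_0 [OF lin] bilinear_def linear_zero)
    next
      case (step r x y)
      then obtain c d where x: "x = c \<otimes> d" by auto
      have "tensor_lift (f a b) (r *\<^sub>R x + y) = r *\<^sub>R f a b c d + tensor_lift (f a b) y" for a b
        by (simp add: x linear_add [OF lin] linear_scale [OF lin] tensor_lift_pure [OF assms(1)])
      then show ?case
        using step.IH assms(2) [of c d] unfolding bilinear_def
        by (auto intro!: linear_compose_add linear_compose_scale_right)
    qed
  qed
  show "bilinear (tensor_lift2 f)"
    unfolding bilinear_def tensor_lift2_def
  proof (intro conjI allI)
    show "linear (\<lambda>u. tensor_lift (\<lambda>a b. tensor_lift (f a b) v) u)" for v
      using linear_tensor_lift [OF bil] .
    fix u :: "('a, 'b) tensor"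
    have "u \<in> span (range (\<lambda>(a, b). a \<otimes> b))"
      by (simp add: span_tensor_pure)
    then show "linear (\<lambda>v. tensor_lift (\<lambda>a b. tensor_lift (f a b) v) u)"
    proof (induction u rule: span_induct_alt)
      case base
      then show ?case
        by (simp add: linear_0 [OF linear_tensor_lift [OF bil]] linear_zero)
    next
      case (step r x y)
      then obtain a b where x: "x = a \<otimes> b" by auto
      show ?case
        using step.IH lin [of a b]
        by (auto simp: x linear_add [OF linear_tensor_lift [OF bil]]
            linear_scale [OF linear_tensor_lift [OF bil]] tensor_lift_pure [OF bil]
            intro!: linear_compose_add linear_compose_scale_right)
    qed
  qed
  show "tensor_lift2 f (a \<otimes> b) (c \<otimes> d) = f a b c d"
    by (simp add: tensor_lift2_def tensor_lift_pure [OF assms(2)] tensor_lift_pure [OF assms(1)])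
qed

subsection \<open>Lie algebras and derivations\<close>

locale lie_algebra_on =
  fixes L :: "'a::real_vector set" and br :: "'a \<Rightarrow> 'a \<Rightarrow> 'a"
  assumes subspace: "subspace L"
    and closed: "x \<in> L \<Longrightarrow> y \<in> L \<Longrightarrow> br x y \<in> L"
    and add_left: "x \<in> L \<Longrightarrow> y \<in> L \<Longrightarrow> z \<in> L \<Longrightarrow> br (x + y) z = br x z + br y z"
    and add_right: "x \<in> L \<Longrightarrow> y \<in> L \<Longrightarrow> z \<in> L \<Longrightarrow> br x (y + z) = br x y + br x z"
    and scaleR_left: "x \<in> L \<Longrightarrow> y \<in> L \<Longrightarrow> br (r *\<^sub>R x) y = r *\<^sub>R br x y"
    and scaleR_right: "x \<in> L \<Longrightarrow> y \<in> L \<Longrightarrow> br x (r *\<^sub>R y) = r *\<^sub>R br x y"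
    and alternating: "x \<in> L \<Longrightarrow> br x x = 0"
    and jacobi: "x \<in> L \<Longrightarrow> y \<in> L \<Longrightarrow> z \<in> L \<Longrightarrow>
      br x (br y z) + br y (br z x) + br z (br x y) = 0"

definition lie_isomorphic ::
    "'a::real_vector set \<Rightarrow> ('a \<Rightarrow> 'a \<Rightarrow> 'a) \<Rightarrow> 'b::real_vector set \<Rightarrow> ('b \<Rightarrow> 'b \<Rightarrow> 'b) \<Rightarrow> bool" where
  "lie_isomorphic L br L' br' \<longleftrightarrow>
     lie_algebra_on L br \<and> lie_algebra_on L' br' \<and>
     (\<exists>f. bij_betw f L L' \<and>
       (\<forall>x\<in>L. \<forall>y\<in>L. f (x + y) = f x + f y) \<and>
       (\<forall>r. \<forall>x\<in>L. f (r *\<^sub>R x) = r *\<^sub>R f x) \<and>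
       (\<forall>x\<in>L. \<forall>y\<in>L. f (br x y) = br' (f x) (f y)))"

definition commutator :: "('a \<Rightarrow> 'a) \<Rightarrow> ('a \<Rightarrow> 'a) \<Rightarrow> 'a \<Rightarrow> 'a::real_vector" where
  "commutator f g = (f \<circ> g) - (g \<circ> f)"

lemma commutator_zero: "linear f \<Longrightarrow> commutator f 0 = 0" "commutator 0 0 = 0"
  by (simp_all add: commutator_def fun_eq_iff linear_0)

definition derivations :: "('a::real_vector \<Rightarrow> 'a \<Rightarrow> 'a) \<Rightarrow> ('a \<Rightarrow> 'a) set" where
  "derivations m = {D. linear D \<and> (\<forall>x y. D (m x y) = m (D x) y + m x (D y))}"


section \<open>Composition algebras\<close>

class composition_algebra = real_vector + times + zero_neq_one +
  fixes nsq :: "'a \<Rightarrow> real"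
  assumes mult_add_l: "(x + y) * z = x * z + y * z"
    and mult_add_r: "x * (y + z) = x * y + x * z"
    and mult_scaleR_l: "(r *\<^sub>R x) * y = r *\<^sub>R (x * y)"
    and mult_scaleR_r: "x * (r *\<^sub>R y) = r *\<^sub>R (x * y)"
    and mult_one_l: "1 * x = x"
    and mult_one_r: "x * 1 = x"
    and nsq_scaleR: "nsq (r *\<^sub>R x) = r\<^sup>2 * nsq x"
    and nsq_polar_add: "nsq (x + y + z) - nsq (x + y) - nsq z =
      (nsq (x + z) - nsq x - nsq z) + (nsq (y + z) - nsq y - nsq z)"
    and nsq_polar_scaleR: "nsq (r *\<^sub>R x + y) - nsq (r *\<^sub>R x) - nsq y =
      r * (nsq (x + y) - nsq x - nsq y)"
    and nsq_nondegenerate: "(\<forall>y. nsq (x + y) - nsq x - nsq y = 0) \<Longrightarrow> x = 0"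
    and nsq_mult: "nsq (x * y) = nsq x * nsq y"

instantiation real :: composition_algebra
begin

definition "nsq (x::real) = x\<^sup>2"

instance
proof
  fix x y z r :: real
  show "(x + y) * z = x * z + y * z" "x * (y + z) = x * y + x * z"
    by (simp_all add: algebra_simps)
  show "nsq (x + y + z) - nsq (x + y) - nsq z =
      (nsq (x + z) - nsq x - nsq z) + (nsq (y + z) - nsq y - nsq z)"
    "nsq (r *\<^sub>R x + y) - nsq (r *\<^sub>R x) - nsq y = r * (nsq (x + y) - nsq x - nsq y)"
    by (simp_all add: nsq_real_def power2_eq_square algebra_simps)
  assume "\<forall>y. nsq (x + y) - nsq x - nsq y = 0"
  from this [THEN spec, of x] show "x = 0"
    by (simp add: nsq_real_def power2_eq_square algebra_simps)
qed (simp_all add: nsq_real_def power_mult_distrib)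

end

instantiation complex :: composition_algebra
begin

definition "nsq (x::complex) = (cmod x)\<^sup>2"

instance
proof
  fix x y z :: complex and r :: real
  show "(x + y) * z = x * z + y * z" "x * (y + z) = x * y + x * z"
    by (simp_all add: distrib_left distrib_right)
  show "nsq (x + y + z) - nsq (x + y) - nsq z =
      (nsq (x + z) - nsq x - nsq z) + (nsq (y + z) - nsq y - nsq z)"
    "nsq (r *\<^sub>R x + y) - nsq (r *\<^sub>R x) - nsq y = r * (nsq (x + y) - nsq x - nsq y)"
    unfolding nsq_complex_def cmod_power2 by (simp_all add: power2_eq_square algebra_simps)
  assume "\<forall>y. nsq (x + y) - nsq x - nsq y = 0"
  from this [THEN spec, of x] show "x = 0"
    by (simp add: nsq_complex_def norm_mult power_mult_distrib mult_2 [symmetric])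
qed (simp_all add: nsq_complex_def norm_mult power_mult_distrib)

end

text \<open>The inner product \<open>\<langle>x, y\<rangle>\<close>; then \<open>\<real> 1\<close>, its orthogonal complement \<open>im_space\<close>, the
  coefficient \<open>rp x\<close> of \<open>1\<close> in the orthogonal projection onto \<open>\<real> 1\<close>, and conjugation.\<close>

definition ip :: "'a::composition_algebra \<Rightarrow> 'a \<Rightarrow> real" where
  "ip x y = (nsq (x + y) - nsq x - nsq y) / 2"

definition im_space :: "'a::composition_algebra set" where
  "im_space = {x. ip x 1 = 0}"

definition rp :: "'a::composition_algebra \<Rightarrow> real" where
  "rp x = ip x 1"

definition im_part :: "'a::composition_algebra \<Rightarrow> 'a" where
  "im_part x = x - rp x *\<^sub>R 1"

definition cj :: "'a::composition_algebra \<Rightarrow> 'a" where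
  "cj x = rp x *\<^sub>R 1 - im_part x"

lemma ip_commute: "ip x y = ip y x"
  by (simp add: ip_def add.commute)

lemma ip_add_l: "ip (x + y) z = ip x z + ip y z"
  using nsq_polar_add [of x y z] by (simp add: ip_def field_simps)

lemma ip_scaleR_l: "ip (r *\<^sub>R x) z = r * ip x z"
  using nsq_polar_scaleR [of r x z] by (simp add: ip_def field_simps)

lemma bilinear_ip: "bilinear ip"
  unfolding bilinear_def
proof (intro conjI allI)
  show "linear (\<lambda>x. ip x y)" for y :: 'a
    by (rule linearI) (simp_all add: ip_add_l ip_scaleR_l)
  moreover have "ip x = (\<lambda>y. ip y x)" for x :: 'a
    by (rule ext) (rule ip_commute)
  ultimately show "linear (ip x)" for x :: 'a
    by metis
qed

lemmas ip_simps = bilinear_ladd [OF bilinear_ip] bilinear_radd [OF bilinear_ip]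
  bilinear_lsub [OF bilinear_ip] bilinear_rsub [OF bilinear_ip]
  bilinear_lmul [OF bilinear_ip] bilinear_rmul [OF bilinear_ip]

lemma ip_eqI:
  assumes "\<And>z. ip x z = ip y z"
  shows "x = y"
proof -
  have "ip (x - y) z = 0" for z
    using assms by (simp add: ip_simps)
  then have "x - y = 0"
    by (intro nsq_nondegenerate) (simp add: ip_def)
  then show ?thesis by simp
qed

lemma ip_self: "ip x x = nsq x"
  using nsq_scaleR [of 2 x] by (simp add: ip_def scaleR_2)

lemma nsq_one: "nsq (1::'a::composition_algebra) = 1"
proof (rule ccontr)
  assume 1: "nsq (1::'a) \<noteq> 1"
  have "nsq (1::'a) * nsq (1::'a) = nsq (1::'a)"
    by (metis mult_one_l nsq_mult)
  with 1 have "nsq (1::'a) = 0" by auto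
  then have "nsq x = 0" for x :: 'a
    by (metis mult_one_l mult_zero_left nsq_mult)
  then have "ip (1::'a) z = ip 0 z" for z
    by (simp add: ip_def)
  then have "(1::'a) = 0"
    by (rule ip_eqI)
  then show False by simp
qed

lemma im_part_im_space: "im_part x \<in> im_space"
  by (simp add: im_part_def im_space_def ip_simps rp_def ip_self nsq_one)

lemma cj_alt: "cj x = (2 * ip x 1) *\<^sub>R 1 - x"
  by (simp only: cj_def im_part_def rp_def mult_2 scaleR_add_left diff_diff_eq2)

lemma linear_cj: "linear cj"
proof (rule linearI)
  show "cj (x + y) = cj x + cj y" for x y :: 'a
    by (simp only: cj_alt ip_simps distrib_left scaleR_add_left add_diff_add)
  show "cj (r *\<^sub>R x) = r *\<^sub>R cj x" for r and x :: 'a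
    by (simp only: cj_alt ip_simps real_scaleR_def scaleR_diff_right scaleR_scaleR mult.left_commute)
qed

lemma cj_cj [simp]: "cj (cj x) = x"
  by (simp add: cj_alt ip_simps ip_self nsq_one)

lemma ip_cj_cj: "ip (cj x) (cj y) = ip x y"
  using ip_commute [of 1 y] by (simp add: cj_alt ip_simps ip_self nsq_one)

lemma bilinear_mult: "bilinear ((*) :: 'a::composition_algebra \<Rightarrow> 'a \<Rightarrow> 'a)"
  unfolding bilinear_def
  by (auto intro!: linearI simp: mult_add_l mult_add_r mult_scaleR_l mult_scaleR_r)

lemmas ca_mult_simps = bilinear_ladd [OF bilinear_mult] bilinear_radd [OF bilinear_mult]
  bilinear_lsub [OF bilinear_mult] bilinear_rsub [OF bilinear_mult]
  bilinear_lmul [OF bilinear_mult] bilinear_rmul [OF bilinear_mult]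

lemma ip_mult_mult: "ip (x * y) (x' * y') + ip (x * y') (x' * y) = 2 * ip x x' * ip y y'"
proof -
  have 1: "ip (x * y) (x' * y) = ip x x' * nsq y" for x x' y
    by (simp only: ip_def mult_add_l [symmetric] nsq_mult left_diff_distrib [symmetric] times_divide_eq_left)
  have "ip (x * (y + y')) (x' * (y + y')) = ip x x' * nsq (y + y')"
    by (rule 1)
  moreover have "nsq (y + y') = nsq y + nsq y' + 2 * ip y y'"
    by (simp add: ip_def field_simps)
  ultimately have "ip (x * y) (x' * y) + ip (x * y') (x' * y) + (ip (x * y) (x' * y') + ip (x * y') (x' * y')) =
      ip x x' * (nsq y + nsq y' + 2 * ip y y')"
    by (simp only: mult_add_r ip_simps)
  then show ?thesis
    by (simp add: 1 distrib_left)
qed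

lemma ip_mult_left: "ip (x * y) z = ip x (z * cj y)"
  using ip_mult_mult [of x y z 1]
  by (simp add: cj_alt ca_mult_simps ip_simps mult_one_r mult.commute [of "ip y 1"] mult.assoc)

lemma ip_mult_right: "ip (x * y) z = ip y (cj x * z)"
  using ip_mult_mult [of x y 1 z] ip_commute [of y "x * z"]
  by (simp add: cj_alt ca_mult_simps ip_simps mult_one_l)

lemma cj_mult: "cj (x * y) = cj y * cj x"
proof (rule ip_eqI)
  fix z
  have "ip (cj (x * y)) z = ip (x * y) (cj z)"
    using ip_cj_cj [of "x * y" "cj z"] by simp
  also have "\<dots> = ip y (cj x * cj z)"
    by (rule ip_mult_right)
  also have "\<dots> = ip (cj x * cj z) y"
    by (rule ip_commute)
  also have "\<dots> = ip (cj x) (y * z)"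
    by (simp add: ip_mult_left)
  also have "\<dots> = ip (y * z) (cj x)"
    by (rule ip_commute)
  also have "\<dots> = ip z (cj y * cj x)"
    by (rule ip_mult_right)
  also have "\<dots> = ip (cj y * cj x) z"
    by (rule ip_commute)
  finally show "ip (cj (x * y)) z = ip (cj y * cj x) z" .
qed

definition lmul :: "'a::composition_algebra \<Rightarrow> 'a \<Rightarrow> 'a" where
  "lmul x = (\<lambda>z. x * z)"

definition rmul :: "'a::composition_algebra \<Rightarrow> 'a \<Rightarrow> 'a" where
  "rmul x = (\<lambda>z. z * x)"

text \<open>The derivation \<open>D\<^sub>x\<^sub>,\<^sub>y\<close>.\<close>

definition inner_der :: "'a::composition_algebra \<Rightarrow> 'a \<Rightarrow> 'a \<Rightarrow> 'a" where
  "inner_der x y =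
     commutator (lmul x) (lmul y) + commutator (lmul x) (rmul y) + commutator (rmul x) (rmul y)"

lemma bilinear_inner_der: "bilinear inner_der"
  unfolding bilinear_def
  by (auto intro!: linearI
      simp: inner_der_def commutator_def lmul_def rmul_def fun_eq_iff ca_mult_simps algebra_simps)


section \<open>The triality algebra\<close>

type_synonym 'a end3 = "('a \<Rightarrow> 'a) \<times> ('a \<Rightarrow> 'a) \<times> ('a \<Rightarrow> 'a)"

definition so :: "('a::composition_algebra \<Rightarrow> 'a) set" where
  "so = {A. linear A \<and> (\<forall>x y. ip (A x) y = - ip x (A y))}"

definition Tri :: "'a::composition_algebra end3 set" where
  "Tri = {(A, B, C). A \<in> so \<and> B \<in> so \<and> C \<in> so \<and> (\<forall>x y. A (x * y) = x * B y + C x * y)}"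

fun end3_bracket :: "'a::composition_algebra end3 \<Rightarrow> 'a end3 \<Rightarrow> 'a end3" where
  "end3_bracket (A, B, C) (A', B', C') = (commutator A A', commutator B B', commutator C C')"

definition map_bar :: "('a::composition_algebra \<Rightarrow> 'a) \<Rightarrow> 'a \<Rightarrow> 'a" where
  "map_bar A = (\<lambda>x. cj (A (cj x)))"

fun theta :: "'a::composition_algebra end3 \<Rightarrow> 'a end3" where
  "theta (A, B, C) = (map_bar B, C, map_bar A)"

lemma map_bar_map_bar [simp]: "map_bar (map_bar A) = A"
  by (simp add: map_bar_def)

lemma
  shows bij_theta: "bij theta"
    and inv_theta: "inv theta = (\<lambda>(A, B, C). (map_bar C, map_bar A, B))"
proof -
  have *: "(\<lambda>(A, B, C). (map_bar C, map_bar A, B)) \<circ> theta = id"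
    "theta \<circ> (\<lambda>(A, B, C). (map_bar C, map_bar A, B)) = id"
    by (auto simp: fun_eq_iff)
  show "bij theta" "inv theta = (\<lambda>(A, B, C). (map_bar C, map_bar A, B))"
    using o_bij [OF *] inv_unique_comp [OF *(2,1)] by blast+
qed

text \<open>The index set \<open>{1, 2, 3}\<close> is the type \<open>3\<close> of residues modulo 3, so the cyclic permutations of
  \<open>(1, 2, 3)\<close> are the triples \<open>(i, i + 1, i + 2)\<close>. For \<open>T = (A, B, C)\<close> the components
  \<open>T\<^sub>1, T\<^sub>2, T\<^sub>3\<close> are \<open>A\<close>, \<open>map_bar B\<close>, \<open>map_bar C\<close>; and \<open>theta_pow i\<close> is the power \<open>1 - i\<close> of
  \<open>theta\<close>.\<close>

fun tri_comp :: "'a::composition_algebra end3 \<Rightarrow> 3 \<Rightarrow> 'a \<Rightarrow> 'a" where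
  "tri_comp (A, B, C) i = (if i = 1 then A else if i = 2 then map_bar B else map_bar C)"

definition theta_pow :: "3 \<Rightarrow> 'a::composition_algebra end3 \<Rightarrow> 'a end3" where
  "theta_pow i = (if i = 1 then id else if i = 2 then inv theta else inv theta \<circ> inv theta)"

definition S_map :: "'a::composition_algebra \<Rightarrow> 'a \<Rightarrow> 'a \<Rightarrow> 'a" where
  "S_map x y = (\<lambda>z. ip x z *\<^sub>R y - ip y z *\<^sub>R x)"

definition T_elem :: "'a::composition_algebra \<Rightarrow> 'a \<Rightarrow> 'a end3" where
  "T_elem x y =
     (4 *\<^sub>R S_map x y,
      (rmul y \<circ> rmul (cj x)) - (rmul x \<circ> rmul (cj y)),
      (lmul y \<circ> lmul (cj x)) - (lmul x \<circ> lmul (cj y)))"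

lemma bilinear_T_elem: "bilinear T_elem"
  unfolding bilinear_def
  by (auto intro!: linearI simp: T_elem_def S_map_def lmul_def rmul_def fun_eq_iff ca_mult_simps
      ip_simps linear_add [OF linear_cj] linear_scale [OF linear_cj] algebra_simps)

lemma linear_map_bar: "linear map_bar"
  by (rule linearI)
    (simp_all add: map_bar_def fun_eq_iff linear_add [OF linear_cj] linear_scale [OF linear_cj])

lemma linear_theta_pow: "linear (theta_pow i)"
proof -
  have "linear (inv theta)"
    unfolding inv_theta
    by (auto intro!: linearI simp: linear_add [OF linear_map_bar] linear_scale [OF linear_map_bar])
  then show ?thesis
    by (auto simp: theta_pow_def linear_id intro: linear_compose)
qed


section \<open>The triality form of the magic square algebra\<close>

type_synonym ('a, 'b) triality = "'a end3 \<times> 'b end3 \<times> ((('a, 'b) tensor)^3)"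

definition triality_algebra :: "('a::composition_algebra, 'b::composition_algebra) triality set" where
  "triality_algebra = Tri \<times> Tri \<times> UNIV"

text \<open>The inclusion of the \<open>i\<close>-th summand.\<close>

definition F :: "3 \<Rightarrow> ('a::composition_algebra, 'b::composition_algebra) tensor \<Rightarrow> (('a, 'b) tensor)^3" where
  "F i u = axis i u"

definition tri_act :: "'a::composition_algebra end3 \<Rightarrow> 'b::composition_algebra end3 \<Rightarrow>
    (('a, 'b) tensor)^3 \<Rightarrow> (('a, 'b) tensor)^3" where
  "tri_act T U v = (\<chi> i. tensor_map (tri_comp T i) id (v $ i) + tensor_map id (tri_comp U i) (v $ i))"

definition tensor_cross ::
    "('a::composition_algebra, 'b::composition_algebra) tensor \<Rightarrow> ('a, 'b) tensor \<Rightarrow> ('a, 'b) tensor" where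
  "tensor_cross = tensor_lift2 (\<lambda>x\<^sub>1 x\<^sub>2 y\<^sub>1 y\<^sub>2. (cj y\<^sub>1 * cj x\<^sub>1) \<otimes> (cj y\<^sub>2 * cj x\<^sub>2))"

fun triality_bracket ::
    "('a::composition_algebra, 'b::composition_algebra) triality \<Rightarrow> ('a, 'b) triality \<Rightarrow> ('a, 'b) triality" where
  "triality_bracket (T, U, v) (T', U', w) =
     (end3_bracket T T' +
        (\<Sum>i\<in>UNIV. tensor_lift2 (\<lambda>x\<^sub>1 x\<^sub>2 y\<^sub>1 y\<^sub>2. ip x\<^sub>2 y\<^sub>2 *\<^sub>R theta_pow i (T_elem x\<^sub>1 y\<^sub>1)) (v $ i) (w $ i)),
      end3_bracket U U' +
        (\<Sum>i\<in>UNIV. tensor_lift2 (\<lambda>x\<^sub>1 x\<^sub>2 y\<^sub>1 y\<^sub>2. ip x\<^sub>1 y\<^sub>1 *\<^sub>R theta_pow i (T_elem x\<^sub>2 y\<^sub>2)) (v $ i) (w $ i)),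
      tri_act T U w - tri_act T' U' v +
        (\<chi> k. tensor_cross (v $ (k + 1)) (w $ (k + 2)) - tensor_cross (w $ (k + 1)) (v $ (k + 2))))"

lemma linear_tri_comp:
  assumes "T \<in> Tri"
  shows "linear (tri_comp T i)"
proof -
  have "linear (map_bar B)" if "linear B" for B :: "'a \<Rightarrow> 'a"
    using that linear_cj unfolding map_bar_def by (auto intro: linear_compose [unfolded o_def])
  then show ?thesis
    using assms by (auto simp: Tri_def so_def)
qed

lemma tensor_lift_zero:
  fixes u :: "('a::real_vector, 'b::real_vector) tensor"
  shows "tensor_lift (\<lambda>a b. 0 :: 'c::real_vector) u = 0"
proof -
  have b: "bilinear (\<lambda>(a::'a) (b::'b). 0 :: 'c)"
    by (simp add: bilinear_def linear_zero)
  have "tensor_lift (\<lambda>(a::'a) (b::'b). 0 :: 'c) = (\<lambda>_. 0)"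
    using linear_tensor_lift [OF b] tensor_lift_pure [OF b]
    by (intro tensor_linear_eqI) (simp_all only: linear_zero)
  then show ?thesis by (simp add: fun_eq_iff)
qed

lemma tensor_map_zero: "tensor_map 0 g u = 0" "tensor_map f 0 u = 0"
  by (simp_all add: tensor_map_def tensor_lift_zero bilinear_lzero [OF bilinear_tensor_pure]
      bilinear_rzero [OF bilinear_tensor_pure])

lemma linear_tensor_map:
  assumes "linear f" "linear g"
  shows "linear (tensor_map f g)"
proof -
  have "bilinear (\<lambda>a b. f a \<otimes> g b)"
    using bilinear_tensor_pure assms unfolding bilinear_def
    by (auto intro: linear_compose [unfolded o_def])
  then show ?thesis
    using linear_tensor_lift [of "\<lambda>a b. f a \<otimes> g b"] by (simp add: tensor_map_def [abs_def])
qed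

lemma tri_comp_zero: "tri_comp 0 i = 0"
  by (auto simp: zero_prod_def map_bar_def fun_eq_iff linear_0 [OF linear_cj])

lemma zero_Tri: "0 \<in> Tri"
  by (auto simp: Tri_def so_def zero_prod_def linear_zero ip_simps zero_fun_def
      bilinear_lzero [OF bilinear_ip] bilinear_rzero [OF bilinear_ip]
      bilinear_lzero [OF bilinear_mult] bilinear_rzero [OF bilinear_mult])

lemma tri_act_zero: "tri_act 0 0 v = 0"
  by (simp add: tri_act_def tri_comp_zero tensor_map_zero vec_eq_iff)

lemma tri_act_F:
  assumes "T \<in> Tri" "U \<in> Tri"
  shows "tri_act T U (F i (x\<^sub>1 \<otimes> x\<^sub>2)) = F i (tri_comp T i x\<^sub>1 \<otimes> x\<^sub>2 + x\<^sub>1 \<otimes> tri_comp U i x\<^sub>2)"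
  using assms
  by (auto simp: tri_act_def F_def axis_def vec_eq_iff linear_tri_comp linear_id tensor_map_pure
      linear_0 [OF linear_tensor_map])

lemma end3_bracket_zero: "end3_bracket 0 0 = 0"
  by (simp add: zero_prod_def commutator_def fun_eq_iff)

lemma tri_tensor_lift2:
  fixes x\<^sub>1 y\<^sub>1 :: "'a::composition_algebra" and x\<^sub>2 y\<^sub>2 :: "'b::composition_algebra"
  shows "bilinear (tensor_lift2 (\<lambda>x\<^sub>1 x\<^sub>2 y\<^sub>1 (y\<^sub>2::'b). ip x\<^sub>2 y\<^sub>2 *\<^sub>R theta_pow i (T_elem x\<^sub>1 (y\<^sub>1::'a))))"
    and "bilinear (tensor_lift2 (\<lambda>x\<^sub>1 x\<^sub>2 y\<^sub>1 (y\<^sub>2::'b). ip x\<^sub>1 (y\<^sub>1::'a) *\<^sub>R theta_pow i (T_elem x\<^sub>2 y\<^sub>2)))"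
    and "bilinear (tensor_cross :: ('a, 'b) tensor \<Rightarrow> _)"
    and "tensor_lift2 (\<lambda>x\<^sub>1 x\<^sub>2 y\<^sub>1 y\<^sub>2. ip x\<^sub>2 y\<^sub>2 *\<^sub>R theta_pow i (T_elem x\<^sub>1 y\<^sub>1)) (x\<^sub>1 \<otimes> x\<^sub>2) (y\<^sub>1 \<otimes> y\<^sub>2) =
      ip x\<^sub>2 y\<^sub>2 *\<^sub>R theta_pow i (T_elem x\<^sub>1 y\<^sub>1)"
    and "tensor_lift2 (\<lambda>x\<^sub>1 x\<^sub>2 y\<^sub>1 y\<^sub>2. ip x\<^sub>1 y\<^sub>1 *\<^sub>R theta_pow i (T_elem x\<^sub>2 y\<^sub>2)) (x\<^sub>1 \<otimes> x\<^sub>2) (y\<^sub>1 \<otimes> y\<^sub>2) =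
      ip x\<^sub>1 y\<^sub>1 *\<^sub>R theta_pow i (T_elem x\<^sub>2 y\<^sub>2)"
    and "tensor_cross (x\<^sub>1 \<otimes> x\<^sub>2) (y\<^sub>1 \<otimes> y\<^sub>2) = (cj y\<^sub>1 * cj x\<^sub>1) \<otimes> (cj y\<^sub>2 * cj x\<^sub>2)"
proof -
  note simps = ip_simps linear_add [OF linear_theta_pow] linear_scale [OF linear_theta_pow]
    bilinear_ladd [OF bilinear_T_elem] bilinear_radd [OF bilinear_T_elem]
    bilinear_lmul [OF bilinear_T_elem] bilinear_rmul [OF bilinear_T_elem]
    linear_add [OF linear_cj] linear_scale [OF linear_cj] ca_mult_simps
    bilinear_ladd [OF bilinear_tensor_pure] bilinear_radd [OF bilinear_tensor_pure]
    bilinear_lmul [OF bilinear_tensor_pure] bilinear_rmul [OF bilinear_tensor_pure]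
  have 1: "bilinear (\<lambda>y\<^sub>1 y\<^sub>2. ip x\<^sub>2 y\<^sub>2 *\<^sub>R theta_pow i (T_elem x\<^sub>1 y\<^sub>1))"
    "bilinear (\<lambda>y\<^sub>1 y\<^sub>2. ip x\<^sub>1 y\<^sub>1 *\<^sub>R theta_pow i (T_elem x\<^sub>2 y\<^sub>2))"
    "bilinear (\<lambda>y\<^sub>1 y\<^sub>2. (cj y\<^sub>1 * cj x\<^sub>1) \<otimes> (cj y\<^sub>2 * cj x\<^sub>2))" for x\<^sub>1 :: 'a and x\<^sub>2 :: 'b
    unfolding bilinear_def by (auto intro!: linearI simp: simps algebra_simps)
  have 2: "bilinear (\<lambda>x\<^sub>1 x\<^sub>2. ip x\<^sub>2 y\<^sub>2 *\<^sub>R theta_pow i (T_elem x\<^sub>1 y\<^sub>1))"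
    "bilinear (\<lambda>x\<^sub>1 x\<^sub>2. ip x\<^sub>1 y\<^sub>1 *\<^sub>R theta_pow i (T_elem x\<^sub>2 y\<^sub>2))"
    "bilinear (\<lambda>x\<^sub>1 x\<^sub>2. (cj y\<^sub>1 * cj x\<^sub>1) \<otimes> (cj y\<^sub>2 * cj x\<^sub>2))" for y\<^sub>1 :: 'a and y\<^sub>2 :: 'b
    unfolding bilinear_def by (auto intro!: linearI simp: simps algebra_simps)
  show "bilinear (tensor_lift2 (\<lambda>x\<^sub>1 x\<^sub>2 y\<^sub>1 (y\<^sub>2::'b). ip x\<^sub>2 y\<^sub>2 *\<^sub>R theta_pow i (T_elem x\<^sub>1 (y\<^sub>1::'a))))"
    using 1 2 by (intro bilinear_tensor_lift2)
  show "bilinear (tensor_lift2 (\<lambda>x\<^sub>1 x\<^sub>2 y\<^sub>1 (y\<^sub>2::'b). ip x\<^sub>1 (y\<^sub>1::'a) *\<^sub>R theta_pow i (T_elem x\<^sub>2 y\<^sub>2)))"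
    using 1 2 by (intro bilinear_tensor_lift2)
  show "bilinear (tensor_cross :: ('a, 'b) tensor \<Rightarrow> _)"
    unfolding tensor_cross_def using 1 2 by (intro bilinear_tensor_lift2)
  show "tensor_lift2 (\<lambda>x\<^sub>1 x\<^sub>2 y\<^sub>1 y\<^sub>2. ip x\<^sub>2 y\<^sub>2 *\<^sub>R theta_pow i (T_elem x\<^sub>1 y\<^sub>1)) (x\<^sub>1 \<otimes> x\<^sub>2) (y\<^sub>1 \<otimes> y\<^sub>2) =
      ip x\<^sub>2 y\<^sub>2 *\<^sub>R theta_pow i (T_elem x\<^sub>1 y\<^sub>1)"
    by (rule tensor_lift2_pure [OF 1(1) 2(1)])
  show "tensor_lift2 (\<lambda>x\<^sub>1 x\<^sub>2 y\<^sub>1 y\<^sub>2. ip x\<^sub>1 y\<^sub>1 *\<^sub>R theta_pow i (T_elem x\<^sub>2 y\<^sub>2)) (x\<^sub>1 \<otimes> x\<^sub>2) (y\<^sub>1 \<otimes> y\<^sub>2) =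
      ip x\<^sub>1 y\<^sub>1 *\<^sub>R theta_pow i (T_elem x\<^sub>2 y\<^sub>2)"
    by (rule tensor_lift2_pure [OF 1(2) 2(2)])
  show "tensor_cross (x\<^sub>1 \<otimes> x\<^sub>2) (y\<^sub>1 \<otimes> y\<^sub>2) = (cj y\<^sub>1 * cj x\<^sub>1) \<otimes> (cj y\<^sub>2 * cj x\<^sub>2)"
    unfolding tensor_cross_def by (rule tensor_lift2_pure [OF 1(3) 2(3)])
qed

lemmas tri_lift_zero =
  bilinear_lzero [OF tri_tensor_lift2(1)] bilinear_rzero [OF tri_tensor_lift2(1)]
  bilinear_lzero [OF tri_tensor_lift2(2)] bilinear_rzero [OF tri_tensor_lift2(2)]
  bilinear_lzero [OF tri_tensor_lift2(3)] bilinear_rzero [OF tri_tensor_lift2(3)]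

lemma triality_bracket_Tri:
  assumes "T \<in> Tri" "U \<in> Tri" "T' \<in> Tri" "U' \<in> Tri"
  shows "triality_bracket (T, U, 0) (T', U', 0) = (end3_bracket T T', end3_bracket U U', 0)"
  using assms
  by (simp add: tri_lift_zero tri_act_def linear_0 [OF linear_tensor_map] linear_tri_comp linear_id vec_eq_iff)

lemma triality_bracket_Tri_F:
  assumes "T \<in> Tri" "U \<in> Tri"
  shows "triality_bracket (T, 0, 0) (0, 0, F i (x\<^sub>1 \<otimes> x\<^sub>2)) = (0, 0, F i (tri_comp T i x\<^sub>1 \<otimes> x\<^sub>2))"
    and "triality_bracket (0, U, 0) (0, 0, F i (x\<^sub>1 \<otimes> x\<^sub>2)) = (0, 0, F i (x\<^sub>1 \<otimes> tri_comp U i x\<^sub>2))"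
proof -
  have *: "end3_bracket T 0 = 0" if "T \<in> Tri" for T :: "'c::composition_algebra end3"
    using that by (auto simp: Tri_def so_def zero_prod_def commutator_def fun_eq_iff linear_0)
  show "triality_bracket (T, 0, 0) (0, 0, F i (x\<^sub>1 \<otimes> x\<^sub>2)) = (0, 0, F i (tri_comp T i x\<^sub>1 \<otimes> x\<^sub>2))"
    "triality_bracket (0, U, 0) (0, 0, F i (x\<^sub>1 \<otimes> x\<^sub>2)) = (0, 0, F i (x\<^sub>1 \<otimes> tri_comp U i x\<^sub>2))"
    using assms
    by (simp_all add: tri_lift_zero * zero_Tri tri_act_F tri_comp_zero tri_act_zero
        end3_bracket_zero vec_eq_iff bilinear_lzero [OF bilinear_tensor_pure] bilinear_rzero [OF bilinear_tensor_pure])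
qed

lemma triality_bracket_F_cyclic:
  "triality_bracket (0, 0, F i (x\<^sub>1 \<otimes> x\<^sub>2)) (0, 0, F (i + 1) (y\<^sub>1 \<otimes> y\<^sub>2)) =
     (0, 0, F (i + 2) ((cj y\<^sub>1 * cj x\<^sub>1) \<otimes> (cj y\<^sub>2 * cj x\<^sub>2)))"
  using exhaust_3 [of i]
  by (auto simp: F_def axis_def sum_3 tri_lift_zero tri_act_zero end3_bracket_zero vec_eq_iff
      forall_3 tri_tensor_lift2)

lemma triality_bracket_F_same:
  "triality_bracket (0, 0, F i (x\<^sub>1 \<otimes> x\<^sub>2)) (0, 0, F i (y\<^sub>1 \<otimes> y\<^sub>2)) =
     (ip x\<^sub>2 y\<^sub>2 *\<^sub>R theta_pow i (T_elem x\<^sub>1 y\<^sub>1), ip x\<^sub>1 y\<^sub>1 *\<^sub>R theta_pow i (T_elem x\<^sub>2 y\<^sub>2), 0)"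
proof -
  have 1: "tensor_lift2 (\<lambda>x\<^sub>1 x\<^sub>2 y\<^sub>1 y\<^sub>2. ip x\<^sub>2 y\<^sub>2 *\<^sub>R theta_pow j (T_elem x\<^sub>1 y\<^sub>1))
      (F i (x\<^sub>1 \<otimes> x\<^sub>2) $ j) (F i (y\<^sub>1 \<otimes> y\<^sub>2) $ j) =
      (if j = i then ip x\<^sub>2 y\<^sub>2 *\<^sub>R theta_pow i (T_elem x\<^sub>1 y\<^sub>1) else 0)"
    "tensor_lift2 (\<lambda>x\<^sub>1 x\<^sub>2 y\<^sub>1 y\<^sub>2. ip x\<^sub>1 y\<^sub>1 *\<^sub>R theta_pow j (T_elem x\<^sub>2 y\<^sub>2))
      (F i (x\<^sub>1 \<otimes> x\<^sub>2) $ j) (F i (y\<^sub>1 \<otimes> y\<^sub>2) $ j) =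
      (if j = i then ip x\<^sub>1 y\<^sub>1 *\<^sub>R theta_pow i (T_elem x\<^sub>2 y\<^sub>2) else 0)" for j
    by (simp_all add: F_def axis_def tri_lift_zero tri_tensor_lift2)
  have "tensor_cross (F i (x\<^sub>1 \<otimes> x\<^sub>2) $ (k + 1)) (F i (y\<^sub>1 \<otimes> y\<^sub>2) $ (k + 2)) = 0"
    "tensor_cross (F i (y\<^sub>1 \<otimes> y\<^sub>2) $ (k + 1)) (F i (x\<^sub>1 \<otimes> x\<^sub>2) $ (k + 2)) = 0" for k
    by (auto simp: F_def axis_def tri_lift_zero)
  then show ?thesis
    by (simp add: 1 tri_act_zero end3_bracket_zero vec_eq_iff)
qed


section \<open>Hermitian matrices\<close>

definition mat_mult :: "'a::composition_algebra^3^3 \<Rightarrow> 'a^3^3 \<Rightarrow> 'a^3^3" where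
  "mat_mult X Y = (\<chi> i j. \<Sum>k\<in>UNIV. X $ i $ k * Y $ k $ j)"

definition dagger :: "'a::composition_algebra^3^3 \<Rightarrow> 'a^3^3" where
  "dagger X = (\<chi> i j. cj (X $ j $ i))"

lemma linear_dagger: "linear dagger"
  by (rule linearI)
    (simp_all add: dagger_def vec_eq_iff linear_add [OF linear_cj] linear_scale [OF linear_cj])

lemma dagger_mat_mult: "dagger (mat_mult X Y) = mat_mult (dagger Y) (dagger X)"
  by (simp add: dagger_def mat_mult_def vec_eq_iff linear_sum [OF linear_cj] cj_mult)

lemma bilinear_mat_mult: "bilinear mat_mult"
  unfolding bilinear_def
  by (auto intro!: linearI simp: mat_mult_def vec_eq_iff ca_mult_simps sum.distrib scaleR_sum_right)

typedef (overloaded) 'a herm3 = "{X :: 'a::composition_algebra^3^3. dagger X = X}"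
  by (rule exI [of _ 0]) (simp add: linear_0 [OF linear_dagger])

setup_lifting type_definition_herm3

instantiation herm3 :: (composition_algebra) real_vector
begin

lift_definition zero_herm3 :: "'a herm3" is 0
  by (simp add: linear_0 [OF linear_dagger])

lift_definition plus_herm3 :: "'a herm3 \<Rightarrow> 'a herm3 \<Rightarrow> 'a herm3" is "(+)"
  by (simp add: linear_add [OF linear_dagger])

lift_definition uminus_herm3 :: "'a herm3 \<Rightarrow> 'a herm3" is uminus
  by (simp add: linear_neg [OF linear_dagger])

lift_definition minus_herm3 :: "'a herm3 \<Rightarrow> 'a herm3 \<Rightarrow> 'a herm3" is "(-)"
  by (simp add: linear_diff [OF linear_dagger])

lift_definition scaleR_herm3 :: "real \<Rightarrow> 'a herm3 \<Rightarrow> 'a herm3" is scaleR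
  by (simp add: linear_scale [OF linear_dagger])

instance
  by (standard; transfer; simp add: scaleR_add_right scaleR_add_left)

end

lift_definition herm_one :: "'a::composition_algebra herm3" is "mat 1"
  by (simp add: dagger_def mat_def vec_eq_iff linear_0 [OF linear_cj] cj_alt ip_self nsq_one scaleR_2
      bilinear_lzero [OF bilinear_ip])

lift_definition jordan :: "'a::composition_algebra herm3 \<Rightarrow> 'a herm3 \<Rightarrow> 'a herm3"
  is "\<lambda>A B. mat_mult A B + mat_mult B A"
  by (simp add: linear_add [OF linear_dagger] dagger_mat_mult add.commute)

lift_definition herm_tr :: "'a::composition_algebra herm3 \<Rightarrow> 'a" is "\<lambda>A. \<Sum>i\<in>UNIV. A $ i $ i" .

definition herm_traceless :: "'a::composition_algebra herm3 set" where
  "herm_traceless = {A. herm_tr A = 0}"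

definition herm_ip :: "'a::composition_algebra herm3 \<Rightarrow> 'a herm3 \<Rightarrow> real" where
  "herm_ip A B = rp (herm_tr (jordan A B))"

text \<open>The trace of a hermitian matrix lies in \<open>\<real> 1\<close>, so it acts on matrices through the real
  scalar \<open>rp\<close>.\<close>

lemma herm_tr_real: "herm_tr A = rp (herm_tr A) *\<^sub>R 1"
proof -
  have "cj (herm_tr A) = herm_tr A"
    by transfer (auto simp: dagger_def vec_eq_iff linear_sum [OF linear_cj])
  then have "2 *\<^sub>R herm_tr A = 2 *\<^sub>R (rp (herm_tr A) *\<^sub>R 1)"
    by (simp add: cj_alt rp_def scaleR_2 [of "herm_tr A"] algebra_simps)
  then show ?thesis
    by (simp only: scaleR_cancel_left) simp
qed

definition herm_star :: "'a::composition_algebra herm3 \<Rightarrow> 'a herm3 \<Rightarrow> 'a herm3" where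
  "herm_star A B = jordan A B - (1/3) *\<^sub>R rp (herm_tr (jordan A B)) *\<^sub>R herm_one"

lemma bilinear_jordan: "bilinear jordan"
  unfolding bilinear_def
  by (intro conjI allI linearI; transfer;
      simp add: bilinear_ladd [OF bilinear_mat_mult] bilinear_radd [OF bilinear_mat_mult]
        bilinear_lmul [OF bilinear_mat_mult] bilinear_rmul [OF bilinear_mat_mult] algebra_simps)

lemma linear_rp_herm_tr: "linear (\<lambda>A. rp (herm_tr A))"
  by (rule linearI; transfer; simp add: rp_def sum.distrib scaleR_sum_right [symmetric] ip_simps)

lemmas jordan_simps = bilinear_ladd [OF bilinear_jordan] bilinear_radd [OF bilinear_jordan]
  bilinear_lmul [OF bilinear_jordan] bilinear_rmul [OF bilinear_jordan]

lemma bilinear_herm_ip: "bilinear herm_ip"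
  unfolding bilinear_def herm_ip_def
  by (auto intro!: linearI simp: jordan_simps linear_add [OF linear_rp_herm_tr]
      linear_scale [OF linear_rp_herm_tr])

lemma bilinear_herm_star: "bilinear herm_star"
  unfolding bilinear_def herm_star_def herm_ip_def [symmetric]
  by (auto intro!: linearI simp: jordan_simps bilinear_ladd [OF bilinear_herm_ip]
      bilinear_radd [OF bilinear_herm_ip] bilinear_lmul [OF bilinear_herm_ip]
      bilinear_rmul [OF bilinear_herm_ip] scaleR_add_left scaleR_diff_right add_divide_distrib)


section \<open>Tits's algebra\<close>

type_synonym ('a, 'b) tits = "('a herm3 \<Rightarrow> 'a herm3) \<times> ('a herm3, 'b) tensor \<times> ('b \<Rightarrow> 'b)"

text \<open>The tensor product of the subspaces \<open>herm_traceless\<close> and \<open>im_space\<close> is the subspace that their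
  pure tensors span in the tensor product of the ambient spaces (over a field the canonical map is
  injective).\<close>

definition tits_algebra :: "('a::composition_algebra, 'b::composition_algebra) tits set" where
  "tits_algebra =
     derivations jordan \<times> span {A \<otimes> x | A x. A \<in> herm_traceless \<and> x \<in> im_space} \<times> derivations (*)"

fun tits_bracket ::
    "('a::composition_algebra, 'b::composition_algebra) tits \<Rightarrow> ('a, 'b) tits \<Rightarrow> ('a, 'b) tits" where
  "tits_bracket (D, u, E) (D', v, E') =
     (commutator D D' -
        tensor_lift2 (\<lambda>A x B y. ip x y *\<^sub>R commutator (jordan A) (jordan B)) u v,
      tensor_map D id v - tensor_map D' id u + tensor_map id E v - tensor_map id E' u +
        tensor_lift2 (\<lambda>A x B y. herm_star A B \<otimes> ((1/2) *\<^sub>R (x * y - y * x))) u v,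
      commutator E E' +
        tensor_lift2 (\<lambda>A x B y. (herm_ip A B / 6) *\<^sub>R inner_der x y) u v)"

lemma tits_tensor_lift2:
  fixes A B :: "'a::composition_algebra herm3" and x y :: "'b::composition_algebra"
  shows "bilinear (tensor_lift2 (\<lambda>A x B y. ip (x::'b) y *\<^sub>R commutator (jordan (A :: 'a herm3)) (jordan B)))"
    and "bilinear (tensor_lift2 (\<lambda>A x B y. herm_star (A :: 'a herm3) B \<otimes> ((1/2) *\<^sub>R (x * y - y * (x::'b)))))"
    and "bilinear (tensor_lift2 (\<lambda>A x B y. (herm_ip (A :: 'a herm3) B / 6) *\<^sub>R inner_der (x::'b) y))"
    and "tensor_lift2 (\<lambda>A x B y. ip x y *\<^sub>R commutator (jordan A) (jordan B)) (A \<otimes> x) (B \<otimes> y) =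
      ip x y *\<^sub>R commutator (jordan A) (jordan B)"
    and "tensor_lift2 (\<lambda>A x B y. herm_star A B \<otimes> ((1/2) *\<^sub>R (x * y - y * x))) (A \<otimes> x) (B \<otimes> y) =
      herm_star A B \<otimes> ((1/2) *\<^sub>R (x * y - y * x))"
    and "tensor_lift2 (\<lambda>A x B y. (herm_ip A B / 6) *\<^sub>R inner_der x y) (A \<otimes> x) (B \<otimes> y) =
      (herm_ip A B / 6) *\<^sub>R inner_der x y"
proof -
  note simps = ip_simps ca_mult_simps jordan_simps
    bilinear_ladd [OF bilinear_tensor_pure] bilinear_radd [OF bilinear_tensor_pure]
    bilinear_lmul [OF bilinear_tensor_pure] bilinear_rmul [OF bilinear_tensor_pure]
    bilinear_lsub [OF bilinear_tensor_pure] bilinear_rsub [OF bilinear_tensor_pure]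
    bilinear_ladd [OF bilinear_inner_der] bilinear_radd [OF bilinear_inner_der]
    bilinear_lmul [OF bilinear_inner_der] bilinear_rmul [OF bilinear_inner_der]
    bilinear_ladd [OF bilinear_herm_star] bilinear_radd [OF bilinear_herm_star]
    bilinear_lmul [OF bilinear_herm_star] bilinear_rmul [OF bilinear_herm_star]
    bilinear_ladd [OF bilinear_herm_ip] bilinear_radd [OF bilinear_herm_ip]
    bilinear_lmul [OF bilinear_herm_ip] bilinear_rmul [OF bilinear_herm_ip]
    commutator_def fun_eq_iff add_divide_distrib
  have 1: "bilinear (\<lambda>B y. ip x y *\<^sub>R commutator (jordan A) (jordan B))"
    "bilinear (\<lambda>B y. herm_star A B \<otimes> ((1/2) *\<^sub>R (x * y - y * x)))"
    "bilinear (\<lambda>B y. (herm_ip A B / 6) *\<^sub>R inner_der x y)" for A :: "'a herm3" and x :: 'b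
    unfolding bilinear_def by (auto intro!: linearI simp: simps algebra_simps)
  have 2: "bilinear (\<lambda>A x. ip x y *\<^sub>R commutator (jordan A) (jordan B))"
    "bilinear (\<lambda>A x. herm_star A B \<otimes> ((1/2) *\<^sub>R (x * y - y * x)))"
    "bilinear (\<lambda>A x. (herm_ip A B / 6) *\<^sub>R inner_der x y)" for B :: "'a herm3" and y :: 'b
    unfolding bilinear_def by (auto intro!: linearI simp: simps algebra_simps)
  show "bilinear (tensor_lift2 (\<lambda>A x B y. ip (x::'b) y *\<^sub>R commutator (jordan (A :: 'a herm3)) (jordan B)))"
    using 1 2 by (intro bilinear_tensor_lift2)
  show "bilinear (tensor_lift2 (\<lambda>A x B y. herm_star (A :: 'a herm3) B \<otimes> ((1/2) *\<^sub>R (x * y - y * (x::'b)))))"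
    using 1 2 by (intro bilinear_tensor_lift2)
  show "bilinear (tensor_lift2 (\<lambda>A x B y. (herm_ip (A :: 'a herm3) B / 6) *\<^sub>R inner_der (x::'b) y))"
    using 1 2 by (intro bilinear_tensor_lift2)
  show "tensor_lift2 (\<lambda>A x B y. ip x y *\<^sub>R commutator (jordan A) (jordan B)) (A \<otimes> x) (B \<otimes> y) =
      ip x y *\<^sub>R commutator (jordan A) (jordan B)"
    by (rule tensor_lift2_pure [OF 1(1) 2(1)])
  show "tensor_lift2 (\<lambda>A x B y. herm_star A B \<otimes> ((1/2) *\<^sub>R (x * y - y * x))) (A \<otimes> x) (B \<otimes> y) =
      herm_star A B \<otimes> ((1/2) *\<^sub>R (x * y - y * x))"
    by (rule tensor_lift2_pure [OF 1(2) 2(2)])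
  show "tensor_lift2 (\<lambda>A x B y. (herm_ip A B / 6) *\<^sub>R inner_der x y) (A \<otimes> x) (B \<otimes> y) =
      (herm_ip A B / 6) *\<^sub>R inner_der x y"
    by (rule tensor_lift2_pure [OF 1(3) 2(3)])
qed

lemmas tits_lift_zero =
  bilinear_lzero [OF tits_tensor_lift2(1)] bilinear_rzero [OF tits_tensor_lift2(1)]
  bilinear_lzero [OF tits_tensor_lift2(2)] bilinear_rzero [OF tits_tensor_lift2(2)]
  bilinear_lzero [OF tits_tensor_lift2(3)] bilinear_rzero [OF tits_tensor_lift2(3)]

lemma linear_derivation: "D \<in> derivations m \<Longrightarrow> linear D"
  by (simp add: derivations_def)

lemma tits_bracket_derivations:
  assumes "D \<in> derivations jordan" "E \<in> derivations (*)" "D' \<in> derivations jordan" "E' \<in> derivations (*)"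
  shows "tits_bracket (D, 0, E) (D', 0, E') = (commutator D D', 0, commutator E E')"
  using assms
  by (simp add: tits_lift_zero linear_0 [OF linear_tensor_map] linear_derivation linear_id)

lemma tits_bracket_derivation_pure:
  assumes "D \<in> derivations jordan" "E \<in> derivations (*)"
  shows "tits_bracket (D, 0, 0) (0, A \<otimes> x, 0) = (0, D A \<otimes> x, 0)"
    and "tits_bracket (0, 0, E) (0, A \<otimes> x, 0) = (0, A \<otimes> E x, 0)"
  using linear_derivation [OF assms(1)] linear_derivation [OF assms(2)]
  by (simp_all add: tits_lift_zero commutator_zero tensor_map_zero tensor_map_pure
      linear_id linear_0 [OF linear_tensor_map])

lemma tits_bracket_pure_pure:
  "tits_bracket (0, A \<otimes> x, 0) (0, B \<otimes> y, 0) =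
     (- (ip x y *\<^sub>R commutator (jordan A) (jordan B)),
      herm_star A B \<otimes> ((1/2) *\<^sub>R (x * y - y * x)),
      (herm_ip A B / 6) *\<^sub>R inner_der x y)"
  by (simp add: tits_tensor_lift2 tensor_map_zero commutator_zero)

end

theory Submission
  imports Defs
begin

text \<open>Write an element of \<open>H\<^sub>3\<close> in its Peirce decomposition: real multiples of the three diagonal idempotents
  \<open>e\<^sub>i\<close> and off-diagonal parts \<open>P\<^sub>i x\<close>. A triality acts on the \<open>P\<^sub>i\<close> and kills the \<open>e\<^sub>i\<close>; a derivation of
  \<open>H\<^sub>3\<close> differs from such a map by a sum of commutators \<open>D\<^sub>i z\<close> of \<open>e\<^sub>i\<^sub>+\<^sub>1\<close> with \<open>P\<^sub>i z\<close>. On the other factor,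
  trialities are the triples \<open>E + L(u\<^sub>i\<^sub>+\<^sub>1) - R(u\<^sub>i\<^sub>+\<^sub>2)\<close> for a derivation \<open>E\<close> and imaginary \<open>u\<^sub>1 + u\<^sub>2 + u\<^sub>3 = 0\<close>.
  So \<open>T\<close> in the first triality algebra goes to its action, the second goes to \<open>E + \<Sum> e\<^sub>i \<otimes> u\<^sub>i\<close>,
  \<open>F\<^sub>i (x \<otimes> 1)\<close> goes to \<open>- D\<^sub>i x\<close>, and \<open>F\<^sub>i (x \<otimes> y)\<close> with \<open>y\<close> imaginary goes to \<open>- P\<^sub>i x \<otimes> y\<close>. The Jacobi
  identity is checked only on the triality side, and transported.\<close>

section \<open>Composition algebras\<close>

text \<open>\<open>nsq\<close> may be indefinite and no basis of either algebra is fixed. Identities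
  in a composition algebra are therefore proved by pairing both sides with an arbitrary vector and
  using nondegeneracy, with polarised multiplicativity of the norm in place of associativity.
  Bijectivity is shown by recovering coordinates and exhibiting preimages, not by counting
  dimensions.

  The signs in the map are forced. The commutator of \<open>hD i x\<close> and
  \<open>hD (i + 1) y\<close> is \<open>- hD (i + 2) (cj y * cj x)\<close>, while the corresponding
  bracket of \<open>F\<close>'s has a plus sign; and the imaginary part of
  \<open>cj y * cj x\<close> reverses the commutator of the imaginary parts, which fixes the sign of
  \<open>hP i x \<otimes> y\<close>.

  The imaginary triple comes from the values of a triality at \<open>1\<close>: component
  \<open>i\<close> takes \<open>1\<close> to \<open>u (i + 1) - u (i + 2)\<close>, and sum zero
  makes \<open>u\<close> unique. Solving for \<open>u\<close> brings in the factor 1/3, which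
  reappears on the Tits side as the trace correction in \<open>herm_star\<close> and, as 2/6, in
  front of \<open>inner_der\<close>. Sum zero on one side is trace zero on the other.\<close>

lemma three_add [simp]:
  "(i::3) + 1 + 1 = i + 2" "(i::3) + 1 + 2 = i" "(i::3) + 2 + 1 = i" "(i::3) + 2 + 2 = i + 1"
  using exhaust_3 [of i] by auto

lemma three_neq [simp]:
  "(i::3) + 1 \<noteq> i" "(i::3) + 2 \<noteq> i" "i \<noteq> (i::3) + 1" "i \<noteq> (i::3) + 2"
  "(i::3) + 1 \<noteq> i + 2" "(i::3) + 2 \<noteq> i + 1"
  using exhaust_3 [of i] by auto

text \<open>Case analysis relative to \<open>i\<close>, so that one computation at a variable index
  covers all three.\<close>

lemma three_cases:
  obtains "j = (i::3)" | "j = i + 1" | "j = i + 2"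
  using exhaust_3 [of i] exhaust_3 [of j] by auto

lemma sum_three: "(\<Sum>j\<in>UNIV. f j) = f (i::3) + f (i + 1) + (f (i + 2) :: 'a::ab_group_add)"
proof -
  \<comment> \<open>Adding 1 or 2 to the numerals of the type \<open>3\<close> produces
    \<open>4\<close> and \<open>5\<close>, which denote the residues \<open>1\<close> and
    \<open>2\<close>.\<close>
  have "f 4 = f 1" "f 5 = f 2"
    by (rule arg_cong, simp)+
  then show ?thesis
    using exhaust_3 [of i] by (auto simp: sum_3 algebra_simps)
qed

section \<open>Conjugation, adjointness and polarised norm identities\<close>

lemmas cj_simps = linear_add [OF linear_cj] linear_diff [OF linear_cj] linear_scale [OF linear_cj]
  linear_neg [OF linear_cj] linear_0 [OF linear_cj]

lemmas ca_zero [simp] = bilinear_lzero [OF bilinear_mult] bilinear_rzero [OF bilinear_mult]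
lemmas ca_neg = bilinear_lneg [OF bilinear_mult] bilinear_rneg [OF bilinear_mult]
lemmas ip_zero [simp] = bilinear_lzero [OF bilinear_ip] bilinear_rzero [OF bilinear_ip]
lemmas ip_neg = bilinear_lneg [OF bilinear_ip] bilinear_rneg [OF bilinear_ip]
lemmas K_simps = ca_mult_simps ca_neg ip_simps ip_neg cj_simps mult_one_l mult_one_r cj_mult

lemma cj_one [simp]: "cj 1 = 1"
  by (simp add: cj_alt ip_self nsq_one scaleR_2)

lemma ip_one_one [simp]: "ip 1 1 = 1"
  by (simp add: ip_self nsq_one)

lemma ip_cj_left: "ip (cj x) y = ip x (cj y)"
  using ip_cj_cj [of x "cj y"] by simp

lemma cj_im: "x \<in> im_space \<Longrightarrow> cj x = - x"
  by (simp add: im_space_def cj_alt)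

text \<open>Polarised form of \<open>cj x * (x * z) = nsq x *\<^sub>R z\<close>: the outer factors
  move to the other side of \<open>ip\<close> by adjointness, where \<open>ip_mult_mult\<close>
  applies. This and its mirror images are the substitute for associativity in the computations
  below.\<close>

lemma cj_sandwich_left: "cj x * (y * z) + cj y * (x * z) = (2 * ip x y) *\<^sub>R z"
proof (rule ip_eqI)
  fix s
  have "ip (cj x * (y * z)) s = ip (y * z) (x * s)" "ip (cj y * (x * z)) s = ip (x * z) (y * s)" 
    using ip_mult_right [of "cj x"] ip_mult_right [of "cj y"] by simp_all
  then show "ip (cj x * (y * z) + cj y * (x * z)) s = ip ((2 * ip x y) *\<^sub>R z) s"
    using ip_mult_mult [of y z x s] by (simp add: K_simps ip_commute)
qed

lemma cj_sandwich_right: "(z * x) * cj y + (z * y) * cj x = (2 * ip x y) *\<^sub>R z"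
  using arg_cong [OF cj_sandwich_left [of "cj x" "cj y" "cj z"], of cj]
  by (simp add: K_simps ip_cj_cj add.commute)

lemma cj_sandwich_left': "x * (cj y * z) + y * (cj x * z) = (2 * ip x y) *\<^sub>R z"
  using cj_sandwich_left [of "cj x" "cj y" z] by (simp add: ip_cj_cj)

lemma cj_sandwich_right': "(z * cj x) * y + (z * cj y) * x = (2 * ip x y) *\<^sub>R z"
  using cj_sandwich_right [of z "cj x" "cj y"] by (simp add: ip_cj_cj)

lemma mult_cj_sum: "x * cj y + y * cj x = (2 * ip x y) *\<^sub>R 1" "cj x * y + cj y * x = (2 * ip x y) *\<^sub>R 1"
  using cj_sandwich_left' [of x y 1] cj_sandwich_left [of x y 1] by (simp_all add: mult_one_r)

text \<open>The source of all the triality identities below.\<close>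

lemma triality_key:
  "(t * (cj x * a)) * b + a * ((b * cj x) * t) =
     (2 * ip x t) *\<^sub>R (a * b) - (2 * ip (a * b) t) *\<^sub>R x + (2 * ip (a * b) x) *\<^sub>R t"
proof (rule ip_eqI)
  fix s
  have 1: "ip ((t * (cj x * a)) * b) s = ip (t * (cj x * a)) (s * cj b)"
    by (simp add: ip_mult_left)
  have 2: "ip (t * (cj x * a)) (s * cj b) + ip (t * cj b) (s * (cj x * a)) = 2 * ip t s * ip (cj x * a) (cj b)"
    by (rule ip_mult_mult)
  \<comment> \<open>Interchanging \<open>s\<close> and \<open>x\<close> costs a multiple of
    \<open>a\<close>, and lets a second use of \<open>ip_mult_mult\<close> produce exactly the
    pairing that the facts 5 and 6 obtain from \<open>a * ((b * cj x) * t)\<close>.\<close>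
  have 3: "s * (cj x * a) = (2 * ip s x) *\<^sub>R a - x * (cj s * a)"
    using cj_sandwich_left' [of s x a] by (simp add: algebra_simps)
  have 4: "ip (t * cj b) (x * (cj s * a)) + ip (t * (cj s * a)) (x * cj b) = 2 * ip t x * ip (cj b) (cj s * a)"
    by (rule ip_mult_mult)
  have 5: "ip (a * ((b * cj x) * t)) s = ip (b * cj x) ((cj a * s) * cj t)"
    by (simp only: ip_mult_right [of a] ip_mult_left [of "b * cj x"])
  have 6: "ip (b * cj x) ((cj a * s) * cj t) = ip (t * (cj s * a)) (x * cj b)"
    using ip_cj_cj [of "b * cj x" "(cj a * s) * cj t"] by (simp add: K_simps ip_commute)
  have 7: "ip (cj x * a) (cj b) = ip (a * b) x" "ip (cj b) (cj s * a) = ip (a * b) s" "ip (t * cj b) a = ip (a * b) t"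
    using ip_mult_right [of "cj x" a "cj b"] ip_mult_right [of "cj s" a "cj b"] ip_mult_left [of t "cj b" a]
     ip_mult_left [of a b x] ip_mult_left [of a b s] by (simp_all add: ip_commute)
  show "ip ((t * (cj x * a)) * b + a * ((b * cj x) * t)) s = 
     ip ((2 * ip x t) *\<^sub>R (a * b) - (2 * ip (a * b) t) *\<^sub>R x + (2 * ip (a * b) x) *\<^sub>R t) s"
    using 1 2 4 5 6 7 by (simp add: 3 ip_simps ip_commute algebra_simps)
qed

text \<open>The source of the threefold symmetry: a triality is a triple of skew maps annihilating
  this trilinear form, so cyclic invariance of the form lets the components be rotated.\<close>

lemma ip_cyclic: "ip (cj y * cj x) z = ip (cj z * cj y) x"
proof -
  have "ip (cj y * cj x) z = ip (cj x) (y * z)"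
    by (simp add: ip_mult_right)
  also have "\<dots> = ip (cj z * cj y) x"
    using ip_cj_cj [of "cj x" "y * z"] by (simp add: K_simps ip_commute)
  finally show ?thesis .
qed

section \<open>The associator and imaginary elements\<close>

definition asc :: "'a::composition_algebra \<Rightarrow> 'a \<Rightarrow> 'a \<Rightarrow> 'a" where
  "asc x y z = (x * y) * z - x * (y * z)"

text \<open>Alternativity. By \<open>cj_sandwich_left\<close> and \<open>mult_cj_sum\<close>,
  \<open>cj x * (y * z) + cj y * (x * z)\<close> and \<open>(cj x * y + cj y * x) * z\<close> have
  the same value. Writing \<open>cj x\<close> as a multiple of \<open>1\<close> minus
  \<open>x\<close> leaves only associators, since \<open>asc\<close> vanishes when an argument is a
  multiple of \<open>1\<close>. The second half is the mirror image.\<close>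

lemma asc_skew: "asc y x z = - asc x y z" "asc x z y = - asc x y z"
proof -
  have r: "cj x = (2 * ip x 1) *\<^sub>R 1 - x" for x :: 'a
    by (rule cj_alt)
  have l: "ip s (cj x * (y * z)) + ip s (cj y * (x * z)) = ip s ((cj x * y) * z) + ip s ((cj y * x) * z)" for s
    by (simp add: ip_simps [symmetric] mult_add_l [symmetric] cj_sandwich_left mult_cj_sum K_simps)
  show "asc y x z = - asc x y z"
    by (rule ip_eqI) (use l in \<open>simp add: asc_def r K_simps algebra_simps ip_commute\<close>)
  have l: "ip s ((x * y) * cj z) + ip s ((x * z) * cj y) = ip s (x * (y * cj z)) + ip s (x * (z * cj y))" for s
    by (simp add: ip_simps [symmetric] mult_add_r [symmetric] cj_sandwich_right mult_cj_sum K_simps)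
  show "asc x z y = - asc x y z"
    by (rule ip_eqI) (use l in \<open>simp add: asc_def r K_simps algebra_simps ip_commute\<close>)
qed

lemma asc_cyclic: "asc y z x = asc x y z" "asc z x y = asc x y z"
  by (metis asc_skew minus_minus)+

lemma mult_im_anticommute: "\<lbrakk>x \<in> im_space; y \<in> im_space\<rbrakk> \<Longrightarrow> x * y + y * x = (- 2 * ip x y) *\<^sub>R 1"
  using mult_cj_sum(1) [of x y] by (simp add: cj_im K_simps eq_neg_iff_add_eq_0 add_eq_0_iff) 

lemma rp_im_decomp: "rp x *\<^sub>R 1 + im_part x = x"
  by (simp add: im_part_def)

lemma linear_rp: "linear rp"
  by (rule linearI) (simp_all add: rp_def ip_simps)

lemma linear_im_part: "linear im_part"
  by (rule linearI) (simp_all add: im_part_def rp_def ip_simps algebra_simps)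

lemma im_space_iff: "x \<in> im_space \<longleftrightarrow> rp x = 0"
  by (simp add: im_space_def rp_def)

section \<open>The triality algebra\<close>

lemma tri_comp_add: "tri_comp (T + U) i = tri_comp T i + tri_comp U i"
  by (cases T; cases U) (auto simp: map_bar_def fun_eq_iff cj_simps)

lemma tri_comp_scaleR: "tri_comp (r *\<^sub>R T) i = r *\<^sub>R tri_comp T i"
  by (cases T) (auto simp: map_bar_def fun_eq_iff cj_simps)

lemma tri_comp_bracket: "tri_comp (end3_bracket T U) i = commutator (tri_comp T i) (tri_comp U i)"
  by (cases T; cases U) (auto simp: map_bar_def fun_eq_iff cj_simps commutator_def)

lemma tri_eqI:
  assumes "\<And>i. tri_comp T i = tri_comp U i"
  shows "T = U"
proof -
  obtain A B C A' B' C' where TU: "T = (A, B, C)" "U = (A', B', C')"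
    by (cases T; cases U) 
  have "A = A'" "map_bar B = map_bar B'" "map_bar C = map_bar C'"
    using assms [of 1] assms [of 2] assms [of 3] by (auto simp: TU)
  then show ?thesis
    by (metis TU map_bar_map_bar)
qed

definition tri_of :: "(3 \<Rightarrow> 'a \<Rightarrow> 'a) \<Rightarrow> 'a::composition_algebra end3" where
  "tri_of t = (t 1, map_bar (t 2), map_bar (t 3))"

lemma tri_comp_tri_of [simp]: "tri_comp (tri_of t) i = t i"
  using exhaust_3 [of i] by (auto simp: tri_of_def)

lemma so_skew: "A \<in> so \<Longrightarrow> ip (A x) y = - ip x (A y)"
  by (simp add: so_def)

lemma map_bar_so: "map_bar A \<in> so \<longleftrightarrow> A \<in> so"
proof -
  have "map_bar A \<in> so" if "A \<in> so" for A :: "'a \<Rightarrow> 'a"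
    using that by (auto simp: so_def map_bar_def ip_cj_left cj_simps linear_add linear_scale intro!: linearI)
  from this [of A] this [of "map_bar A"] show ?thesis by auto
qed

text \<open>Pairing with \<open>z\<close> and moving \<open>C\<close> across by skewness turns the
  multiplicative identity into the annihilation of the trilinear form of \<open>ip_cyclic\<close>,
  in which the three maps enter alike.\<close>

lemma triality_iff_trilinear:
  assumes "C \<in> so"
  shows "(\<forall>x y. C (cj y * cj x) = cj y * cj (A x) + cj (B y) * cj x) \<longleftrightarrow>
    (\<forall>x y z. ip (cj y * cj (A x)) z + ip (cj (B y) * cj x) z + ip (cj y * cj x) (C z) = 0)"
    (is "?l \<longleftrightarrow> ?r")
proof
  assume ?l
  then show ?r
    using so_skew [OF assms] by (metis add.right_inverse ip_simps(1) add.commute minus_minus)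
next
  assume r: ?r
  show ?l
  proof (intro allI, rule ip_eqI)
    fix x y z
    show "ip (C (cj y * cj x)) z = ip (cj y * cj (A x) + cj (B y) * cj x) z"
      using r [rule_format, of y x z] by (simp add: so_skew [OF assms] ip_simps)
  qed
qed

text \<open>Annihilating the trilinear form is preserved by cyclic permutation of the maps because
  the form itself is.\<close>

lemma triality_rotate:
  assumes so: "A \<in> so" "B \<in> so" "C \<in> so"
    and "\<forall>x y. C (cj y * cj x) = cj y * cj (A x) + cj (B y) * cj x"
  shows "\<forall>x y. A (cj y * cj x) = cj y * cj (B x) + cj (C y) * cj x"
proof -
  from assms(4) have "ip (cj y * cj (A x)) z + ip (cj (B y) * cj x) z + ip (cj y * cj x) (C z) = 0" for x y z
    unfolding triality_iff_trilinear [OF so(3)] by blast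
  then have "ip (cj z * cj (B y)) x + ip (cj (C z) * cj y) x + ip (cj z * cj y) (A x) = 0" for x y z
    by (simp add: ip_cyclic [of y "A x" z, symmetric] ip_cyclic [of "B y" x z, symmetric]
        ip_cyclic [of y x "C z", symmetric] add_ac)
  then show ?thesis
    unfolding triality_iff_trilinear [OF so(1)] by blast
qed

text \<open>A description in which the three indices play equal roles. The identity in the
  definition of \<open>Tri\<close> is the instance \<open>i = 2\<close>, where the bars in
  \<open>tri_comp\<close> cancel the conjugations; \<open>triality_rotate\<close> carries it round
  the cycle.\<close>

lemma Tri_iff:
  "T \<in> Tri \<longleftrightarrow> (\<forall>i. tri_comp T i \<in> so) \<and> (\<forall>i x y. tri_comp T (i + 2) (cj y * cj x) =
     cj y * cj (tri_comp T i x) + cj (tri_comp T (i + 1) y) * cj x)"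
proof -
  obtain A B C where T: "T = (A, B, C)"
    by (cases T)
  let ?R = "\<lambda>i. \<forall>x y. tri_comp T (i + 2) (cj y * cj x) =
     cj y * cj (tri_comp T i x) + cj (tri_comp T (i + 1) y) * cj x"
  have so: "(\<forall>i. tri_comp T i \<in> so) \<longleftrightarrow> A \<in> so \<and> B \<in> so \<and> C \<in> so"
    by (simp add: T forall_3 map_bar_so)
  have R2: "?R 2 \<longleftrightarrow> (\<forall>x y. A (x * y) = x * B y + C x * y)"
  proof -
    have "?R 2 \<longleftrightarrow> (\<forall>x y. A (cj y * cj x) = cj y * B (cj x) + C (cj y) * cj x)"
      by (simp add: T map_bar_def)
    also have "\<dots> \<longleftrightarrow> (\<forall>x y. A (x * y) = x * B y + C x * y)"
      by (metis cj_cj)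
    finally show ?thesis .
  qed
  have rot: "?R (i + 1)" if "?R i" "\<forall>i. tri_comp T i \<in> so" for i
    using triality_rotate [of "tri_comp T i" "tri_comp T (i + 1)" "tri_comp T (i + 2)"] that by simp
  have "?R i" if k: "?R k" and so: "\<forall>i. tri_comp T i \<in> so" for i k
    using k rot [OF k so] rot [OF rot [OF k so] so] by (cases rule: three_cases [of i k]) simp_all
  then have "\<forall>i. ?R i" if "?R 2" "\<forall>i. tri_comp T i \<in> so"
    using that by metis
  moreover have "T \<in> Tri \<longleftrightarrow> (\<forall>i. tri_comp T i \<in> so) \<and> ?R 2"
    by (simp only: so R2) (simp add: Tri_def T)
  ultimately show ?thesis
    by blast
qed

lemma Tri_so: "T \<in> Tri \<Longrightarrow> tri_comp T i \<in> so"
  and Tri_mult: "T \<in> Tri \<Longrightarrow> tri_comp T (i + 2) (cj y * cj x) =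
     cj y * cj (tri_comp T i x) + cj (tri_comp T (i + 1) y) * cj x"
  unfolding Tri_iff by blast+

lemma Tri_mult': "T \<in> Tri \<Longrightarrow> tri_comp T i (cj y * cj x) =
     cj y * cj (tri_comp T (i + 1) x) + cj (tri_comp T (i + 2) y) * cj x"
  "T \<in> Tri \<Longrightarrow> tri_comp T (i + 1) (cj y * cj x) =
     cj y * cj (tri_comp T (i + 2) x) + cj (tri_comp T i y) * cj x"
  using Tri_mult [of T "i + 1" y x] Tri_mult [of T "i + 2" y x] by simp_all

lemma so_closed: "0 \<in> so" "\<lbrakk>A \<in> so; B \<in> so\<rbrakk> \<Longrightarrow> A + B \<in> so" "A \<in> so \<Longrightarrow> r *\<^sub>R A \<in> so"
  "\<lbrakk>A \<in> so; B \<in> so\<rbrakk> \<Longrightarrow> commutator A B \<in> so"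
  by (auto simp: so_def commutator_def zero_fun_def ip_simps linear_zero linear_add linear_scale algebra_simps intro!: linearI)

lemma Tri_closed: "0 \<in> Tri" "\<lbrakk>T \<in> Tri; U \<in> Tri\<rbrakk> \<Longrightarrow> T + U \<in> Tri" "T \<in> Tri \<Longrightarrow> r *\<^sub>R T \<in> Tri"
  "\<lbrakk>T \<in> Tri; U \<in> Tri\<rbrakk> \<Longrightarrow> end3_bracket T U \<in> Tri"
proof -
  show "0 \<in> Tri" by (rule zero_Tri)
  show "\<lbrakk>T \<in> Tri; U \<in> Tri\<rbrakk> \<Longrightarrow> T + U \<in> Tri"
    by (simp add: Tri_iff tri_comp_add so_closed) (simp add: cj_simps ca_mult_simps algebra_simps)
  show "T \<in> Tri \<Longrightarrow> r *\<^sub>R T \<in> Tri"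
    by (simp add: Tri_iff tri_comp_scaleR so_closed) (simp add: cj_simps ca_mult_simps algebra_simps)
  show "\<lbrakk>T \<in> Tri; U \<in> Tri\<rbrakk> \<Longrightarrow> end3_bracket T U \<in> Tri"
  proof -
    assume T: "T \<in> Tri" and U: "U \<in> Tri"
    note lin = linear_add [OF linear_tri_comp [OF T]] linear_add [OF linear_tri_comp [OF U]]
    have 1: "tri_comp T (i + 2) (cj y * c) = cj y * cj (tri_comp T i (cj c)) + cj (tri_comp T (i + 1) y) * c" 
      "tri_comp U (i + 2) (cj y * c) = cj y * cj (tri_comp U i (cj c)) + cj (tri_comp U (i + 1) y) * c" for i y c
      using Tri_mult [OF T, of i y "cj c"] Tri_mult [OF U, of i y "cj c"] by simp_all
    show ?thesis
      using T U unfolding Tri_iff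
      by (simp add: tri_comp_bracket so_closed) (simp add: commutator_def lin cj_simps ca_mult_simps 1 algebra_simps)
  qed
qed

lemma subspace_Tri: "subspace Tri"
  unfolding subspace_def by (auto simp: Tri_closed)

text \<open>\<open>theta\<close> moves the components one place along the cycle, so its powers are
  mere shifts of the index, and every question about \<open>theta_pow\<close> becomes one about
  components.\<close>

lemma tri_comp_theta_pow: "tri_comp (theta_pow i T) j = tri_comp T (j - i + 1)"
  using exhaust_3 [of i] exhaust_3 [of j] by (cases T) (auto simp: theta_pow_def inv_theta)

lemma theta_pow_Tri: "T \<in> Tri \<Longrightarrow> theta_pow i T \<in> Tri"
proof -
  have "j + 2 - i + 1 = (j - i + 1) + 2" "j + 1 - i + 1 = (j - i + 1) + 1" for j :: 3
    by (simp_all add: algebra_simps)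
  then show "T \<in> Tri \<Longrightarrow> theta_pow i T \<in> Tri"
    unfolding Tri_iff tri_comp_theta_pow by metis
qed

section \<open>The trialities attached to pairs of vectors\<close>

abbreviation tau :: "3 \<Rightarrow> 'a::composition_algebra \<Rightarrow> 'a \<Rightarrow> 'a end3" where
  "tau i x y \<equiv> theta_pow i (T_elem x y)"

lemma tri_comp_tau:
  "tri_comp (tau i x y) i z = 4 *\<^sub>R (ip x z *\<^sub>R y - ip y z *\<^sub>R x)"
  "tri_comp (tau i x y) (i + 1) z = cj y * (x * z) - cj x * (y * z)"
  "tri_comp (tau i x y) (i + 2) z = (z * x) * cj y - (z * y) * cj x"
  by (simp_all add: tri_comp_theta_pow T_elem_def S_map_def map_bar_def rmul_def lmul_def cj_simps cj_mult)

lemma T_elem_Tri: "T_elem x y \<in> Tri"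
proof -
  have sk: "ip ((z * cj x) * y) w = ip z ((w * cj y) * x)" "ip (y * (cj x * z)) w = ip z (x * (cj y * w))"
    for x y z w :: 'a
    using ip_mult_left [of "z * cj x" y w] ip_mult_left [of z "cj x" "w * cj y"]
      ip_mult_right [of y "cj x * z" w] ip_mult_right [of "cj x" z "cj y * w"] by simp_all
  have 1: "4 *\<^sub>R S_map x y \<in> so"
    by (auto simp: so_def S_map_def K_simps algebra_simps ip_commute intro!: linearI)
  have 2: "(rmul y \<circ> rmul (cj x)) - (rmul x \<circ> rmul (cj y)) \<in> so"
    unfolding so_def mem_Collect_eq
  proof (intro conjI allI)
    show "linear ((rmul y \<circ> rmul (cj x)) - (rmul x \<circ> rmul (cj y)))"
      by (rule linearI) (simp_all add: rmul_def ca_mult_simps algebra_simps)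
  qed (simp add: rmul_def ip_simps sk)
  have 4: "(lmul y \<circ> lmul (cj x)) - (lmul x \<circ> lmul (cj y)) \<in> so"
    unfolding so_def mem_Collect_eq
  proof (intro conjI allI)
    show "linear ((lmul y \<circ> lmul (cj x)) - (lmul x \<circ> lmul (cj y)))"
      by (rule linearI) (simp_all add: lmul_def ca_mult_simps algebra_simps)
  qed (simp add: lmul_def ip_simps sk)
  \<comment> \<open>The instance of \<open>triality_key\<close> with \<open>x\<close> and
    \<open>y\<close> interchanged is subtracted: the multiples of \<open>p * q\<close> cancel and
    the coefficients of \<open>x\<close> and \<open>y\<close> double from 2 to 4, the factor in
    \<open>T_elem\<close>.\<close>
  have 3: "(4 *\<^sub>R S_map x y) (p * q) = p * ((q * cj x) * y - (q * cj y) * x) + (y * (cj x * p) - x * (cj y * p)) * q" for p q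
  proof (rule ip_eqI)
    fix s
    note arg_cong [OF triality_key [of y x p q], of "\<lambda>v. ip v s"] arg_cong [OF triality_key [of x y p q], of "\<lambda>v. ip v s"]
    then show "ip ((4 *\<^sub>R S_map x y) (p * q)) s = ip (p * ((q * cj x) * y - (q * cj y) * x) + (y * (cj x * p) - x * (cj y * p)) * q) s"
      by (simp add: S_map_def ip_commute K_simps algebra_simps)
  qed
  show ?thesis
    using 1 2 4 3 by (simp add: Tri_def T_elem_def lmul_def rmul_def)
qed

lemma tau_Tri: "tau i x y \<in> Tri"
  by (intro theta_pow_Tri T_elem_Tri)

lemma tri_eqI_cyclic:
  assumes "tri_comp T i = tri_comp U i" "tri_comp T (i + 1) = tri_comp U (i + 1)" "tri_comp T (i + 2) = tri_comp U (i + 2)"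
  shows "T = U"
proof (rule tri_eqI)
  show "tri_comp T j = tri_comp U j" for j
    by (cases rule: three_cases [of j i]) (simp_all only: assms)
qed

lemma bilinear_tau: "bilinear (tau i)"
  using bilinear_T_elem linear_theta_pow [of i] unfolding bilinear_def
  by (auto intro: linear_compose [unfolded o_def])

text \<open>Equivariance of \<open>tau\<close>, on which the Jacobi identity for one triality and
  two vectors rests. In component \<open>i\<close> it comes from skewness; in the other two from the
  triality identity, applied to the outer and the inner product of each nested product.\<close>

lemma end3_bracket_tau:
  assumes T: "T \<in> Tri"
  shows "end3_bracket T (tau i x y) = tau i (tri_comp T i x) y + tau i x (tri_comp T i y)"
proof (rule tri_eqI_cyclic [of _ i])
  note lin = linear_add [OF linear_tri_comp [OF T]] linear_diff [OF linear_tri_comp [OF T]] 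
     linear_scale [OF linear_tri_comp [OF T]]
  note sk = so_skew [OF Tri_so [OF T]]
  show "tri_comp (end3_bracket T (tau i x y)) i = tri_comp (tau i (tri_comp T i x) y + tau i x (tri_comp T i y)) i"
    by (rule ext, rule ip_eqI)
      (simp add: tri_comp_bracket tri_comp_add commutator_def tri_comp_tau lin K_simps sk algebra_simps)
  have 1: "tri_comp T (i + 1) (cj y * z) = cj y * cj (tri_comp T (i + 2) (cj z)) + cj (tri_comp T i y) * z" for y z
    using Tri_mult'(2) [OF T, of i y "cj z"] by simp
  have 2: "tri_comp T (i + 2) (cj (x * z)) = cj (x * tri_comp T (i + 1) z) + cj (tri_comp T i x * z)" for x z
    using Tri_mult [OF T, of i z x] by (simp add: cj_mult add.commute)
  have 2: "cj (tri_comp T (i + 2) (cj (x * z))) = x * tri_comp T (i + 1) z + tri_comp T i x * z" for x z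
    unfolding 2 by (simp add: cj_simps)
  show "tri_comp (end3_bracket T (tau i x y)) (i + 1) = tri_comp (tau i (tri_comp T i x) y + tau i x (tri_comp T i y)) (i + 1)"
    by (rule ext, simp only: tri_comp_bracket tri_comp_add commutator_def tri_comp_tau lin 1 2
          ca_mult_simps fun_diff_def plus_fun_apply o_apply) (simp only: algebra_simps)
  have 3: "tri_comp T (i + 2) (z * cj x) = z * cj (tri_comp T i x) + cj (tri_comp T (i + 1) (cj z)) * cj x" for x z
    using Tri_mult [OF T, of i "cj z" x] by simp
  have 4: "cj (tri_comp T (i + 1) (cj (z * x))) = tri_comp T (i + 2) z * x + z * tri_comp T i x" for x z
    using arg_cong [OF Tri_mult'(2) [OF T, of i x z], of cj] by (simp add: cj_mult cj_simps add.commute)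
  show "tri_comp (end3_bracket T (tau i x y)) (i + 2) = tri_comp (tau i (tri_comp T i x) y + tau i x (tri_comp T i y)) (i + 2)"
    by (rule ext, simp only: tri_comp_bracket tri_comp_add commutator_def tri_comp_tau lin 3 4
          ca_mult_simps fun_diff_def plus_fun_apply o_apply) (simp only: algebra_simps)
qed

lemma tau_skew: "tau i y x = - tau i x y"
proof -
  have "tau i x y + tau i y x = 0"
    by (rule tri_eqI_cyclic [of _ i]; rule ext)
      (simp_all add: tri_comp_add tri_comp_tau tri_comp_zero, simp add: algebra_simps)
  then show ?thesis by (simp add: eq_neg_iff_add_eq_0 add.commute)
qed

text \<open>The obstruction in \<open>Tri\<close> to the Jacobi identity for three vectors with
  distinct indices. Vanishing of component \<open>i\<close> suffices, since the sum is unchanged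
  when indices and arguments are rotated together.\<close>

lemma tau_cyclic_sum:
  "tau i x (cj z * cj y) + tau (i + 1) y (cj x * cj z) + tau (i + 2) z (cj y * cj x) = 0"
proof -
  have *: "tri_comp (tau i x (cj z * cj y) + tau (i + 1) y (cj x * cj z) + tau (i + 2) z (cj y * cj x)) i t = 0"
    for i and x y z t :: 'a
  proof -
    have 1: "tri_comp (tau (i + 1) y v) i t = (t * y) * cj v - (t * v) * cj y" for v
      using tri_comp_tau(3) [of "i + 1"] by simp
    have 2: "tri_comp (tau (i + 2) z v) i t = cj v * (z * t) - cj z * (v * t)" for v
      using tri_comp_tau(2) [of "i + 2"] by simp
    define a b where "a = cj z" and "b = cj y"
    have ab: "cj a = z" "cj b = y"
      by (simp_all add: a_def b_def)
    \<comment> \<open>A companion of \<open>triality_key\<close>. The component to be killed is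
      \<open>4 *\<^sub>R S_map x (a * b) t\<close> plus this sum minus the sum in
      \<open>triality_key\<close>, and the three right-hand sides cancel.\<close>
    have m: "(t * cj b) * (cj a * x) + (x * cj b) * (cj a * t) =
       (2 * ip t (a * b)) *\<^sub>R x + (2 * ip x (a * b)) *\<^sub>R t - (2 * ip x t) *\<^sub>R (a * b)"
    proof (rule ip_eqI)
      fix s
      have p: "ip ((t * cj b) * (cj a * x)) s + ip (cj a * s) ((b * cj t) * x) = 2 * ip t (a * b) * ip x s" for t x
      proof -
        have "ip ((t * cj b) * (cj a * x)) s = ip (cj a * x) ((b * cj t) * s)"
          by (subst ip_mult_right) (simp add: cj_mult)
        moreover have "ip (cj a) (b * cj t) = ip t (a * b)"
          using ip_mult_right [of a b "cj t"] ip_cj_cj [of "cj a" "b * cj t"] ip_mult_right [of "cj b" "cj a" t]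
          by (metis cj_cj cj_mult ip_cj_cj ip_commute ip_mult_left)
        ultimately show ?thesis
          using ip_mult_mult [of "cj a" x "b * cj t" s] by (simp add: ip_commute)
      qed
      have q: "ip (cj a * s) ((b * cj t) * x) + ip (cj a * s) ((b * cj x) * t) = 2 * ip x t * ip s (a * b)"
        using cj_sandwich_right' [of b x t] ip_mult_right [of "cj a" s b]
        by (simp add: ip_simps [symmetric] add.commute) (simp add: ip_simps)
      show "ip ((t * cj b) * (cj a * x) + (x * cj b) * (cj a * t)) s =
          ip ((2 * ip t (a * b)) *\<^sub>R x + (2 * ip x (a * b)) *\<^sub>R t - (2 * ip x t) *\<^sub>R (a * b)) s"
        using p [of t x] p [of x t] q by (simp add: ip_simps ip_commute [of _ s] algebra_simps)
    qed
    show ?thesis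
    proof (rule ip_eqI)
      fix s
      note arg_cong [OF triality_key [of t x a b], of "\<lambda>v. ip v s"] arg_cong [OF m, of "\<lambda>v. ip v s"]
      then show "ip (tri_comp (tau i x (cj z * cj y) + tau (i + 1) y (cj x * cj z) + tau (i + 2) z (cj y * cj x)) i t) s = ip 0 s"
        by (simp add: tri_comp_add tri_comp_tau 1 2 ab a_def [symmetric] b_def [symmetric] K_simps)
          (simp add: ip_commute algebra_simps)
    qed
  qed
  show ?thesis
  proof (rule tri_eqI_cyclic [of _ i])
    show "tri_comp (tau i x (cj z * cj y) + tau (i + 1) y (cj x * cj z) + tau (i + 2) z (cj y * cj x)) i = tri_comp 0 i"
      by (rule ext) (simp add: * tri_comp_zero)
    show "tri_comp (tau i x (cj z * cj y) + tau (i + 1) y (cj x * cj z) + tau (i + 2) z (cj y * cj x)) (i + 1) = tri_comp 0 (i + 1)"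
      using * [of "i + 1" y x z] unfolding three_add
      by (intro ext) (simp only: tri_comp_zero tri_comp_add plus_fun_apply zero_fun_apply add_ac)
    show "tri_comp (tau i x (cj z * cj y) + tau (i + 1) y (cj x * cj z) + tau (i + 2) z (cj y * cj x)) (i + 2) = tri_comp 0 (i + 2)"
      using * [of "i + 2" z y x] unfolding three_add
      by (intro ext) (simp only: tri_comp_zero tri_comp_add plus_fun_apply zero_fun_apply add_ac)
  qed
qed

section \<open>The Lie algebra built from triality\<close>

lemmas tensor_simps = bilinear_ladd [OF bilinear_tensor_pure] bilinear_radd [OF bilinear_tensor_pure]
  bilinear_lsub [OF bilinear_tensor_pure] bilinear_rsub [OF bilinear_tensor_pure]
  bilinear_lmul [OF bilinear_tensor_pure] bilinear_rmul [OF bilinear_tensor_pure]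
  bilinear_lneg [OF bilinear_tensor_pure] bilinear_rneg [OF bilinear_tensor_pure]
lemmas tensor_zero [simp] = bilinear_lzero [OF bilinear_tensor_pure] bilinear_rzero [OF bilinear_tensor_pure]

lemma tensor_map_add_left:
  assumes "linear f" "linear f'" "linear g"
  shows "tensor_map (f + f') g u = tensor_map f g u + tensor_map f' g u"
proof -
  have l: "linear (f + f')"
    using linear_compose_add [OF assms(1,2)] by (simp add: plus_fun_def)
  have "tensor_map (f + f') g = (\<lambda>u. tensor_map f g u + tensor_map f' g u)"
    by (rule tensor_linear_eqI)
      (simp_all add: linear_tensor_map linear_compose_add l assms tensor_map_pure tensor_simps)
  then show ?thesis by simp
qed

lemma tensor_map_add_right:
  assumes "linear f" "linear g" "linear g'"
  shows "tensor_map f (g + g') u = tensor_map f g u + tensor_map f g' u"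
proof -
  have l: "linear (g + g')"
    using linear_compose_add [OF assms(2,3)] by (simp add: plus_fun_def)
  have "tensor_map f (g + g') = (\<lambda>u. tensor_map f g u + tensor_map f g' u)"
    by (rule tensor_linear_eqI)
      (simp_all add: linear_tensor_map linear_compose_add l assms tensor_map_pure tensor_simps)
  then show ?thesis by simp
qed

lemma tensor_map_scaleR_left:
  assumes "linear f" "linear g"
  shows "tensor_map (r *\<^sub>R f) g u = r *\<^sub>R tensor_map f g u"
proof -
  have l: "linear (r *\<^sub>R f)"
    using linear_compose_scale_right [OF assms(1)] by (simp add: scaleR_fun_def)
  have "tensor_map (r *\<^sub>R f) g = (\<lambda>u. r *\<^sub>R tensor_map f g u)"
    by (rule tensor_linear_eqI)
      (simp_all add: linear_tensor_map linear_compose_scale_right l assms tensor_map_pure tensor_simps)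
  then show ?thesis by simp
qed

lemma tensor_map_scaleR_right:
  assumes "linear f" "linear g"
  shows "tensor_map f (r *\<^sub>R g) u = r *\<^sub>R tensor_map f g u"
proof -
  have l: "linear (r *\<^sub>R g)"
    using linear_compose_scale_right [OF assms(2)] by (simp add: scaleR_fun_def)
  have "tensor_map f (r *\<^sub>R g) = (\<lambda>u. r *\<^sub>R tensor_map f g u)"
    by (rule tensor_linear_eqI)
      (simp_all add: linear_tensor_map linear_compose_scale_right l assms tensor_map_pure tensor_simps)
  then show ?thesis by simp
qed

lemma linear_F: "linear (F i)"
  by (rule linearI) (simp_all add: F_def axis_def vec_eq_iff)

lemmas F_simps = linear_add [OF linear_F] linear_diff [OF linear_F] linear_scale [OF linear_F] linear_neg [OF linear_F]
lemmas F_zero [simp] = linear_0 [OF linear_F]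

lemma F_linear_eqI:
  fixes f g :: "('a::composition_algebra, 'b::composition_algebra) tensor^3 \<Rightarrow> 'c::real_vector"
  assumes f: "linear f" and g: "linear g" and eq: "\<And>i x y. f (F i (x \<otimes> y)) = g (F i (x \<otimes> y))"
  shows "f v = g v"
proof -
  have *: "(\<lambda>u. f (F i u)) = (\<lambda>u. g (F i u))" for i
    by (rule tensor_linear_eqI)
      (simp_all add: eq linear_compose [OF linear_F f, unfolded o_def] linear_compose [OF linear_F g, unfolded o_def])
  have "v = (\<Sum>i\<in>UNIV. F i (v $ i))"
    by (simp add: vec_eq_iff F_def axis_def)
  moreover have "f (\<Sum>i\<in>UNIV. F i (v $ i)) = g (\<Sum>i\<in>UNIV. F i (v $ i))"
    using * by (simp add: linear_sum [OF f] linear_sum [OF g] fun_eq_iff)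
  ultimately show ?thesis by simp
qed

lemma F_bilinear_eqI:
  assumes f: "bilinear f" and g: "bilinear g"
    and eq: "\<And>i j x\<^sub>1 x\<^sub>2 y\<^sub>1 y\<^sub>2. f (F i (x\<^sub>1 \<otimes> x\<^sub>2)) (F j (y\<^sub>1 \<otimes> y\<^sub>2)) = g (F i (x\<^sub>1 \<otimes> x\<^sub>2)) (F j (y\<^sub>1 \<otimes> y\<^sub>2))"
  shows "f v w = g v w"
proof -
  have l: "linear (\<lambda>v. f v w)" "linear (\<lambda>v. g v w)" "linear (f v)" "linear (g v)" for v w
    using f g unfolding bilinear_def by blast+
  have "f v (F j (y\<^sub>1 \<otimes> y\<^sub>2)) = g v (F j (y\<^sub>1 \<otimes> y\<^sub>2))" for v j y\<^sub>1 y\<^sub>2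
    by (rule F_linear_eqI [OF l(1) l(2)]) (rule eq)
  then show ?thesis
    by (rule F_linear_eqI [OF l(3,4)])
qed

section \<open>The bracket of two vectors, split into three bilinear maps\<close>

definition beta1 :: "('a::composition_algebra, 'b::composition_algebra) tensor^3 \<Rightarrow> ('a, 'b) tensor^3 \<Rightarrow> 'a end3" where
  "beta1 v w = (\<Sum>i\<in>UNIV. tensor_lift2 (\<lambda>x\<^sub>1 x\<^sub>2 y\<^sub>1 y\<^sub>2. ip x\<^sub>2 y\<^sub>2 *\<^sub>R tau i x\<^sub>1 y\<^sub>1) (v $ i) (w $ i))"

definition beta2 :: "('a::composition_algebra, 'b::composition_algebra) tensor^3 \<Rightarrow> ('a, 'b) tensor^3 \<Rightarrow> 'b end3" where
  "beta2 v w = (\<Sum>i\<in>UNIV. tensor_lift2 (\<lambda>x\<^sub>1 x\<^sub>2 y\<^sub>1 y\<^sub>2. ip x\<^sub>1 y\<^sub>1 *\<^sub>R tau i x\<^sub>2 y\<^sub>2) (v $ i) (w $ i))"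

definition crs :: "('a::composition_algebra, 'b::composition_algebra) tensor^3 \<Rightarrow> ('a, 'b) tensor^3 \<Rightarrow> ('a, 'b) tensor^3" where
  "crs v w = (\<chi> k. tensor_cross (v $ (k + 1)) (w $ (k + 2)) - tensor_cross (w $ (k + 1)) (v $ (k + 2)))"

lemma triality_bracket_eq:
  "triality_bracket (T, U, v) (T', U', w) = (end3_bracket T T' + beta1 v w, end3_bracket U U' + beta2 v w,
     tri_act T U w - tri_act T' U' v + crs v w)"
  by (simp add: beta1_def beta2_def crs_def)

lemma bilinear_sum_nth:
  assumes "\<And>i. bilinear (f i)"
  shows "bilinear (\<lambda>(v::'a::real_vector^3) (w::'b::real_vector^3). \<Sum>i\<in>UNIV. f i (v $ i) (w $ i))"
  unfolding bilinear_def
  by (auto intro!: linearI simp: sum_3 bilinear_ladd [OF assms] bilinear_radd [OF assms]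
      bilinear_lmul [OF assms] bilinear_rmul [OF assms] algebra_simps)

lemma bilinear_beta1: "bilinear beta1"
  unfolding beta1_def [abs_def] by (rule bilinear_sum_nth) (rule tri_tensor_lift2)

lemma bilinear_beta2: "bilinear beta2"
  unfolding beta2_def [abs_def] by (rule bilinear_sum_nth) (rule tri_tensor_lift2)

lemma bilinear_crs: "bilinear crs"
proof -
  note b = tri_tensor_lift2(3)
  show ?thesis
    unfolding bilinear_def crs_def
    by (auto intro!: linearI simp: vec_eq_iff bilinear_ladd [OF b] bilinear_radd [OF b]
      bilinear_lmul [OF b] bilinear_rmul [OF b] algebra_simps)
qed

lemmas crs_simps = bilinear_ladd [OF bilinear_crs] bilinear_radd [OF bilinear_crs]
  bilinear_lmul [OF bilinear_crs] bilinear_rmul [OF bilinear_crs]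
  bilinear_lneg [OF bilinear_crs] bilinear_rneg [OF bilinear_crs]
  bilinear_lsub [OF bilinear_crs] bilinear_rsub [OF bilinear_crs]
lemmas crs_zero [simp] = bilinear_lzero [OF bilinear_crs] bilinear_rzero [OF bilinear_crs]
lemmas beta_simps = bilinear_ladd [OF bilinear_beta1] bilinear_radd [OF bilinear_beta1]
  bilinear_lmul [OF bilinear_beta1] bilinear_rmul [OF bilinear_beta1]
  bilinear_ladd [OF bilinear_beta2] bilinear_radd [OF bilinear_beta2]
  bilinear_lmul [OF bilinear_beta2] bilinear_rmul [OF bilinear_beta2]
  bilinear_lneg [OF bilinear_beta1] bilinear_rneg [OF bilinear_beta1]
  bilinear_lneg [OF bilinear_beta2] bilinear_rneg [OF bilinear_beta2]
  bilinear_lsub [OF bilinear_beta1] bilinear_rsub [OF bilinear_beta1]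
  bilinear_lsub [OF bilinear_beta2] bilinear_rsub [OF bilinear_beta2]
lemmas beta_zero [simp] = bilinear_lzero [OF bilinear_beta1] bilinear_rzero [OF bilinear_beta1]
  bilinear_lzero [OF bilinear_beta2] bilinear_rzero [OF bilinear_beta2]

lemma F_nth: "F i u $ j = (if j = i then u else 0)"
  by (simp add: F_def axis_def)

lemma beta1_F: "beta1 (F i (x\<^sub>1 \<otimes> x\<^sub>2)) (F j (y\<^sub>1 \<otimes> y\<^sub>2)) = (if i = j then ip x\<^sub>2 y\<^sub>2 *\<^sub>R tau i x\<^sub>1 y\<^sub>1 else 0)"
proof -
  have "tensor_lift2 (\<lambda>x\<^sub>1 x\<^sub>2 y\<^sub>1 y\<^sub>2. ip x\<^sub>2 y\<^sub>2 *\<^sub>R tau k x\<^sub>1 y\<^sub>1) (F i (x\<^sub>1 \<otimes> x\<^sub>2) $ k) (F j (y\<^sub>1 \<otimes> y\<^sub>2) $ k) =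
    (if k = i then if i = j then ip x\<^sub>2 y\<^sub>2 *\<^sub>R tau i x\<^sub>1 y\<^sub>1 else 0 else 0)" for k
    by (simp add: F_nth tri_lift_zero tri_tensor_lift2)
  then show ?thesis
    unfolding beta1_def by simp
qed

lemma beta2_F: "beta2 (F i (x\<^sub>1 \<otimes> x\<^sub>2)) (F j (y\<^sub>1 \<otimes> y\<^sub>2)) = (if i = j then ip x\<^sub>1 y\<^sub>1 *\<^sub>R tau i x\<^sub>2 y\<^sub>2 else 0)"
proof -
  have "tensor_lift2 (\<lambda>x\<^sub>1 x\<^sub>2 y\<^sub>1 y\<^sub>2. ip x\<^sub>1 y\<^sub>1 *\<^sub>R tau k x\<^sub>2 y\<^sub>2) (F i (x\<^sub>1 \<otimes> x\<^sub>2) $ k) (F j (y\<^sub>1 \<otimes> y\<^sub>2) $ k) =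
    (if k = i then if i = j then ip x\<^sub>1 y\<^sub>1 *\<^sub>R tau i x\<^sub>2 y\<^sub>2 else 0 else 0)" for k
    by (simp add: F_nth tri_lift_zero tri_tensor_lift2)
  then show ?thesis
    unfolding beta2_def by simp
qed

lemma crs_skew: "crs w v = - crs v w"
  by (simp add: crs_def vec_eq_iff)

lemma crs_F:
  "crs (F i (x\<^sub>1 \<otimes> x\<^sub>2)) (F i (y\<^sub>1 \<otimes> y\<^sub>2)) = 0"
  "crs (F i (x\<^sub>1 \<otimes> x\<^sub>2)) (F (i + 1) (y\<^sub>1 \<otimes> y\<^sub>2)) = F (i + 2) ((cj y\<^sub>1 * cj x\<^sub>1) \<otimes> (cj y\<^sub>2 * cj x\<^sub>2))"
  "crs (F i (x\<^sub>1 \<otimes> x\<^sub>2)) (F (i + 2) (y\<^sub>1 \<otimes> y\<^sub>2)) = - F (i + 1) ((cj x\<^sub>1 * cj y\<^sub>1) \<otimes> (cj x\<^sub>2 * cj y\<^sub>2))"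
proof -
  have 1: "crs (F i (x\<^sub>1 \<otimes> x\<^sub>2)) (F i (y\<^sub>1 \<otimes> y\<^sub>2)) = 0" for i and x\<^sub>1 y\<^sub>1 :: 'a and x\<^sub>2 y\<^sub>2 :: 'b
    by (auto simp: crs_def F_nth tri_lift_zero vec_eq_iff)
  have 2: "crs (F i (x\<^sub>1 \<otimes> x\<^sub>2)) (F (i + 1) (y\<^sub>1 \<otimes> y\<^sub>2)) = F (i + 2) ((cj y\<^sub>1 * cj x\<^sub>1) \<otimes> (cj y\<^sub>2 * cj x\<^sub>2))"
    for i and x\<^sub>1 y\<^sub>1 :: 'a and x\<^sub>2 y\<^sub>2 :: 'b
  proof -
    have "crs (F i (x\<^sub>1 \<otimes> x\<^sub>2)) (F (i + 1) (y\<^sub>1 \<otimes> y\<^sub>2)) $ k = F (i + 2) ((cj y\<^sub>1 * cj x\<^sub>1) \<otimes> (cj y\<^sub>2 * cj x\<^sub>2)) $ k" for k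
      by (cases rule: three_cases [of k i]) (simp_all add: crs_def F_nth tri_lift_zero tri_tensor_lift2)
    then show ?thesis by (simp add: vec_eq_iff)
  qed
  show "crs (F i (x\<^sub>1 \<otimes> x\<^sub>2)) (F i (y\<^sub>1 \<otimes> y\<^sub>2)) = 0" by (rule 1)
  show "crs (F i (x\<^sub>1 \<otimes> x\<^sub>2)) (F (i + 1) (y\<^sub>1 \<otimes> y\<^sub>2)) = F (i + 2) ((cj y\<^sub>1 * cj x\<^sub>1) \<otimes> (cj y\<^sub>2 * cj x\<^sub>2))" by (rule 2)
  show "crs (F i (x\<^sub>1 \<otimes> x\<^sub>2)) (F (i + 2) (y\<^sub>1 \<otimes> y\<^sub>2)) = - F (i + 1) ((cj x\<^sub>1 * cj y\<^sub>1) \<otimes> (cj x\<^sub>2 * cj y\<^sub>2))"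
    using 2 [of "i + 2" y\<^sub>1 y\<^sub>2 x\<^sub>1 x\<^sub>2] crs_skew [of "F i (x\<^sub>1 \<otimes> x\<^sub>2)"] by simp
qed

lemma crs_F_shift:
  "crs (F (i + 1) (x\<^sub>1 \<otimes> x\<^sub>2)) (F (i + 2) (y\<^sub>1 \<otimes> y\<^sub>2)) = F i ((cj y\<^sub>1 * cj x\<^sub>1) \<otimes> (cj y\<^sub>2 * cj x\<^sub>2))"
  "crs (F (i + 1) (x\<^sub>1 \<otimes> x\<^sub>2)) (F i (y\<^sub>1 \<otimes> y\<^sub>2)) = - F (i + 2) ((cj x\<^sub>1 * cj y\<^sub>1) \<otimes> (cj x\<^sub>2 * cj y\<^sub>2))"
  "crs (F (i + 2) (x\<^sub>1 \<otimes> x\<^sub>2)) (F i (y\<^sub>1 \<otimes> y\<^sub>2)) = F (i + 1) ((cj y\<^sub>1 * cj x\<^sub>1) \<otimes> (cj y\<^sub>2 * cj x\<^sub>2))"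
  "crs (F (i + 2) (x\<^sub>1 \<otimes> x\<^sub>2)) (F (i + 1) (y\<^sub>1 \<otimes> y\<^sub>2)) = - F i ((cj x\<^sub>1 * cj y\<^sub>1) \<otimes> (cj x\<^sub>2 * cj y\<^sub>2))"
  using crs_F [of "i + 1" x\<^sub>1 x\<^sub>2 y\<^sub>1 y\<^sub>2] crs_F [of "i + 2" x\<^sub>1 x\<^sub>2 y\<^sub>1 y\<^sub>2] by simp_all

lemma beta1_skew: "beta1 w v = - beta1 v w"
proof (rule F_bilinear_eqI [of "\<lambda>v w. beta1 w v" "\<lambda>v w. - beta1 v w" v w])
  show "bilinear (\<lambda>v w. beta1 w v)" "bilinear (\<lambda>v w. - beta1 v w)"
    by (auto simp: bilinear_def beta_simps intro!: linearI)
  fix i j :: 3 and x\<^sub>1 y\<^sub>1 :: 'a and x\<^sub>2 y\<^sub>2 :: 'b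
  show "beta1 (F j (y\<^sub>1 \<otimes> y\<^sub>2)) (F i (x\<^sub>1 \<otimes> x\<^sub>2)) = - beta1 (F i (x\<^sub>1 \<otimes> x\<^sub>2)) (F j (y\<^sub>1 \<otimes> y\<^sub>2))"
    using tau_skew [of i x\<^sub>1 y\<^sub>1] ip_commute [of x\<^sub>2 y\<^sub>2] by (simp add: beta1_F)
qed

lemma beta2_skew:
  fixes v w :: "('a::composition_algebra, 'b::composition_algebra) tensor^3"
  shows "beta2 w v = - beta2 v w"
proof (rule F_bilinear_eqI [of "\<lambda>v w. beta2 w v" "\<lambda>v w. - beta2 v w" v w])
  show "bilinear (\<lambda>v w. beta2 w v)" "bilinear (\<lambda>v w. - beta2 v w)"
    by (auto simp: bilinear_def beta_simps intro!: linearI)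
  fix i j :: 3 and x\<^sub>1 y\<^sub>1 :: 'a and x\<^sub>2 y\<^sub>2 :: 'b
  show "beta2 (F j (y\<^sub>1 \<otimes> y\<^sub>2)) (F i (x\<^sub>1 \<otimes> x\<^sub>2)) = - beta2 (F i (x\<^sub>1 \<otimes> x\<^sub>2)) (F j (y\<^sub>1 \<otimes> y\<^sub>2))"
    using tau_skew [of i x\<^sub>2 y\<^sub>2] ip_commute [of x\<^sub>1 y\<^sub>1] by (simp add: beta2_F)
qed

lemma F_subspace_UNIV:
  fixes u :: "('a::composition_algebra, 'b::composition_algebra) tensor^3"
  assumes S: "subspace S" and gen: "\<And>i x y. F i (x \<otimes> y) \<in> S"
  shows "u \<in> S"
proof -
  have "F i t \<in> S" for i t
  proof -
    have "t \<in> span (range (\<lambda>(a, b). a \<otimes> b))"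
      by (simp add: span_tensor_pure)
    then show ?thesis
      by (induction rule: span_induct_alt)
        (use assms in \<open>auto simp: subspace_0 F_simps subspace_add subspace_scale\<close>)
  qed
  then have "(\<Sum>i\<in>UNIV. F i (u $ i)) \<in> S"
    by (intro subspace_sum S)
  moreover have "u = (\<Sum>i\<in>UNIV. F i (u $ i))"
    by (simp add: vec_eq_iff F_nth)
  ultimately show ?thesis by simp
qed

lemma beta_Tri: "beta1 v w \<in> Tri" "beta2 v w \<in> Tri"
proof -
  note simps = beta_simps Tri_closed(2,3) subspace_0 [OF subspace_Tri]
  have F: "v \<in> {v. beta1 v (F j (y\<^sub>1 \<otimes> y\<^sub>2)) \<in> Tri \<and> beta2 v (F j (y\<^sub>1 \<otimes> y\<^sub>2)) \<in> Tri}"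
    for j y\<^sub>1 y\<^sub>2 and v :: "('a, 'b) tensor^3"
    by (rule F_subspace_UNIV) (auto simp: subspace_def simps beta1_F beta2_F tau_Tri)
  have "w \<in> {w. beta1 v w \<in> Tri \<and> beta2 v w \<in> Tri}"
    by (rule F_subspace_UNIV) (use F in \<open>auto simp: subspace_def simps\<close>)
  then show "beta1 v w \<in> Tri" "beta2 v w \<in> Tri"
    by simp_all
qed

section \<open>The action of trialities on vectors\<close>

lemma linear_tri_act: "\<lbrakk>T \<in> Tri; U \<in> Tri\<rbrakk> \<Longrightarrow> linear (tri_act T U)"
  unfolding tri_act_def
  by (rule linearI) (simp_all add: vec_eq_iff linear_add [OF linear_tensor_map] linear_scale [OF linear_tensor_map]
      linear_tri_comp linear_id algebra_simps)

lemma tri_act_add: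
  assumes "T \<in> Tri" "U \<in> Tri" "T' \<in> Tri" "U' \<in> Tri"
  shows "tri_act (T + T') (U + U') v = tri_act T U v + tri_act T' U' v"
  using assms by (simp add: tri_act_def vec_eq_iff tri_comp_add tensor_map_add_left tensor_map_add_right
      linear_tri_comp linear_id)

lemma tri_act_scaleR:
  assumes "T \<in> Tri" "U \<in> Tri"
  shows "tri_act (r *\<^sub>R T) (r *\<^sub>R U) v = r *\<^sub>R tri_act T U v"
  using assms by (simp add: tri_act_def vec_eq_iff tri_comp_scaleR tensor_map_scaleR_left tensor_map_scaleR_right
      linear_tri_comp linear_id algebra_simps)

lemmas tri_act_lin = linear_add [OF linear_tri_act] linear_diff [OF linear_tri_act] linear_scale [OF linear_tri_act]
  linear_neg [OF linear_tri_act] linear_0 [OF linear_tri_act]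

lemma tri_act_bracket:
  assumes "T \<in> Tri" "U \<in> Tri" "T' \<in> Tri" "U' \<in> Tri"
  shows "tri_act (end3_bracket T T') (end3_bracket U U') v =
    tri_act T U (tri_act T' U' v) - tri_act T' U' (tri_act T U v)"
proof (rule F_linear_eqI [of "tri_act (end3_bracket T T') (end3_bracket U U')"
      "\<lambda>v. tri_act T U (tri_act T' U' v) - tri_act T' U' (tri_act T U v)"])
  show "linear (tri_act (end3_bracket T T') (end3_bracket U U'))"
    by (intro linear_tri_act Tri_closed assms)
  show "linear (\<lambda>v. tri_act T U (tri_act T' U' v) - tri_act T' U' (tri_act T U v))"
    by (rule linearI) (simp_all add: tri_act_lin assms algebra_simps)
  fix i and x :: 'a and y :: 'b
  show "tri_act (end3_bracket T T') (end3_bracket U U') (F i (x \<otimes> y)) =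
    tri_act T U (tri_act T' U' (F i (x \<otimes> y))) - tri_act T' U' (tri_act T U (F i (x \<otimes> y)))"
    by (simp add: tri_act_F tri_act_lin assms F_simps Tri_closed tri_comp_bracket commutator_def tensor_simps)
qed

lemma tri_act_crs:
  assumes T: "T \<in> Tri" and U: "U \<in> Tri"
  shows "tri_act T U (crs v w) = crs (tri_act T U v) w + crs v (tri_act T U w)"
proof (rule F_bilinear_eqI [of "\<lambda>v w. tri_act T U (crs v w)" "\<lambda>v w. crs (tri_act T U v) w + crs v (tri_act T U w)"])
  show "bilinear (\<lambda>v w. tri_act T U (crs v w))" "bilinear (\<lambda>v w. crs (tri_act T U v) w + crs v (tri_act T U w))"
    unfolding bilinear_def by (auto intro!: linearI simp: tri_act_lin [OF T U] crs_simps algebra_simps)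
  have eq: "tri_act T U (crs (F i (x\<^sub>1 \<otimes> x\<^sub>2)) (F (i + 1) (y\<^sub>1 \<otimes> y\<^sub>2))) =
     crs (tri_act T U (F i (x\<^sub>1 \<otimes> x\<^sub>2))) (F (i + 1) (y\<^sub>1 \<otimes> y\<^sub>2)) + crs (F i (x\<^sub>1 \<otimes> x\<^sub>2)) (tri_act T U (F (i + 1) (y\<^sub>1 \<otimes> y\<^sub>2)))"
    for i x\<^sub>1 x\<^sub>2 y\<^sub>1 y\<^sub>2
    by (simp add: crs_F tri_act_F T U F_simps crs_simps Tri_mult tensor_simps)
  fix i j :: 3 and x\<^sub>1 y\<^sub>1 :: 'a and x\<^sub>2 y\<^sub>2 :: 'b
  show "tri_act T U (crs (F i (x\<^sub>1 \<otimes> x\<^sub>2)) (F j (y\<^sub>1 \<otimes> y\<^sub>2))) =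
     crs (tri_act T U (F i (x\<^sub>1 \<otimes> x\<^sub>2))) (F j (y\<^sub>1 \<otimes> y\<^sub>2)) + crs (F i (x\<^sub>1 \<otimes> x\<^sub>2)) (tri_act T U (F j (y\<^sub>1 \<otimes> y\<^sub>2)))"
  proof (cases rule: three_cases [of j i])
    case 1
    then show ?thesis by (simp add: crs_F tri_act_F T U F_simps crs_simps tri_act_lin)
  next
    case 2
    then show ?thesis using eq by simp
  next
    case 3
    \<comment> \<open>Skewness of \<open>crs\<close> reduces this order of indices to the cyclic
      one.\<close>
    then have i: "i = j + 1" by simp
    show ?thesis
      unfolding i crs_skew [of "F (j + 1) _"] crs_skew [of "tri_act T U (F (j + 1) _)"] tri_act_lin(4) [OF T U]
      using eq [of j y\<^sub>1 y\<^sub>2 x\<^sub>1 x\<^sub>2] by simp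
  qed
qed

lemma end3_bracket_lin:
  assumes "T \<in> Tri"
  shows "end3_bracket T (A + B) = end3_bracket T A + end3_bracket T B"
    "end3_bracket T (r *\<^sub>R A) = r *\<^sub>R end3_bracket T A"
    "end3_bracket (A + B) T = end3_bracket A T + end3_bracket B T"
    "end3_bracket (r *\<^sub>R A) T = r *\<^sub>R end3_bracket A T"
  by (rule tri_eqI; simp add: tri_comp_add tri_comp_scaleR tri_comp_bracket commutator_def fun_eq_iff
      linear_add [OF linear_tri_comp [OF assms]] linear_scale [OF linear_tri_comp [OF assms]] algebra_simps)+

lemma end3_bracket_zero_right: "T \<in> Tri \<Longrightarrow> end3_bracket T 0 = 0"
  using end3_bracket_lin(2) [of T 0 0] by simp

lemma end3_bracket_self: "end3_bracket T T = 0"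
  by (rule tri_eqI) (simp add: tri_comp_bracket tri_comp_zero commutator_def)

lemma end3_bracket_skew: "end3_bracket U T = - end3_bracket T U"
proof -
  have "end3_bracket U T + end3_bracket T U = 0"
    by (rule tri_eqI) (simp add: tri_comp_add tri_comp_bracket tri_comp_zero commutator_def)
  then show ?thesis by (simp add: eq_neg_iff_add_eq_0)
qed

lemma end3_bracket_jacobi:
  assumes "T \<in> Tri" "U \<in> Tri" "V \<in> Tri"
  shows "end3_bracket T (end3_bracket U V) + end3_bracket U (end3_bracket V T) + end3_bracket V (end3_bracket T U) = 0"
  by (rule tri_eqI)
    (simp add: tri_comp_add tri_comp_bracket tri_comp_zero commutator_def fun_eq_iff assms linear_diff [OF linear_tri_comp])

lemma end3_bracket_beta:
  assumes T: "T \<in> Tri" and U: "U \<in> Tri"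
  shows "end3_bracket T (beta1 v w) = beta1 (tri_act T U v) w + beta1 v (tri_act T U w)"
    and "end3_bracket U (beta2 v w) = beta2 (tri_act T U v) w + beta2 v (tri_act T U w)"
proof -
  note lins = tri_act_lin [OF T U] beta_simps end3_bracket_lin [OF T] end3_bracket_lin [OF U]
  note tl = bilinear_ladd [OF bilinear_tau] bilinear_radd [OF bilinear_tau]
  have sk: "ip (tri_comp U i x) y = - ip x (tri_comp U i y)" "ip (tri_comp T i x') y' = - ip x' (tri_comp T i y')" for i x y x' y'
    by (rule so_skew, rule Tri_so, rule U) (rule so_skew, rule Tri_so, rule T)
  show "end3_bracket T (beta1 v w) = beta1 (tri_act T U v) w + beta1 v (tri_act T U w)"
    by (rule F_bilinear_eqI [of "\<lambda>v w. end3_bracket T (beta1 v w)" "\<lambda>v w. beta1 (tri_act T U v) w + beta1 v (tri_act T U w)"])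
      (auto simp: bilinear_def lins T U tri_act_F F_simps beta1_F end3_bracket_tau sk end3_bracket_zero_right algebra_simps intro!: linearI)
  show "end3_bracket U (beta2 v w) = beta2 (tri_act T U v) w + beta2 v (tri_act T U w)"
    by (rule F_bilinear_eqI [of "\<lambda>v w. end3_bracket U (beta2 v w)" "\<lambda>v w. beta2 (tri_act T U v) w + beta2 v (tri_act T U w)"])
      (auto simp: bilinear_def lins T U tri_act_F F_simps beta2_F end3_bracket_tau sk end3_bracket_zero_right algebra_simps intro!: linearI)
qed

section \<open>The Jacobi identity for three vectors\<close>

lemma F_trilinear_eqI:
  assumes "\<And>v w. linear (\<lambda>u. f u v w)" "\<And>u w. linear (\<lambda>v. f u v w)" "\<And>u v. linear (\<lambda>w. f u v w)"
    and eq: "\<And>i j k x\<^sub>1 x\<^sub>2 y\<^sub>1 y\<^sub>2 z\<^sub>1 z\<^sub>2. f (F i (x\<^sub>1 \<otimes> x\<^sub>2)) (F j (y\<^sub>1 \<otimes> y\<^sub>2)) (F k (z\<^sub>1 \<otimes> z\<^sub>2)) = 0"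
  shows "f u v w = 0"
proof -
  have "f (F i (x\<^sub>1 \<otimes> x\<^sub>2)) v w = 0" for i x\<^sub>1 x\<^sub>2 v w
    by (rule F_bilinear_eqI [of "f (F i (x\<^sub>1 \<otimes> x\<^sub>2))" "\<lambda>v w. 0"])
      (auto simp: eq bilinear_def assms linear_zero)
  then show ?thesis
    by (rule F_linear_eqI [OF assms(1) linear_zero])
qed

text \<open>The sum of \<open>(a - b) \<otimes> (a + b)\<close> and
  \<open>(a + b) \<otimes> (a - b)\<close> is twice \<open>a \<otimes> a - b \<otimes> b\<close>,
  here with separate elements in the two slots. The hypotheses are sandwich identities; the
  conclusion turns the action of \<open>tau\<close> on a vector of another index into a difference
  of two double products.\<close>

lemma tensor_difference_of_squares:
  assumes "a\<^sub>1 + b\<^sub>1 = (2 * p\<^sub>1) *\<^sub>R z\<^sub>1" "a\<^sub>2 + b\<^sub>2 = (2 * p\<^sub>2) *\<^sub>R z\<^sub>2"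
  shows "p\<^sub>2 *\<^sub>R ((a\<^sub>1 - b\<^sub>1) \<otimes> z\<^sub>2) + p\<^sub>1 *\<^sub>R (z\<^sub>1 \<otimes> (a\<^sub>2 - b\<^sub>2)) = a\<^sub>1 \<otimes> a\<^sub>2 - b\<^sub>1 \<otimes> b\<^sub>2"
proof -
  have "2 *\<^sub>R (p\<^sub>2 *\<^sub>R ((a\<^sub>1 - b\<^sub>1) \<otimes> z\<^sub>2) + p\<^sub>1 *\<^sub>R (z\<^sub>1 \<otimes> (a\<^sub>2 - b\<^sub>2))) =
      (a\<^sub>1 - b\<^sub>1) \<otimes> (a\<^sub>2 + b\<^sub>2) + (a\<^sub>1 + b\<^sub>1) \<otimes> (a\<^sub>2 - b\<^sub>2)"
    by (simp add: assms tensor_simps(5,6) scaleR_add_right)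
  also have "\<dots> = 2 *\<^sub>R (a\<^sub>1 \<otimes> a\<^sub>2 - b\<^sub>1 \<otimes> b\<^sub>2)"
    by (simp add: tensor_simps scaleR_2)
  finally show ?thesis
    by (simp only: scaleR_cancel_left) simp
qed

lemma beta_crs_cyclic:
  "beta1 u (crs v w) + beta1 v (crs w u) + beta1 w (crs u v) = 0"
  "beta2 u (crs v w) + beta2 v (crs w u) + beta2 w (crs u v) = 0"
proof -
  let ?f1 = "\<lambda>u v w :: ('a, 'b) tensor^3. beta1 u (crs v w) + beta1 v (crs w u) + beta1 w (crs u v)"
  let ?f2 = "\<lambda>u v w :: ('a, 'b) tensor^3. beta2 u (crs v w) + beta2 v (crs w u) + beta2 w (crs u v)"
  have dist: "?f1 (F i (x\<^sub>1 \<otimes> x\<^sub>2)) (F (i + 1) (y\<^sub>1 \<otimes> y\<^sub>2)) (F (i + 2) (z\<^sub>1 \<otimes> z\<^sub>2)) = 0"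
    "?f2 (F i (x\<^sub>1 \<otimes> x\<^sub>2)) (F (i + 1) (y\<^sub>1 \<otimes> y\<^sub>2)) (F (i + 2) (z\<^sub>1 \<otimes> z\<^sub>2)) = 0"
    for i x\<^sub>1 x\<^sub>2 y\<^sub>1 y\<^sub>2 z\<^sub>1 z\<^sub>2
  proof -
    \<comment> \<open>\<open>ip_cyclic\<close> makes the three scalar coefficients equal, so they
      factor out of \<open>tau_cyclic_sum\<close>.\<close>
    have t: "ip x (cj z * cj y) = ip z (cj y * cj x)" "ip y (cj x * cj z) = ip z (cj y * cj x)" for x y z :: "'c::composition_algebra"
      using ip_cyclic [of y x z] ip_cyclic [of x z y] by (simp_all add: ip_commute)
    show "?f1 (F i (x\<^sub>1 \<otimes> x\<^sub>2)) (F (i + 1) (y\<^sub>1 \<otimes> y\<^sub>2)) (F (i + 2) (z\<^sub>1 \<otimes> z\<^sub>2)) = 0"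
      by (simp only: crs_F crs_F_shift beta1_F t simp_thms if_True scaleR_add_right [symmetric] tau_cyclic_sum scaleR_zero_right)
    show "?f2 (F i (x\<^sub>1 \<otimes> x\<^sub>2)) (F (i + 1) (y\<^sub>1 \<otimes> y\<^sub>2)) (F (i + 2) (z\<^sub>1 \<otimes> z\<^sub>2)) = 0"
      by (simp only: crs_F crs_F_shift beta2_F t simp_thms if_True scaleR_add_right [symmetric] tau_cyclic_sum scaleR_zero_right)
  qed
  have dist': "?f1 (F i (x\<^sub>1 \<otimes> x\<^sub>2)) (F (i + 2) (y\<^sub>1 \<otimes> y\<^sub>2)) (F (i + 1) (z\<^sub>1 \<otimes> z\<^sub>2)) = 0"
    "?f2 (F i (x\<^sub>1 \<otimes> x\<^sub>2)) (F (i + 2) (y\<^sub>1 \<otimes> y\<^sub>2)) (F (i + 1) (z\<^sub>1 \<otimes> z\<^sub>2)) = 0"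
    for i x\<^sub>1 x\<^sub>2 y\<^sub>1 y\<^sub>2 z\<^sub>1 z\<^sub>2
  proof -
    have sw: "?f1 u w v = - ?f1 u v w" "?f2 u w v = - ?f2 u v w" for u v w
      using crs_skew [of w v] crs_skew [of u w] crs_skew [of v u] by (simp_all add: beta_simps)
    show "?f1 (F i (x\<^sub>1 \<otimes> x\<^sub>2)) (F (i + 2) (y\<^sub>1 \<otimes> y\<^sub>2)) (F (i + 1) (z\<^sub>1 \<otimes> z\<^sub>2)) = 0"
      by (rule trans [OF sw(1)]) (simp only: dist minus_zero)
    show "?f2 (F i (x\<^sub>1 \<otimes> x\<^sub>2)) (F (i + 2) (y\<^sub>1 \<otimes> y\<^sub>2)) (F (i + 1) (z\<^sub>1 \<otimes> z\<^sub>2)) = 0"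
      by (rule trans [OF sw(2)]) (simp only: dist minus_zero)
  qed
  have rest: "?f1 (F i (x\<^sub>1 \<otimes> x\<^sub>2)) (F j (y\<^sub>1 \<otimes> y\<^sub>2)) (F k (z\<^sub>1 \<otimes> z\<^sub>2)) = 0 \<and>
      ?f2 (F i (x\<^sub>1 \<otimes> x\<^sub>2)) (F j (y\<^sub>1 \<otimes> y\<^sub>2)) (F k (z\<^sub>1 \<otimes> z\<^sub>2)) = 0"
    for i j k x\<^sub>1 x\<^sub>2 y\<^sub>1 y\<^sub>2 z\<^sub>1 z\<^sub>2
  proof -
    show ?thesis
      by (cases rule: three_cases [of j i]; cases rule: three_cases [of k i])
        (simp_all only: dist dist' simp_thms, simp_all add: crs_F crs_F_shift beta1_F beta2_F beta_simps)
  qed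
  show "?f1 u v w = 0"
    by (rule F_trilinear_eqI [of ?f1]; (rule linearI; simp add: crs_simps beta_simps algebra_simps | simp only: rest))
  show "?f2 u v w = 0"
    by (rule F_trilinear_eqI [of ?f2]; (rule linearI; simp add: crs_simps beta_simps algebra_simps | simp only: rest))
qed

text \<open>The vector part of the Jacobi identity. With all indices equal the double products
  vanish and the \<open>S_map\<close> terms cancel cyclically; with exactly two equal it is
  \<open>tensor_difference_of_squares\<close>; with all distinct both sides are zero.\<close>

lemma tri_act_beta_cyclic:
  "tri_act (beta1 v w) (beta2 v w) u + tri_act (beta1 w u) (beta2 w u) v + tri_act (beta1 u v) (beta2 u v) w =
   crs u (crs v w) + crs v (crs w u) + crs w (crs u v)"
proof -
  define f where "f = (\<lambda>u v w :: ('a, 'b) tensor^3.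
     (tri_act (beta1 v w) (beta2 v w) u + tri_act (beta1 w u) (beta2 w u) v + tri_act (beta1 u v) (beta2 u v) w) -
     (crs u (crs v w) + crs v (crs w u) + crs w (crs u v)))"
  have rot: "f u v w = f v w u" for u v w
    by (simp add: f_def algebra_simps)
  have act: "tri_act (beta1 (F i (x\<^sub>1 \<otimes> x\<^sub>2)) (F j (y\<^sub>1 \<otimes> y\<^sub>2))) (beta2 (F i (x\<^sub>1 \<otimes> x\<^sub>2)) (F j (y\<^sub>1 \<otimes> y\<^sub>2))) (F k (z\<^sub>1 \<otimes> z\<^sub>2)) =
     (if i = j then F k (ip x\<^sub>2 y\<^sub>2 *\<^sub>R (tri_comp (tau i x\<^sub>1 y\<^sub>1) k z\<^sub>1 \<otimes> z\<^sub>2) + ip x\<^sub>1 y\<^sub>1 *\<^sub>R (z\<^sub>1 \<otimes> tri_comp (tau i x\<^sub>2 y\<^sub>2) k z\<^sub>2)) else 0)"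
    for i j k x\<^sub>1 x\<^sub>2 y\<^sub>1 y\<^sub>2 z\<^sub>1 z\<^sub>2
    by (simp add: beta1_F beta2_F tri_act_F tau_Tri Tri_closed tri_comp_scaleR tensor_simps tri_act_zero tri_comp_zero)
  have 0: "f (F i (x\<^sub>1 \<otimes> x\<^sub>2)) (F i (y\<^sub>1 \<otimes> y\<^sub>2)) (F i (z\<^sub>1 \<otimes> z\<^sub>2)) = 0" for i x\<^sub>1 x\<^sub>2 y\<^sub>1 y\<^sub>2 z\<^sub>1 z\<^sub>2
    by (simp add: f_def act crs_F F_simps [symmetric] tri_comp_tau)
      (simp add: tensor_simps algebra_simps ip_commute)
  have 1: "f (F i (x\<^sub>1 \<otimes> x\<^sub>2)) (F i (y\<^sub>1 \<otimes> y\<^sub>2)) (F (i + 1) (z\<^sub>1 \<otimes> z\<^sub>2)) = 0" for i x\<^sub>1 x\<^sub>2 y\<^sub>1 y\<^sub>2 z\<^sub>1 z\<^sub>2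
  proof -
    show ?thesis
      using tensor_difference_of_squares [OF cj_sandwich_left [of y\<^sub>1 x\<^sub>1 z\<^sub>1] cj_sandwich_left [of y\<^sub>2 x\<^sub>2 z\<^sub>2]]
      by (simp add: f_def act crs_F crs_F_shift crs_simps tri_comp_tau cj_mult ip_commute) (simp add: F_simps [symmetric])
  qed
  have 2: "f (F i (x\<^sub>1 \<otimes> x\<^sub>2)) (F i (y\<^sub>1 \<otimes> y\<^sub>2)) (F (i + 2) (z\<^sub>1 \<otimes> z\<^sub>2)) = 0" for i x\<^sub>1 x\<^sub>2 y\<^sub>1 y\<^sub>2 z\<^sub>1 z\<^sub>2
  proof -
    show ?thesis
      using tensor_difference_of_squares [OF cj_sandwich_right [of z\<^sub>1 x\<^sub>1 y\<^sub>1] cj_sandwich_right [of z\<^sub>2 x\<^sub>2 y\<^sub>2]]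
      by (simp add: f_def act crs_F crs_F_shift crs_simps tri_comp_tau cj_mult) (simp add: F_simps [symmetric])
  qed
  have 3: "f (F i (x\<^sub>1 \<otimes> x\<^sub>2)) (F j (y\<^sub>1 \<otimes> y\<^sub>2)) (F k (z\<^sub>1 \<otimes> z\<^sub>2)) = 0" if "i \<noteq> j" "j \<noteq> k" "i \<noteq> k"
    for i j k x\<^sub>1 x\<^sub>2 y\<^sub>1 y\<^sub>2 z\<^sub>1 z\<^sub>2
  proof -
    have "crs (F i (x\<^sub>1 \<otimes> x\<^sub>2)) (crs (F j (y\<^sub>1 \<otimes> y\<^sub>2)) (F k (z\<^sub>1 \<otimes> z\<^sub>2))) = 0"
      if "i \<noteq> j" "j \<noteq> k" "i \<noteq> k" for i j k and x\<^sub>1 y\<^sub>1 z\<^sub>1 :: 'a and x\<^sub>2 y\<^sub>2 z\<^sub>2 :: 'b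
      using that
      by (cases rule: three_cases [of j i]; cases rule: three_cases [of k i])
        (simp_all add: crs_F crs_F_shift crs_simps)
    from this [of i j k] this [of j k i] this [of k i j] show ?thesis
      using that by (simp add: f_def act)
  qed
  have "f u v w = 0"
  proof (rule F_trilinear_eqI [of f])
    note lin = crs_simps beta_simps tri_act_add tri_act_scaleR beta_Tri tri_act_lin Tri_closed
    show "linear (\<lambda>u. f u v w)" for v w
      by (rule linearI; simp add: f_def lin algebra_simps)
    show "linear (\<lambda>v. f u v w)" for u w
      by (rule linearI; simp add: f_def lin algebra_simps)
    show "linear (\<lambda>w. f u v w)" for u v
      by (rule linearI; simp add: f_def lin algebra_simps)
    show "f (F i (x\<^sub>1 \<otimes> x\<^sub>2)) (F j (y\<^sub>1 \<otimes> y\<^sub>2)) (F k (z\<^sub>1 \<otimes> z\<^sub>2)) = 0" for i j k x\<^sub>1 x\<^sub>2 y\<^sub>1 y\<^sub>2 z\<^sub>1 z\<^sub>2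
    proof -
      have p: "f (F i (x\<^sub>1 \<otimes> x\<^sub>2)) (F i (y\<^sub>1 \<otimes> y\<^sub>2)) (F k (z\<^sub>1 \<otimes> z\<^sub>2)) = 0" for i k x\<^sub>1 x\<^sub>2 y\<^sub>1 y\<^sub>2 z\<^sub>1 z\<^sub>2
        by (cases rule: three_cases [of k i]) (simp_all add: 0 1 2)
      consider "i = j" | "j = k" | "i = k" | "i \<noteq> j" "j \<noteq> k" "i \<noteq> k" by blast
      then show ?thesis
      proof cases
        assume "j = k"
        then show ?thesis by (subst rot) (simp add: p)
      next
        assume "i = k"
        then show ?thesis by (subst rot, subst rot) (simp add: p)
      qed (simp_all add: p 3)
    qed
  qed
  then show ?thesis by (simp add: f_def)
qed

text \<open>Expanded by multilinearity, the Jacobi identity sorts by the number of vectors among its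
  arguments: none is the identity for commutators, one says that \<open>tri_act\<close> is a
  representation, two that \<open>beta1\<close>, \<open>beta2\<close> and \<open>crs\<close> are
  equivariant, and three are the cyclic identities above.\<close>

theorem lie_algebra_on_triality:
  "lie_algebra_on (triality_algebra :: ('a::composition_algebra, 'b::composition_algebra) triality set) triality_bracket"
proof
  have zero_triple: "(0 :: ('a, 'b) triality) = (0, 0, 0)"
    by (simp add: zero_prod_def)
  show "subspace (triality_algebra :: ('a, 'b) triality set)"
    by (auto simp: triality_algebra_def subspace_def Tri_closed zero_Tri [unfolded zero_prod_def] zero_prod_def)
  fix x y z :: "('a, 'b) triality" and r :: real
  assume "x \<in> triality_algebra" "y \<in> triality_algebra"
  then obtain T U u T' U' v where x: "x = (T, U, u)" "T \<in> Tri" "U \<in> Tri"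
      and y: "y = (T', U', v)" "T' \<in> Tri" "U' \<in> Tri"
    by (auto simp: triality_algebra_def)
  note Tr = x(2,3) y(2,3)
  show "triality_bracket x y \<in> triality_algebra"
    by (simp add: x(1) y(1) triality_bracket_eq triality_algebra_def Tri_closed beta_Tri Tr del: triality_bracket.simps)
  show "triality_bracket (r *\<^sub>R x) y = r *\<^sub>R triality_bracket x y"
    "triality_bracket x (r *\<^sub>R y) = r *\<^sub>R triality_bracket x y"
    by (simp_all add: x(1) y(1) triality_bracket_eq end3_bracket_lin Tr beta_simps tri_act_scaleR tri_act_lin crs_simps
        scaleR_add_right scaleR_diff_right del: triality_bracket.simps)
  show "triality_bracket x x = 0"
  proof -
    have "crs u u = 0" "beta1 u u = 0" "beta2 u u = 0"
      using crs_skew [of u u] beta1_skew [of u u] beta2_skew [of u u] by (simp_all add: eq_neg_iff_add_eq_0 scaleR_2 [symmetric])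
    then show ?thesis
      by (simp add: x(1) triality_bracket_eq end3_bracket_self zero_prod_def del: triality_bracket.simps)
  qed
  assume "z \<in> triality_algebra"
  then obtain T'' U'' w where z: "z = (T'', U'', w)" "T'' \<in> Tri" "U'' \<in> Tri"
    by (auto simp: triality_algebra_def)
  note Tr = Tr z(2,3)
  show "triality_bracket (x + y) z = triality_bracket x z + triality_bracket y z"
    "triality_bracket x (y + z) = triality_bracket x y + triality_bracket x z"
    by (simp_all add: x(1) y(1) z(1) triality_bracket_eq end3_bracket_lin Tr beta_simps tri_act_add tri_act_lin crs_simps
        algebra_simps del: triality_bracket.simps)
  note b = beta_Tri Tri_closed Tr
  have 1: "end3_bracket T (end3_bracket T' T'') + beta1 u (tri_act T' U' w - tri_act T'' U'' v + crs v w) + end3_bracket T (beta1 v w)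
     + (end3_bracket T' (end3_bracket T'' T) + beta1 v (tri_act T'' U'' u - tri_act T U w + crs w u) + end3_bracket T' (beta1 w u))
     + (end3_bracket T'' (end3_bracket T T') + beta1 w (tri_act T U v - tri_act T' U' u + crs u v) + end3_bracket T'' (beta1 u v)) = 0"
  proof -
    have "beta1 u (tri_act T' U' w) = - beta1 (tri_act T' U' w) u" "beta1 v (tri_act T'' U'' u) = - beta1 (tri_act T'' U'' u) v"
      "beta1 w (tri_act T U v) = - beta1 (tri_act T U v) w"
      by (rule beta1_skew)+
    then show ?thesis
      using end3_bracket_jacobi [OF Tr(1,3,5)] beta_crs_cyclic(1) [of u v w]
      by (simp add: end3_bracket_beta(1) [OF Tr(1,2)] end3_bracket_beta(1) [OF Tr(3,4)] end3_bracket_beta(1) [OF Tr(5,6)]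
          beta_simps algebra_simps)
  qed
  have 2: "end3_bracket U (end3_bracket U' U'') + beta2 u (tri_act T' U' w - tri_act T'' U'' v + crs v w) + end3_bracket U (beta2 v w)
     + (end3_bracket U' (end3_bracket U'' U) + beta2 v (tri_act T'' U'' u - tri_act T U w + crs w u) + end3_bracket U' (beta2 w u))
     + (end3_bracket U'' (end3_bracket U U') + beta2 w (tri_act T U v - tri_act T' U' u + crs u v) + end3_bracket U'' (beta2 u v)) = 0"
  proof -
    have "beta2 u (tri_act T' U' w) = - beta2 (tri_act T' U' w) u" "beta2 v (tri_act T'' U'' u) = - beta2 (tri_act T'' U'' u) v"
      "beta2 w (tri_act T U v) = - beta2 (tri_act T U v) w"
      by (rule beta2_skew)+
    then show ?thesis
      using end3_bracket_jacobi [OF Tr(2,4,6)] beta_crs_cyclic(2) [of u v w]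
      by (simp add: end3_bracket_beta(2) [OF Tr(1,2)] end3_bracket_beta(2) [OF Tr(3,4)] end3_bracket_beta(2) [OF Tr(5,6)]
          beta_simps algebra_simps)
  qed
  have 3: "tri_act T U (tri_act T' U' w - tri_act T'' U'' v + crs v w)
       - tri_act (end3_bracket T' T'' + beta1 v w) (end3_bracket U' U'' + beta2 v w) u
       + crs u (tri_act T' U' w - tri_act T'' U'' v + crs v w)
     + (tri_act T' U' (tri_act T'' U'' u - tri_act T U w + crs w u)
       - tri_act (end3_bracket T'' T + beta1 w u) (end3_bracket U'' U + beta2 w u) v
       + crs v (tri_act T'' U'' u - tri_act T U w + crs w u))
     + (tri_act T'' U'' (tri_act T U v - tri_act T' U' u + crs u v)
       - tri_act (end3_bracket T T' + beta1 u v) (end3_bracket U U' + beta2 u v) w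
       + crs w (tri_act T U v - tri_act T' U' u + crs u v)) = 0"
  proof -
    have "crs u (tri_act T' U' w) = - crs (tri_act T' U' w) u" "crs v (tri_act T'' U'' u) = - crs (tri_act T'' U'' u) v"
      "crs w (tri_act T U v) = - crs (tri_act T U v) w"
      by (rule crs_skew)+
    then show ?thesis
      using tri_act_beta_cyclic [of v w u]
      by (simp add: b tri_act_add tri_act_bracket tri_act_crs tri_act_lin crs_simps algebra_simps)
  qed
  show "triality_bracket x (triality_bracket y z) + triality_bracket y (triality_bracket z x) + triality_bracket z (triality_bracket x y) = 0"
    using 1 2 3
    by (simp add: x(1) y(1) z(1) triality_bracket_eq end3_bracket_lin Tr zero_triple add_ac del: triality_bracket.simps)
qed

section \<open>Hermitian matrices in coordinates\<close>

declare cj_simps(5) [simp]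

lift_definition hdiag :: "'a::composition_algebra herm3 \<Rightarrow> 3 \<Rightarrow> real" is "\<lambda>A i. rp (A $ i $ i)" .

lift_definition hoff :: "'a::composition_algebra herm3 \<Rightarrow> 3 \<Rightarrow> 'a" is "\<lambda>A i. A $ (i + 1) $ (i + 2)" .

text \<open>The entry \<open>x i\<close> sits in row \<open>i + 1\<close> and column \<open>i + 2\<close>; with this choice the product of the
  off-diagonal parts with indices \<open>i\<close> and \<open>i + 1\<close> is the bracket of \<open>F i\<close> and \<open>F (i + 1)\<close> in one factor.\<close>

lift_definition hm :: "(3 \<Rightarrow> real) \<Rightarrow> (3 \<Rightarrow> 'a::composition_algebra) \<Rightarrow> 'a herm3"
  is "\<lambda>a x. \<chi> i j. if j = i then a i *\<^sub>R 1 else if j = i + 1 then x (i + 2) else cj (x (i + 1))"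
proof -
  fix a :: "3 \<Rightarrow> real" and x :: "3 \<Rightarrow> 'a"
  let ?M = "(\<chi> i j. if j = i then a i *\<^sub>R 1 else if j = i + 1 then x (i + 2) else cj (x (i + 1))) :: 'a^3^3"
  have "dagger ?M $ i $ j = ?M $ i $ j" for i j
    by (cases rule: three_cases [of j i]) (simp_all add: dagger_def cj_simps)
  then show "dagger ?M = ?M"
    by (simp add: vec_eq_iff)
qed

lemma hdiag_hm [simp]: "hdiag (hm a x) i = a i"
  by transfer (simp add: rp_def ip_simps)

lemma hoff_hm [simp]: "hoff (hm a x) i = x i"
  by transfer simp

lemma hm_hdiag_hoff: "hm (hdiag A) (hoff A) = A"
proof transfer
  fix A :: "'a^3^3"
  assume d: "dagger A = A"
  have d: "cj (A $ j $ i) = A $ i $ j" for i j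
    using d by (simp add: dagger_def vec_eq_iff)
  have r: "rp (A $ i $ i) *\<^sub>R 1 = A $ i $ i" for i
  proof -
    have "2 *\<^sub>R (rp (A $ i $ i) *\<^sub>R 1) = 2 *\<^sub>R A $ i $ i"
      using d [of i i] by (simp add: cj_alt rp_def scaleR_2 algebra_simps)
    then show ?thesis by (simp only: scaleR_cancel_left) simp
  qed
  have "(\<chi> i j. if j = i then rp (A $ i $ i) *\<^sub>R 1 else if j = i + 1 then A $ (i + 2 + 1) $ (i + 2 + 2)
      else cj (A $ (i + 1 + 1) $ (i + 1 + 2))) $ i $ j = A $ i $ j" for i j
    by (cases rule: three_cases [of j i]) (simp_all add: r d)
  then show "(\<chi> i j. if j = i then rp (A $ i $ i) *\<^sub>R 1 else if j = i + 1 then A $ (i + 2 + 1) $ (i + 2 + 2)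
      else cj (A $ (i + 1 + 1) $ (i + 1 + 2))) = A"
    by (simp add: vec_eq_iff)
qed

lemma herm_eqI:
  assumes "\<And>i. hdiag A i = hdiag B i" "\<And>i. hoff A i = hoff B i"
  shows "A = B"
  by (metis assms ext hm_hdiag_hoff)

lemma hcoord_lin [simp]:
  "hdiag (A + B) i = hdiag A i + hdiag B i" "hoff (A + B) i = hoff A i + hoff B i"
  "hdiag (A - B) i = hdiag A i - hdiag B i" "hoff (A - B) i = hoff A i - hoff B i"
  "hdiag (r *\<^sub>R A) i = r * hdiag A i" "hoff (r *\<^sub>R A) i = r *\<^sub>R hoff A i"
  "hdiag (- A) i = - hdiag A i" "hoff (- A) i = - hoff A i"
  "hdiag 0 i = 0" "hoff 0 i = 0"
  by (transfer; simp add: rp_def ip_simps ip_neg)+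

lemma hcoord_jordan:
  "hdiag (jordan A B) i = 2 * (hdiag A i * hdiag B i) + 2 * ip (hoff A (i + 1)) (hoff B (i + 1)) +
     2 * ip (hoff A (i + 2)) (hoff B (i + 2))" (is ?d)
  "hoff (jordan A B) i = (hdiag A (i + 1) + hdiag A (i + 2)) *\<^sub>R hoff B i +
     (hdiag B (i + 1) + hdiag B (i + 2)) *\<^sub>R hoff A i +
     cj (hoff B (i + 2)) * cj (hoff A (i + 1)) + cj (hoff A (i + 2)) * cj (hoff B (i + 1))" (is ?o)
proof -
  obtain a x b y where A: "A = hm a x" and B: "B = hm b y"
    by (metis hm_hdiag_hoff)
  have r: "ip (x * cj y) 1 = ip x y" "ip (cj x * y) 1 = ip x y" for x y :: 'a
    using ip_mult_left [of x "cj y" 1] ip_mult_right [of "cj x" y 1] 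
    by (simp_all add: mult_one_l mult_one_r ip_commute)
  note rep = hdiag.rep_eq hoff.rep_eq jordan.rep_eq hm.rep_eq mat_mult_def sum_three [of _ i]
  show ?d
    by (simp add: A B rep) (simp add: rp_def K_simps r ip_commute [of "y _" "x _"])
  show ?o
    by (simp add: A B rep) (simp add: rp_def K_simps algebra_simps)
qed

section \<open>The Peirce basis and its multiplication table\<close>

definition he :: "3 \<Rightarrow> 'a::composition_algebra herm3" where
  "he i = hm (\<lambda>j. if j = i then 1 else 0) (\<lambda>_. 0)"

definition hP :: "3 \<Rightarrow> 'a::composition_algebra \<Rightarrow> 'a herm3" where
  "hP i x = hm (\<lambda>_. 0) (\<lambda>j. if j = i then x else 0)"

lemma hcoord_basis [simp]:
  "hdiag (he i) j = (if j = i then 1 else 0)" "hoff (he i) j = 0"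
  "hdiag (hP i x) j = 0" "hoff (hP i x) j = (if j = i then x else 0)"
  by (simp_all add: he_def hP_def)

lemma linear_hP: "linear (hP i)"
  by (rule linearI) (auto intro: herm_eqI)

lemmas hP_simps = linear_add [OF linear_hP] linear_diff [OF linear_hP] linear_scale [OF linear_hP]
  linear_neg [OF linear_hP] linear_0 [OF linear_hP]

lemma herm_eqI_cyclic:
  assumes "hdiag A i = hdiag B i" "hdiag A (i + 1) = hdiag B (i + 1)" "hdiag A (i + 2) = hdiag B (i + 2)"
    "hoff A i = hoff B i" "hoff A (i + 1) = hoff B (i + 1)" "hoff A (i + 2) = hoff B (i + 2)"
  shows "A = B"
proof (rule herm_eqI)
  show "hdiag A j = hdiag B j" "hoff A j = hoff B j" for j
    by (cases rule: three_cases [of j i]; simp only: assms)+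
qed

lemma jordan_commute: "jordan A B = jordan B A"
  by transfer (rule add.commute)

lemma jordan_he_he: "jordan (he i) (he j) = (if i = j then 2 *\<^sub>R he i else 0)"
  by (rule herm_eqI) (auto simp: hcoord_jordan)

lemma jordan_he_hP:
  "jordan (he i) (hP i x) = 0"
  "jordan (he (i + 1)) (hP i x) = hP i x"
  "jordan (he (i + 2)) (hP i x) = hP i x"
  "jordan (he i) (hP (i + 1) x) = hP (i + 1) x"
  "jordan (he i) (hP (i + 2) x) = hP (i + 2) x"
  "jordan (he (i + 1)) (hP (i + 2) x) = hP (i + 2) x"
  "jordan (he (i + 2)) (hP (i + 1) x) = hP (i + 1) x"
  by (rule herm_eqI_cyclic [of _ i]; simp add: hcoord_jordan)+

lemma jordan_hP_he:
  "jordan (hP i x) (he i) = 0"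
  "jordan (hP i x) (he (i + 1)) = hP i x"
  "jordan (hP i x) (he (i + 2)) = hP i x"
  "jordan (hP (i + 1) x) (he i) = hP (i + 1) x"
  "jordan (hP (i + 2) x) (he i) = hP (i + 2) x"
  "jordan (hP (i + 2) x) (he (i + 1)) = hP (i + 2) x"
  "jordan (hP (i + 1) x) (he (i + 2)) = hP (i + 1) x"
  unfolding jordan_commute [of "hP _ _" "he _"] by (rule jordan_he_hP)+

lemma jordan_hP_hP:
  "jordan (hP i x) (hP i y) = (2 * ip x y) *\<^sub>R (he (i + 1) + he (i + 2))"
  "jordan (hP i x) (hP (i + 1) y) = hP (i + 2) (cj y * cj x)"
  "jordan (hP i x) (hP (i + 2) y) = hP (i + 1) (cj x * cj y)"
  "jordan (hP (i + 1) x) (hP i y) = hP (i + 2) (cj x * cj y)"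
  "jordan (hP (i + 2) x) (hP i y) = hP (i + 1) (cj y * cj x)"
  "jordan (hP (i + 1) x) (hP (i + 1) y) = (2 * ip x y) *\<^sub>R (he i + he (i + 2))"
  "jordan (hP (i + 2) x) (hP (i + 2) y) = (2 * ip x y) *\<^sub>R (he i + he (i + 1))"
  "jordan (hP (i + 1) x) (hP (i + 2) y) = hP i (cj y * cj x)"
  "jordan (hP (i + 2) x) (hP (i + 1) y) = hP i (cj x * cj y)"
  by (rule herm_eqI_cyclic [of _ i]; simp add: hcoord_jordan cj_simps)+

lemmas jordan_table = jordan_he_he jordan_he_hP jordan_hP_he jordan_hP_hP

lemmas jordan_lin = jordan_simps bilinear_lsub [OF bilinear_jordan] bilinear_rsub [OF bilinear_jordan]
  bilinear_lneg [OF bilinear_jordan] bilinear_rneg [OF bilinear_jordan]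
lemmas jordan_zero [simp] = bilinear_lzero [OF bilinear_jordan] bilinear_rzero [OF bilinear_jordan]

lemma herm_basis: "A = (\<Sum>i\<in>UNIV. hdiag A i *\<^sub>R he i) + (\<Sum>i\<in>UNIV. hP i (hoff A i))"
  by (rule herm_eqI_cyclic [of _ 1]) (simp_all add: sum_three [of _ 1])

lemma herm_linear_eqI:
  assumes f: "linear f" and g: "linear g"
    and "\<And>j. f (he j) = g (he j)" "\<And>j x. f (hP j x) = g (hP j x)"
  shows "f = g"
proof
  fix A
  show "f A = g A"
    by (subst (1 2) herm_basis [of A])
      (simp add: linear_add [OF f] linear_add [OF g] linear_sum [OF f] linear_sum [OF g]
        linear_scale [OF f] linear_scale [OF g] assms)
qed

lemma herm_linear_eqI_cyclic:
  assumes "linear f" "linear g"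
    and "f (he i) = g (he i)" "f (he (i + 1)) = g (he (i + 1))" "f (he (i + 2)) = g (he (i + 2))"
    and "\<And>x. f (hP i x) = g (hP i x)" "\<And>x. f (hP (i + 1) x) = g (hP (i + 1) x)"
      "\<And>x. f (hP (i + 2) x) = g (hP (i + 2) x)"
  shows "f = g"
proof (rule herm_linear_eqI [OF assms(1,2)])
  show "f (he j) = g (he j)" for j
    by (cases rule: three_cases [of j i]) (simp_all only: assms)
  show "f (hP j x) = g (hP j x)" for j x
    by (cases rule: three_cases [of j i]) (simp_all only: assms)
qed

lemma linear_jordan: "linear (jordan A)"
  using bilinear_jordan unfolding bilinear_def by blast

lemma linear_commutator: "\<lbrakk>linear f; linear g\<rbrakk> \<Longrightarrow> linear (commutator f g)"
  unfolding commutator_def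
  by (rule linearI) (simp_all add: linear_add linear_scale algebra_simps)

section \<open>Two families of derivations of the Jordan algebra\<close>

definition hD :: "3 \<Rightarrow> 'a::composition_algebra \<Rightarrow> 'a herm3 \<Rightarrow> 'a herm3" where
  "hD i z = commutator (jordan (he (i + 1))) (jordan (hP i z))"

lemma linear_hD: "linear (hD i z)"
  unfolding hD_def by (intro linear_commutator linear_jordan)

lemmas hD_lin = linear_add [OF linear_hD] linear_diff [OF linear_hD] linear_scale [OF linear_hD]
  linear_neg [OF linear_hD]
lemmas hD_zero [simp] = linear_0 [OF linear_hD]

text \<open>On the span of \<open>he (i + 1)\<close>, \<open>he (i + 2)\<close> and the
  \<open>hP i y\<close> this is an infinitesimal rotation, and it interchanges the other two
  off-diagonal spaces. These maps supply the part of a derivation that moves the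
  idempotents.\<close>

lemma hD_basis:
  "hD i z (he i) = 0" "hD i z (he (i + 1)) = - hP i z" "hD i z (he (i + 2)) = hP i z"
  "hD i z (hP i y) = (2 * ip z y) *\<^sub>R (he (i + 1) - he (i + 2))"
  "hD i z (hP (i + 1) y) = hP (i + 2) (cj y * cj z)"
  "hD i z (hP (i + 2) y) = - hP (i + 1) (cj z * cj y)"
  by (simp_all add: hD_def commutator_def jordan_table jordan_lin, simp_all add: algebra_simps scaleR_2)
    (simp_all add: scaleR_left_distrib [symmetric])

lemma hD_basis_shift:
  "hD (i + 1) z (he i) = hP (i + 1) z" "hD (i + 1) z (he (i + 1)) = 0" "hD (i + 1) z (he (i + 2)) = - hP (i + 1) z"
  "hD (i + 1) z (hP i y) = - hP (i + 2) (cj z * cj y)"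
  "hD (i + 1) z (hP (i + 1) y) = (2 * ip z y) *\<^sub>R (he (i + 2) - he i)"
  "hD (i + 1) z (hP (i + 2) y) = hP i (cj y * cj z)"
  "hD (i + 2) z (he i) = - hP (i + 2) z" "hD (i + 2) z (he (i + 1)) = hP (i + 2) z" "hD (i + 2) z (he (i + 2)) = 0"
  "hD (i + 2) z (hP i y) = hP (i + 1) (cj y * cj z)"
  "hD (i + 2) z (hP (i + 1) y) = - hP i (cj z * cj y)"
  "hD (i + 2) z (hP (i + 2) y) = (2 * ip z y) *\<^sub>R (he i - he (i + 1))"
  using hD_basis [of "i + 1" z] hD_basis [of "i + 2" z] by simp_all

lemma derivation_jordanI:
  assumes D: "linear D"
    and ee: "\<And>j k. D (jordan (he j) (he k)) = jordan (D (he j)) (he k) + jordan (he j) (D (he k))"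
    and eP: "\<And>j k x. D (jordan (he j) (hP k x)) = jordan (D (he j)) (hP k x) + jordan (he j) (D (hP k x))"
    and PP: "\<And>j k x y. D (jordan (hP j x) (hP k y)) = jordan (D (hP j x)) (hP k y) + jordan (hP j x) (D (hP k y))"
  shows "D \<in> derivations jordan"
proof -
  have Pe: "D (jordan (hP k x) (he j)) = jordan (D (hP k x)) (he j) + jordan (hP k x) (D (he j))" for j k x
    using eP [of j k x] by (simp add: jordan_commute add.commute)
  note lin = linear_add [OF D] linear_scale [OF D]
  have l: "linear (\<lambda>B. D (jordan A B))" "linear (\<lambda>B. jordan (D A) B + jordan A (D B))"
    "linear (\<lambda>B. D (jordan B A))" "linear (\<lambda>B. jordan (D B) A + jordan B (D A))" for A
    by (rule linearI; simp add: lin jordan_lin algebra_simps)+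
  have "(\<lambda>B. D (jordan (he j) B)) = (\<lambda>B. jordan (D (he j)) B + jordan (he j) (D B))" for j
    by (rule herm_linear_eqI [OF l(1,2)]) (simp_all only: ee eP)
  moreover have "(\<lambda>B. D (jordan (hP j x) B)) = (\<lambda>B. jordan (D (hP j x)) B + jordan (hP j x) (D B))" for j x
    by (rule herm_linear_eqI [OF l(1,2)]) (simp_all only: Pe PP)
  ultimately have "(\<lambda>A. D (jordan A B)) = (\<lambda>A. jordan (D A) B + jordan A (D B))" for B
    by (intro herm_linear_eqI [OF l(3,4)]) (simp_all add: fun_eq_iff)
  then show ?thesis
    using D by (simp add: derivations_def fun_eq_iff)
qed

text \<open>Verified on pairs of Peirce components: what enters is the sandwich identities, and
  cyclicity of the trilinear form where two components multiply into the diagonal.\<close>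

lemma hD_derivation: "hD i z \<in> derivations jordan"
proof (rule derivation_jordanI [OF linear_hD])
  note tab = jordan_table jordan_lin hD_basis hD_lin
  show "hD i z (jordan (he j) (he k)) = jordan (hD i z (he j)) (he k) + jordan (he j) (hD i z (he k))" for j k
    by (cases rule: three_cases [of j i]; cases rule: three_cases [of k i]) (simp_all add: tab scaleR_2)
  show "hD i z (jordan (he j) (hP k x)) = jordan (hD i z (he j)) (hP k x) + jordan (he j) (hD i z (hP k x))" for j k x
    by (cases rule: three_cases [of j i]; cases rule: three_cases [of k i])
      (simp_all add: tab scaleR_2 scaleR_diff_right scaleR_add_right)
  show "hD i z (jordan (hP j x) (hP k y)) = jordan (hD i z (hP j x)) (hP k y) + jordan (hP j x) (hD i z (hP k y))" for j k x y
  proof -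
    \<comment> \<open>The sandwich identities, oriented as rewrite rules that trade one nested
      product for its partner and a scalar multiple.\<close>
    have a: "hP m (cj z * (x * y)) = (2 * ip z x) *\<^sub>R hP m y - hP m (cj x * (z * y))" for m x y
      using arg_cong [OF cj_sandwich_left [of z x y], of "hP m"] by (simp add: hP_simps algebra_simps)
    have b: "hP m ((y * x) * cj z) = (2 * ip z x) *\<^sub>R hP m y - hP m ((y * z) * cj x)" for m x y
      using arg_cong [OF cj_sandwich_right [of y z x], of "hP m"] by (simp add: hP_simps algebra_simps)
    have c: "hP i (z * y * cj x) = (2 * ip x y) *\<^sub>R hP i z - hP i (z * x * cj y)"
      using arg_cong [OF cj_sandwich_right [of z x y], of "hP i"] by (simp add: hP_simps algebra_simps)
    have d: "hP i (cj x * (y * z)) = (2 * ip x y) *\<^sub>R hP i z - hP i (cj y * (x * z))"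
      using arg_cong [OF cj_sandwich_left [of x y z], of "hP i"] by (simp add: hP_simps algebra_simps)
    have t: "ip z (cj y * cj x) = ip (cj x * cj z) y" "ip y (cj z * cj x) = ip z (cj x * cj y)"
       "ip x (cj z * cj y) = ip z (cj y * cj x)" "ip x (cj y * cj z) = ip (cj z * cj x) y" "ip (cj y * cj z) x = ip (cj z * cj x) y" for x y :: 'a
      using ip_cyclic [of x z y] ip_cyclic [of y x z] ip_cyclic [of z y x] ip_cyclic [of x y z] ip_cyclic [of y z x] by (simp_all add: ip_commute)
    show ?thesis
      by (cases rule: three_cases [of j i]; cases rule: three_cases [of k i])
        (simp_all add: tab cj_simps cj_mult a b c d t scaleR_2 scaleR_diff_right scaleR_add_right)
  qed
qed

definition hT :: "'a::composition_algebra end3 \<Rightarrow> 'a herm3 \<Rightarrow> 'a herm3" where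
  "hT T A = hm (\<lambda>_. 0) (\<lambda>i. tri_comp T i (hoff A i))"

lemma hcoord_hT [simp]: "hdiag (hT T A) i = 0" "hoff (hT T A) i = tri_comp T i (hoff A i)"
  by (simp_all add: hT_def)

lemma linear_hT: "T \<in> Tri \<Longrightarrow> linear (hT T)"
  by (rule linearI; rule herm_eqI) (simp_all add: linear_add [OF linear_tri_comp] linear_scale [OF linear_tri_comp])

lemma hT_basis:
  assumes "T \<in> Tri"
  shows "hT T (he j) = 0" "hT T (hP j x) = hP j (tri_comp T j x)"
  by (rule herm_eqI; simp add: linear_0 [OF linear_tri_comp [OF assms]])+

text \<open>Products of \<open>hP i\<close> with \<open>hP (i + 1)\<close> require exactly the
  triality identity, products of \<open>hP i\<close> with itself exactly skewness, and products with
  idempotents only that each Peirce space is preserved.\<close>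

lemma hT_derivation:
  assumes T: "T \<in> Tri"
  shows "hT T \<in> derivations jordan"
proof (rule derivation_jordanI [OF linear_hT [OF T]])
  note lin = linear_add [OF linear_hT [OF T]] linear_scale [OF linear_hT [OF T]] linear_0 [OF linear_hT [OF T]]
  note tab = jordan_table jordan_lin hT_basis [OF T] lin
  show "hT T (jordan (he j) (he k)) = jordan (hT T (he j)) (he k) + jordan (he j) (hT T (he k))" for j k
    by (simp add: tab)
  show "hT T (jordan (he j) (hP k x)) = jordan (hT T (he j)) (hP k x) + jordan (he j) (hT T (hP k x))" for j k x
    by (cases rule: three_cases [of j k]) (simp_all add: tab)
  show "hT T (jordan (hP j x) (hP k y)) = jordan (hT T (hP j x)) (hP k y) + jordan (hP j x) (hT T (hP k y))" for j k x y
    using so_skew [OF Tri_so [OF T]]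
    by (cases rule: three_cases [of k j]) (simp_all add: tab hP_simps [symmetric] Tri_mult [OF T] Tri_mult' [OF T] add.commute [where 'a='a])
qed

lemma herm_tr_eq: "rp (herm_tr A) = (\<Sum>i\<in>UNIV. hdiag A i)"
  by transfer (simp add: linear_sum [OF linear_rp])

lemma herm_traceless_iff: "A \<in> herm_traceless \<longleftrightarrow> (\<Sum>i\<in>UNIV. hdiag A i) = 0"
proof -
  have "herm_tr A = 0 \<longleftrightarrow> rp (herm_tr A) = 0"
    by (metis herm_tr_real linear_0 [OF linear_rp] scaleR_zero_left)
  then show ?thesis by (simp add: herm_traceless_def herm_tr_eq)
qed

lemma herm_one_eq: "herm_one = he i + he (i + 1) + he (i + 2)"
proof -
  have *: "hdiag (herm_one :: 'a herm3) j = 1" "hoff (herm_one :: 'a herm3) j = 0" for j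
    by (simp_all add: hdiag.rep_eq hoff.rep_eq herm_one.rep_eq mat_def rp_def)
  show "(herm_one :: 'a herm3) = he i + he (i + 1) + he (i + 2)"
    by (rule herm_eqI_cyclic [of _ i]) (simp_all add: *)
qed

lemma herm_ip_eq: "herm_ip A B = (\<Sum>i\<in>UNIV. 2 * (hdiag A i * hdiag B i) + 4 * ip (hoff A i) (hoff B i))"
proof -
  fix i :: 3
  show ?thesis
    by (simp add: herm_ip_def herm_tr_eq hcoord_jordan sum_three [of _ i])
qed

lemma subspace_derivations:
  assumes "bilinear m"
  shows "subspace (derivations m)"
  unfolding subspace_def derivations_def
  by (auto simp: zero_fun_def bilinear_lzero [OF assms] bilinear_rzero [OF assms] bilinear_ladd [OF assms] bilinear_radd [OF assms]
      bilinear_lmul [OF assms] bilinear_rmul [OF assms] linear_zero linear_add linear_scale algebra_simps intro!: linearI)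

section \<open>Derivations of the Jordan algebra\<close>

lemma derivations_commutator_jordan:
  assumes "D \<in> derivations jordan"
  shows "commutator D (commutator (jordan A) (jordan B)) =
    commutator (jordan (D A)) (jordan B) + commutator (jordan A) (jordan (D B))"
  using assms unfolding derivations_def
  by (auto simp: commutator_def fun_eq_iff linear_diff jordan_lin algebra_simps)

lemma commutator_jordan_he_he: "commutator (jordan (he j)) (jordan (he k)) = 0"
proof -
  fix i :: 3
  have z: "linear (0 :: 'a herm3 \<Rightarrow> 'a herm3)"
    by (simp add: zero_fun_def linear_zero)
  show "commutator (jordan (he j)) (jordan (he k)) = (0 :: 'a herm3 \<Rightarrow> 'a herm3)"
  proof (rule herm_linear_eqI_cyclic [of _ _ j])
    show "linear (commutator (jordan (he j)) (jordan (he k) :: 'a herm3 \<Rightarrow> _))"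
      by (intro linear_commutator linear_jordan)
  qed (cases rule: three_cases [of k j]; simp add: z commutator_def jordan_table jordan_lin)+
qed

lemma commutator_jordan_he_hP:
  "commutator (jordan (he i)) (jordan (hP i x)) = 0"
  "commutator (jordan (he (i + 1))) (jordan (hP i x)) = hD i x"
  "commutator (jordan (he (i + 2))) (jordan (hP i x)) = - hD i x"
proof -
  have z: "linear (0 :: 'a herm3 \<Rightarrow> 'a herm3)" "linear (- hD i x)"
    by (simp_all add: zero_fun_def linear_zero fun_Compl_def linear_compose_neg linear_hD)
  note lin = linear_commutator linear_jordan z
  show "commutator (jordan (he i)) (jordan (hP i x)) = 0"
    by (rule herm_linear_eqI_cyclic [of _ _ i]) (simp_all add: lin, simp_all add: commutator_def jordan_table jordan_lin)
  show "commutator (jordan (he (i + 1))) (jordan (hP i x)) = hD i x"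
    by (simp add: hD_def)
  show "commutator (jordan (he (i + 2))) (jordan (hP i x)) = - hD i x"
    by (rule herm_linear_eqI_cyclic [of _ _ i])
      (simp_all add: lin, simp_all add: commutator_def jordan_table jordan_lin hD_basis, simp_all add: algebra_simps scaleR_2,
        simp add: scaleR_left_distrib [symmetric])
qed

lemma hT_lin:
  "hT (T + U) = hT T + hT U" "hT (r *\<^sub>R T) = r *\<^sub>R hT T"
  by (rule ext, rule herm_eqI; simp add: tri_comp_add tri_comp_scaleR)+

lemma linear_hD_arg: "linear (hD i)"
  by (rule linearI; rule ext) (simp_all add: hD_def commutator_def hP_simps jordan_lin scaleR_diff_right)

lemmas hD_arg_lin = linear_add [OF linear_hD_arg] linear_scale [OF linear_hD_arg] linear_neg [OF linear_hD_arg]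
  linear_diff [OF linear_hD_arg] linear_0 [OF linear_hD_arg]

lemma commutator_hT_hT: "commutator (hT T) (hT U) = hT (end3_bracket T U)"
  by (rule ext, rule herm_eqI) (simp_all add: commutator_def tri_comp_bracket)

lemma commutator_hT_hD:
  assumes "T \<in> Tri"
  shows "commutator (hT T) (hD i z) = hD i (tri_comp T i z)"
  unfolding hD_def derivations_commutator_jordan [OF hT_derivation [OF assms]]
  by (simp add: hT_basis [OF assms] commutator_def fun_eq_iff)

text \<open>Explains the formula for \<open>T_elem\<close>: up to the shift of index it is the
  commutator of two infinitesimal rotations. The 4 in its first component is the 2 in front of the
  inner product times the 2 from the two idempotents that move.\<close>

lemma commutator_hD_hD_same: "commutator (hD i x) (hD i y) = hT (tau i x y)"
  by (rule herm_linear_eqI_cyclic [of _ _ i])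
    (simp_all add: linear_commutator linear_hD linear_hT tau_Tri,
     simp_all add: commutator_def hD_basis hD_lin hT_basis tau_Tri tri_comp_tau cj_mult,
     simp_all add: hP_simps algebra_simps ip_commute,
     simp add: add.assoc [symmetric] scaleR_left_distrib [symmetric], simp add: ac_simps)

lemma commutator_hD_hD_next: "commutator (hD i x) (hD (i + 1) y) = - hD (i + 2) (cj y * cj x)"
proof -
  have z: "linear (- hD (i + 2) (cj y * cj x))"
    by (simp add: fun_Compl_def linear_compose_neg linear_hD)
  have a: "hP m (cj x * (w * y)) = (2 * ip x w) *\<^sub>R hP m y - hP m (cj w * (x * y))" for m w
    using arg_cong [OF cj_sandwich_left [of x w y], of "hP m"] by (simp add: hP_simps algebra_simps)
  have b: "hP m (x * w * cj y) = (2 * ip w y) *\<^sub>R hP m x - hP m (x * y * cj w)" for m w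
    using arg_cong [OF cj_sandwich_right [of x w y], of "hP m"] by (simp add: hP_simps algebra_simps)
  have t: "ip x (cj w * cj y) = ip (cj y * cj x) w" "ip y (cj x * cj w) = ip (cj y * cj x) w" for w
    using ip_cyclic [of w y x] ip_cyclic [of y x w] ip_cyclic [of x w y] by (simp_all add: ip_commute)
  show ?thesis
    by (rule herm_linear_eqI_cyclic [of _ _ i])
      (simp_all add: linear_commutator linear_hD z,
       simp_all add: commutator_def hD_basis hD_basis_shift hD_lin cj_mult cj_simps,
       simp_all add: hP_simps a b t ip_commute algebra_simps)
qed

text \<open>Opposite in sign to \<open>commutator_hD_hD_same\<close>. Since Tits's bracket subtracts
  this commutator, the real and imaginary parts of the second tensor factor contribute with the same
  sign and add up to the full inner product.\<close>

lemma commutator_jordan_hP_hP_same: "commutator (jordan (hP i x)) (jordan (hP i y)) = - hT (tau i x y)"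
proof -
  have z: "linear (- hT (tau i x y))"
    by (simp add: fun_Compl_def linear_compose_neg linear_hT tau_Tri)
  show ?thesis
    by (rule herm_linear_eqI_cyclic [of _ _ i])
      (simp_all add: linear_commutator linear_jordan z,
       simp_all add: commutator_def jordan_table jordan_lin hT_basis tau_Tri tri_comp_tau cj_mult,
       simp_all add: hP_simps algebra_simps ip_commute,
     simp add: add.assoc [symmetric] scaleR_left_distrib [symmetric], simp add: ac_simps)
qed

lemma commutator_jordan_hP_hP_next:
  "commutator (jordan (hP i x)) (jordan (hP (i + 1) y)) = - hD (i + 2) (cj y * cj x)"
proof -
  have z: "linear (- hD (i + 2) (cj y * cj x))"
    by (simp add: fun_Compl_def linear_compose_neg linear_hD)
  have a: "hP m (cj x * (w * y)) = (2 * ip x w) *\<^sub>R hP m y - hP m (cj w * (x * y))" for m w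
    using arg_cong [OF cj_sandwich_left [of x w y], of "hP m"] by (simp add: hP_simps algebra_simps)
  have b: "hP m (x * w * cj y) = (2 * ip w y) *\<^sub>R hP m x - hP m (x * y * cj w)" for m w
    using arg_cong [OF cj_sandwich_right [of x w y], of "hP m"] by (simp add: hP_simps algebra_simps)
  have t: "ip x (cj w * cj y) = ip (cj y * cj x) w" "ip y (cj x * cj w) = ip (cj y * cj x) w" for w
    using ip_cyclic [of w y x] ip_cyclic [of y x w] ip_cyclic [of x w y] by (simp_all add: ip_commute)
  show ?thesis
    by (rule herm_linear_eqI_cyclic [of _ _ i])
      (simp_all add: linear_commutator linear_jordan z,
       simp_all add: commutator_def jordan_table jordan_lin hD_basis_shift cj_mult cj_simps,
       simp_all add: hP_simps a b t ip_commute algebra_simps)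
qed

text \<open>The off-diagonal spaces are cut out by multiplication with the idempotents, so a
  derivation annihilating these preserves each space. The induced maps are skew because of the
  products within one space, and satisfy the triality identity because of the products between
  neighbours.\<close>

lemma derivation_eq_hT:
  assumes D: "D \<in> derivations jordan" and e: "\<And>j. D (he j) = 0"
  shows "\<exists>T\<in>Tri. D = hT T"
proof -
  have lin: "linear D" and der: "D (jordan A B) = jordan (D A) B + jordan A (D B)" for A B
    using D by (auto simp: derivations_def)
  define t where "t = (\<lambda>i x. hoff (D (hP i x)) i)"
  have DP: "D (hP i x) = hP i (t i x)" for i x
  proof -
    have 0: "jordan (he i) (D (hP i x)) = 0"
      using der [of "he i" "hP i x"] by (simp add: e jordan_table linear_0 [OF lin])
    have 1: "jordan (he (i + 1)) (D (hP i x)) = D (hP i x)"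
      using der [of "he (i + 1)" "hP i x"] by (simp add: e jordan_table)
    have 2: "jordan (he (i + 2)) (D (hP i x)) = D (hP i x)"
      using der [of "he (i + 2)" "hP i x"] by (simp add: e jordan_table)
    show ?thesis
      using arg_cong [OF 0, of "\<lambda>A. hdiag A i"] arg_cong [OF 1, of "\<lambda>A. hdiag A (i + 1)"]
        arg_cong [OF 2, of "\<lambda>A. hdiag A (i + 2)"] arg_cong [OF 0, of "\<lambda>A. hoff A (i + 1)"]
        arg_cong [OF 0, of "\<lambda>A. hoff A (i + 2)"]
      by (intro herm_eqI_cyclic [of _ i]) (simp_all add: hcoord_jordan t_def)
  qed
  have t_lin: "linear (t i)" for i
    by (rule linearI) (simp_all add: t_def hP_simps linear_add [OF lin] linear_scale [OF lin])
  have t_so: "t i \<in> so" for i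
  proof -
    have "ip (t i x) y + ip x (t i y) = 0" for x y
      using arg_cong [OF der [of "hP i x" "hP i y"], of "\<lambda>A. hdiag A (i + 1)"]
      by (simp add: DP jordan_table linear_add [OF lin] linear_scale [OF lin] e)
    then show ?thesis
      using t_lin by (simp add: so_def eq_neg_iff_add_eq_0)
  qed
  have t_mult: "t (i + 2) (cj y * cj x) = cj y * cj (t i x) + cj (t (i + 1) y) * cj x" for i x y
    using arg_cong [OF der [of "hP i x" "hP (i + 1) y"], of "\<lambda>A. hoff A (i + 2)"]
    by (simp add: DP jordan_table)
  have T: "tri_of t \<in> Tri"
    unfolding Tri_iff by (simp add: t_so t_mult)
  have "D = hT (tri_of t)"
    by (rule herm_linear_eqI [OF lin linear_hT [OF T]]) (simp_all add: e DP hT_basis [OF T])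
  then show ?thesis using T by blast
qed

lemma derivation_jordan_decomp:
  assumes D: "D \<in> derivations jordan"
  shows "\<exists>T\<in>Tri. \<exists>z. D = hT T - (\<Sum>i\<in>UNIV. hD i (z i))"
proof -
  have lin: "linear D" and der: "D (jordan A B) = jordan (D A) B + jordan A (D B)" for A B
    using D by (auto simp: derivations_def)
  \<comment> \<open>Differentiating \<open>jordan (he j) (he j) = 2 *\<^sub>R he j\<close> confines
    \<open>D (he j)\<close> to the off-diagonal spaces other than the \<open>j\<close>-th.
    Orthogonality of distinct idempotents then makes the two contributions to each space opposite,
    as for a sum of \<open>hD\<close>'s.\<close>
  have 1: "hdiag (D (he j)) k = 0" for j k
    using arg_cong [OF der [of "he j" "he j"], of "\<lambda>A. hdiag A k"]
    by (cases rule: three_cases [of k j]) (simp_all add: jordan_table linear_scale [OF lin] hcoord_jordan)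
  have 2: "hoff (D (he j)) j = 0" for j
    using arg_cong [OF der [of "he j" "he j"], of "\<lambda>A. hoff A j"]
    by (simp add: jordan_table linear_scale [OF lin] hcoord_jordan)
  have 3: "hoff (D (he (i + 1))) i = - hoff (D (he (i + 2))) i" for i
    using arg_cong [OF der [of "he (i + 1)" "he (i + 2)"], of "\<lambda>A. hoff A i"]
    by (simp add: jordan_table linear_0 [OF lin] hcoord_jordan eq_neg_iff_add_eq_0 add.commute)
  define z where "z = (\<lambda>i. hoff (D (he (i + 2))) i)"
  have De: "D (he j) = hP (j + 1) (z (j + 1)) - hP (j + 2) (z (j + 2))" for j
    using 3 [of "j + 2"] by (intro herm_eqI_cyclic [of _ j]) (simp_all add: 1 2 z_def)
  have "(\<Sum>i\<in>UNIV. hD i (z i)) \<in> derivations jordan"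
    by (intro subspace_sum subspace_derivations bilinear_jordan hD_derivation)
  then have D': "D - (\<Sum>i\<in>UNIV. hD i (z i)) \<in> derivations jordan"
    by (intro subspace_diff subspace_derivations bilinear_jordan D)
  have "(D - (\<Sum>i\<in>UNIV. hD i (z i))) (he j) = 0" for j
    by (simp add: De sum_three [of _ j] hD_basis hD_basis_shift)
  from derivation_eq_hT [OF D' this] obtain T where T: "T \<in> Tri" "D - (\<Sum>i\<in>UNIV. hD i (z i)) = hT T"
    by blast
  \<comment> \<open>The sign is absorbed into \<open>z\<close> to obtain the shape of the first
    component of \<open>magic_iso\<close>.\<close>
  have "D = hT T - (\<Sum>i\<in>UNIV. hD i (- z i))"
    by (simp add: hD_arg_lin sum_negf T(2) [symmetric])
  then show ?thesis using T(1) by (intro bexI exI)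
qed

section \<open>Triality algebra and derivations of the composition algebra\<close>

lemma rp_im_mult:
  assumes "a \<in> im_space" "b \<in> im_space"
  shows "rp (a * b) = - ip a b" "im_part (a * b) = (1/2) *\<^sub>R (a * b - b * a)"
proof -
  show r: "rp (a * b) = - ip a b"
    using ip_mult_left [of a b 1] cj_im [OF assms(2)] by (simp add: rp_def mult_one_l ip_neg)
  have "2 *\<^sub>R im_part (a * b) = 2 *\<^sub>R ((1/2) *\<^sub>R (a * b - b * a))"
    using mult_im_anticommute [OF assms]
    by (simp add: im_part_def r scaleR_diff_right scaleR_2 [of "a * b"] algebra_simps eq_neg_iff_add_eq_0)
  then show "im_part (a * b) = (1/2) *\<^sub>R (a * b - b * a)"
    by (simp only: scaleR_cancel_left) simp
qed

lemma im_part_im [simp]: "x \<in> im_space \<Longrightarrow> im_part x = x"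
  by (simp add: im_part_def im_space_iff)

lemma im_space_closed:
  "0 \<in> im_space" "\<lbrakk>x \<in> im_space; y \<in> im_space\<rbrakk> \<Longrightarrow> x + y \<in> im_space" "\<lbrakk>x \<in> im_space; y \<in> im_space\<rbrakk> \<Longrightarrow> x - y \<in> im_space"
  "x \<in> im_space \<Longrightarrow> r *\<^sub>R x \<in> im_space" "x \<in> im_space \<Longrightarrow> - x \<in> im_space"
  by (simp_all add: im_space_def K_simps)

lemma rp_im_part [simp]: "rp (im_part x) = 0"
  using im_part_im_space [of x] by (simp add: im_space_iff)

lemma rp_one [simp]: "rp 1 = 1" and im_part_one [simp]: "im_part 1 = 0"
  by (simp_all add: rp_def im_part_def)

lemma ip_rp_im: "ip x y = rp x * rp y + ip (im_part x) (im_part y)"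
  by (simp add: im_part_def rp_def ip_simps ip_commute)

lemma derivation_one: "E \<in> derivations (*) \<Longrightarrow> E (1 :: 'a::composition_algebra) = 0"
  by (auto simp: derivations_def mult_one_l mult_one_r dest!: spec [of _ 1])

lemma derivation_mult: "E \<in> derivations (*) \<Longrightarrow> E (x * y) = E x * y + x * (E y :: 'a::composition_algebra)"
  by (simp add: derivations_def)

text \<open>The notion of derivation does not mention the norm; the norm enters through
  \<open>x * x = - nsq x *\<^sub>R 1\<close>. Differentiating this equates a multiple of
  \<open>x\<close> with a multiple of \<open>1\<close>, and for nonzero imaginary \<open>x\<close>
  both must vanish.\<close>

lemma derivation_im:
  assumes E: "E \<in> derivations (*)" and x: "x \<in> im_space"
  shows "E x \<in> im_space \<and> ip (E x) (x :: 'a::composition_algebra) = 0"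
proof (cases "x = 0")
  case True
  then show ?thesis
    using linear_0 [OF linear_derivation [OF E]] by (simp add: im_space_closed)
next
  case False
  note lin = linear_derivation [OF E]
  have "2 *\<^sub>R (x * x) = 2 *\<^sub>R (- nsq x *\<^sub>R 1)"
    using mult_im_anticommute [OF x x] by (simp add: ip_self scaleR_2 [of "x * x"])
  then have "x * x = - nsq x *\<^sub>R 1"
    by (simp only: scaleR_cancel_left) simp
  then have "E x * x + x * E x = 0"
    using derivation_mult [OF E, of x x] by (simp add: linear_scale [OF lin] linear_neg [OF lin] derivation_one [OF E])
  moreover have "E x * x + x * E x = (2 * rp (E x)) *\<^sub>R x + (im_part (E x) * x + x * im_part (E x))"
    by (subst (1 2) rp_im_decomp [of "E x", symmetric])
      (simp only: ca_mult_simps mult_one_l mult_one_r mult_2 scaleR_add_left add_ac)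
  ultimately have *: "(2 * rp (E x)) *\<^sub>R x + (im_part (E x) * x + x * im_part (E x)) = 0"
    by simp
  have i: "im_part (E x) * x + x * im_part (E x) = (- 2 * ip (im_part (E x)) x) *\<^sub>R 1"
    by (rule mult_im_anticommute [OF im_part_im_space x])
  have s: "(2 * rp (E x)) *\<^sub>R x = (2 * ip (im_part (E x)) x) *\<^sub>R 1"
    using * unfolding i by (simp add: algebra_simps)
  have "2 * ip (im_part (E x)) x = 0"
    using arg_cong [OF s, of rp] x by (simp add: linear_scale [OF linear_rp] im_space_iff)
  moreover from this s False have "rp (E x) = 0"
    by simp
  ultimately show ?thesis
    by (simp add: im_space_iff im_part_def)
qed

lemma derivation_so:
  assumes E: "E \<in> derivations (*)"
  shows "E \<in> (so :: ('a::composition_algebra \<Rightarrow> 'a) set)"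
proof -
  note lin = linear_derivation [OF E]
  have 0: "ip (E x) x = 0" for x
  proof -
    have "E x = E (im_part x)"
      by (simp add: im_part_def linear_diff [OF lin] linear_scale [OF lin] derivation_one [OF E])
    then show ?thesis
      using derivation_im [OF E im_part_im_space [of x]]
      by (subst (2) rp_im_decomp [of x, symmetric]) (simp add: ip_simps im_space_def)
  qed
  have "ip (E x) y + ip x (E y) = 0" for x y
    using 0 [of "x + y"] 0 [of x] 0 [of y] by (simp add: linear_add [OF lin] ip_simps ip_commute)
  then show ?thesis
    using lin by (simp add: so_def eq_neg_iff_add_eq_0)
qed

lemma derivation_in_im: "E \<in> derivations (*) \<Longrightarrow> E x \<in> im_space"
  using so_skew [OF derivation_so, of E x 1] by (simp add: im_space_def derivation_one)

lemma derivation_cj: "E \<in> derivations (*) \<Longrightarrow> E (cj x) = cj (E x)"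
  using cj_im [OF derivation_in_im, of E x]
  by (simp add: cj_alt [of x] linear_diff [OF linear_derivation] linear_scale [OF linear_derivation] derivation_one)

section \<open>Trialities as derivations together with imaginary triples\<close>

lemma linear_lmul: "linear (lmul x)" and linear_rmul: "linear (rmul x)"
  by (rule linearI; simp add: lmul_def rmul_def ca_mult_simps)+

lemma lmul_so: "a \<in> im_space \<Longrightarrow> lmul a \<in> so" and rmul_so: "a \<in> im_space \<Longrightarrow> rmul a \<in> so"
  using linear_lmul linear_rmul
  by (auto simp: so_def lmul_def rmul_def ip_mult_left [of _ a] ip_mult_right [of a] cj_im K_simps)

lemma so_diff: "\<lbrakk>A \<in> so; B \<in> so\<rbrakk> \<Longrightarrow> A - B \<in> so"
  using so_closed(2) [of A "(- 1) *\<^sub>R B"] so_closed(3) [of B "- 1"] by (simp add: fun_diff_def plus_fun_def scaleR_fun_def)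

text \<open>Every triality has this shape with \<open>E\<close> a derivation and \<open>u\<close> imaginary of sum zero; the indices make the
  triality identity an instance of the skew symmetry of the associator.\<close>

definition tri_H :: "('a::composition_algebra \<Rightarrow> 'a) \<Rightarrow> (3 \<Rightarrow> 'a) \<Rightarrow> 'a end3" where
  "tri_H E u = tri_of (\<lambda>i. E + lmul (u (i + 1)) - rmul (u (i + 2)))"

lemma tri_comp_H: "tri_comp (tri_H E u) i x = E x + u (i + 1) * x - x * u (i + 2)"
  by (simp add: tri_H_def lmul_def rmul_def)

text \<open>By alternativity the left-hand side is minus the sum of the associators of
  \<open>b\<close>, \<open>a\<close> with the three \<open>u\<close>'s, hence minus one associator
  with their sum.\<close>

lemma asc_sum_zero:
  fixes u u' u'' a b :: "'a::composition_algebra"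
  assumes "u + u' + u'' = 0"
  shows "u * (b * a) - (b * a) * u' + b * (a * u') - b * (u'' * a) + (b * u'') * a - (u * b) * a = 0"
proof -
  have "asc b a u + asc b a u' + asc b a u'' = asc b a (u + u' + u'')"
    by (simp add: asc_def ca_mult_simps algebra_simps)
  also have "\<dots> = 0"
    by (simp add: assms asc_def)
  finally have "asc b a u + asc b a u' + asc b a u'' = 0" .
  moreover have "asc u b a = asc b a u" "asc b u'' a = - asc b a u''"
    using asc_cyclic [of b a u] asc_skew [of b a u''] by auto
  moreover have "- asc b a u - asc b a u' - asc b a u'' = - (asc b a u + asc b a u' + asc b a u'')"
    by simp
  ultimately have "- asc u b a - asc b a u' + asc b u'' a = 0"
    by simp
  then show ?thesis by (simp add: asc_def algebra_simps)
qed

lemma tri_H_Tri: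
  assumes E: "E \<in> derivations (*)" and u: "\<And>i. u i \<in> im_space" and s: "\<And>i. u i + u (i + 1) + u (i + 2) = 0"
  shows "tri_H E u \<in> Tri"
  unfolding Tri_iff
proof (intro conjI allI)
  fix i x y
  show "tri_comp (tri_H E u) i \<in> so"
    unfolding tri_H_def tri_comp_tri_of by (intro so_closed so_diff derivation_so E lmul_so rmul_so u)
  show "tri_comp (tri_H E u) (i + 2) (cj y * cj x) =
      cj y * cj (tri_comp (tri_H E u) i x) + cj (tri_comp (tri_H E u) (i + 1) y) * cj x"
    using asc_sum_zero [OF s [of i], of "cj y" "cj x"]
    by (simp add: tri_comp_H cj_simps cj_mult derivation_cj [OF E, symmetric] derivation_mult [OF E] cj_im [OF u] ca_mult_simps ca_neg)
      (simp add: algebra_simps)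
qed

text \<open>If \<open>tri_comp U i 1 = u (i + 1) - u (i + 2)\<close> for all \<open>i\<close>, the
  difference here is \<open>2 u i - u (i + 1) - u (i + 2)\<close>, which is \<open>3 u i\<close>
  when the sum is zero.\<close>

definition tri_u :: "'a::composition_algebra end3 \<Rightarrow> 3 \<Rightarrow> 'a" where
  "tri_u U i = (1/3) *\<^sub>R (tri_comp U (i + 2) 1 - tri_comp U (i + 1) 1)"

definition tri_E :: "'a::composition_algebra end3 \<Rightarrow> 'a \<Rightarrow> 'a" where
  "tri_E U = tri_comp U 1 - lmul (tri_u U 2) + rmul (tri_u U 3)"

lemma tri_one_im: "U \<in> Tri \<Longrightarrow> tri_comp U i 1 \<in> im_space"
  using so_skew [OF Tri_so, of U i 1 1] by (simp add: im_space_def ip_commute)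

lemma tri_one_sum: "U \<in> Tri \<Longrightarrow> tri_comp U i 1 + tri_comp U (i + 1) 1 + tri_comp U (i + 2) 1 = 0"
  using Tri_mult [of U i 1 1] by (simp add: mult_one_l mult_one_r cj_im [OF tri_one_im])

lemma tri_u_im: "U \<in> Tri \<Longrightarrow> tri_u U i \<in> im_space"
  by (simp add: tri_u_def im_space_closed tri_one_im)

lemma tri_u_sum: "tri_u U i + tri_u U (i + 1) + tri_u U (i + 2) = 0"
  by (simp add: tri_u_def scaleR_add_right [symmetric])

lemma third_of_sum_zero:
  fixes a b c :: "'a::real_vector"
  assumes "a + b + c = 0"
  shows "(1/3) *\<^sub>R ((a - c) - (b - a)) = a"
proof -
  have "c = - (a + b)"
    using assms by (simp only: eq_neg_iff_add_eq_0 add_ac)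
  then have "(a - c) - (b - a) = (1 + (1 + 1)) *\<^sub>R a"
    by (simp only: scaleR_add_left scaleR_one) (simp add: algebra_simps)
  then show ?thesis by simp
qed

lemma tri_u_diff: "U \<in> Tri \<Longrightarrow> tri_u U (i + 1) - tri_u U (i + 2) = tri_comp U i 1"
  using third_of_sum_zero [OF tri_one_sum, of U i] by (simp add: tri_u_def scaleR_diff_right)

text \<open>Neighbouring components differ only by multiplications: the triality identity with
  \<open>1\<close> as one argument, on either side, evaluates component \<open>i + 2\<close> at
  \<open>cj x\<close> in two ways.\<close>

lemma tri_comp_next:
  assumes U: "U \<in> Tri"
  shows "tri_comp U (i + 1) x = tri_comp U i x + x * tri_comp U (i + 1) 1 - tri_comp U i 1 * x"
proof -
  have "cj (tri_comp U (i + 2) (cj x)) = tri_comp U i x + x * tri_comp U (i + 1) 1"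
    using arg_cong [OF Tri_mult [OF U, of i 1 x], of cj] by (simp add: mult_one_l cj_simps cj_mult)
  moreover have "cj (tri_comp U (i + 2) (cj x)) = tri_comp U i 1 * x + tri_comp U (i + 1) x"
    using arg_cong [OF Tri_mult [OF U, of i x 1], of cj] by (simp add: mult_one_r cj_simps cj_mult)
  ultimately show ?thesis by (simp add: algebra_simps)
qed

text \<open>What \<open>tri_comp_next\<close> adds in passing to the next component is exactly the
  change in the multiplications by \<open>tri_u U\<close>, so the remainder is common to all three
  components.\<close>

lemma tri_E_eq:
  assumes U: "U \<in> Tri"
  shows "tri_E U x = tri_comp U i x - tri_u U (i + 1) * x + x * tri_u U (i + 2)"
proof -
  define f where "f i = tri_comp U i x - tri_u U (i + 1) * x + x * tri_u U (i + 2)" for i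
  have f: "f (i + 1) = f i" for i
    unfolding f_def tri_comp_next [OF U, of i x] tri_u_diff [OF U, of i, symmetric] tri_u_diff [OF U, of "i + 1", symmetric]
    by (simp add: ca_mult_simps algebra_simps)
  then have "f (i + 1) = f i" "f (i + 2) = f i" for i
    using f [of i] f [of "i + 1"] by simp_all
  moreover have "tri_E U x = f 1"
    by (simp add: tri_E_def f_def lmul_def rmul_def)
  \<comment> \<open>Only the existence of an index is kept: \<open>f\<close> is constant on the
    cycle, so any index will do.\<close>
  then obtain k where "tri_E U x = f k" ..
  ultimately have "tri_E U x = f i"
    by (cases rule: three_cases [of i k]) simp_all
  then show ?thesis by (simp add: f_def)
qed

lemma tri_H_tri_E: "U \<in> Tri \<Longrightarrow> tri_H (tri_E U) (tri_u U) = U"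
proof (rule tri_eqI, rule ext)
  fix i x
  assume "U \<in> Tri"
  then show "tri_comp (tri_H (tri_E U) (tri_u U)) i x = tri_comp U i x"
    by (simp add: tri_comp_H tri_E_eq [of U x i])
qed

text \<open>Once the multiplications by \<open>tri_u U\<close> are removed, their contribution being
  the vanishing associator sum, the triality identity becomes the Leibniz rule; the conjugations
  disappear because \<open>tri_E U\<close> commutes with \<open>cj\<close>.\<close>

lemma tri_E_derivation:
  assumes U: "U \<in> Tri"
  shows "tri_E U \<in> derivations (*)"
proof -
  let ?E = "tri_E U" and ?u = "tri_u U"
  have lin: "linear ?E"
    unfolding tri_E_def
    by (rule linearI) (simp_all add: linear_add [OF linear_tri_comp [OF U]] linear_scale [OF linear_tri_comp [OF U]]
      lmul_def rmul_def ca_mult_simps algebra_simps)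
  have one: "?E 1 = 0"
    using tri_E_eq [OF U, of 1 1] tri_u_diff [OF U, of 1] by (simp add: mult_one_l mult_one_r algebra_simps)
  have so: "?E \<in> so"
    unfolding tri_E_def by (intro so_closed so_diff Tri_so lmul_so rmul_so tri_u_im U)
  have im: "?E x \<in> im_space" for x
    using so_skew [OF so, of x 1] by (simp add: im_space_def one)
  have cj: "cj (?E x) = ?E (cj x)" for x
    using cj_im [OF im, of x] by (simp add: cj_alt [of x] linear_diff [OF lin] linear_scale [OF lin] one)
  have U': "tri_comp U i x = ?E x + ?u (i + 1) * x - x * ?u (i + 2)" for i x
    using tri_E_eq [OF U, of x i] by (simp add: algebra_simps)
  fix i :: 3
  have "?E (x * y) = ?E x * y + x * ?E y" for x y
    using Tri_mult [OF U, of i "cj x" "cj y"] asc_sum_zero [OF tri_u_sum, of U i x y]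
    unfolding U' by (simp add: cj_simps cj_mult cj cj_im [OF tri_u_im [OF U]] ca_mult_simps ca_neg)
      (simp add: algebra_simps)
  then show "?E \<in> derivations (*)"
    using lin by (simp add: derivations_def)
qed

lemma tri_H_inject:
  assumes E: "E 1 = 0" and s: "u 1 + u 2 + u 3 = 0"
  shows "tri_u (tri_H E u) i = u i" "tri_E (tri_H E u) = E"
proof -
  have s: "u i + u (i + 1) + u (i + 2) = 0" for i
    using s sum_three [of u i] sum_3 [of u] by simp
  show u: "tri_u (tri_H E u) i = u i" for i
    using third_of_sum_zero [of "u i" "u (i + 2)" "u (i + 1)"] s [of i]
    by (simp add: add.assoc [where 'a='a] add.commute [of "u (i + 2)"] tri_u_def tri_comp_H E mult_one_l mult_one_r)
  show "tri_E (tri_H E u) = E"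
    by (rule ext) (simp add: tri_E_def u tri_comp_H lmul_def rmul_def)
qed

section \<open>Brackets and \<open>tau\<close> in terms of derivations and imaginary triples\<close>

lemma inner_der_asc: "inner_der x y z = (x * y - y * x) * z - z * (x * y - y * x) - 3 *\<^sub>R asc x y z"
proof -
  have "asc y x z = - asc x y z" "asc x z y = - asc x y z" "asc z x y = asc x y z" "asc z y x = - asc x y z"
    using asc_skew(1) [of y x z] asc_skew(2) [of x z y] asc_cyclic(2) [of z x y] asc_cyclic(2) [of z y x] by simp_all
  then have r: "x * (y * z) = (x * y) * z - asc x y z" "y * (x * z) = (y * x) * z + asc x y z"
    "(z * x) * y = z * (x * y) + asc x y z" "(z * y) * x = z * (y * x) - asc x y z"
    "x * (z * y) = (x * z) * y + asc x y z"
    by (simp_all add: asc_def algebra_simps)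
  have "3 *\<^sub>R asc x y z = asc x y z + (asc x y z + asc x y z)"
    using scaleR_add_left [of 1 2 "asc x y z"] by (simp add: scaleR_2)
  then show ?thesis
    by (simp add: inner_der_def commutator_def lmul_def rmul_def r ca_mult_simps)
qed

lemma asc_lin: "asc (x + x') y z = asc x y z + asc x' y z" "asc x (y + y') z = asc x y z + asc x y' z"
  "asc (- x) y z = - asc x y z" "asc x (- y) z = - asc x y z"
  by (simp_all add: asc_def ca_mult_simps ca_neg)

text \<open>Nested multiplications sorted into a commutator part and a multiple of one associator,
  as \<open>inner_der_asc\<close> does for \<open>inner_der\<close>, so that the two sides of the
  bracket formula can be compared term by term.\<close>

lemma lmul_rmul_asc:
  "x * (y * z) - y * (x * z) = (x * y - y * x) * z - 2 *\<^sub>R asc x y z"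
  "(z * y) * x - (z * x) * y = - (z * (x * y - y * x)) - 2 *\<^sub>R asc x y z"
  "(x * z) * y - x * (z * y) = - asc x y z"
  "x * (z * y) - (x * z) * y = - asc y x z"
proof -
  have r: "asc y x z = - asc x y z" "asc x z y = - asc x y z" "asc z x y = asc x y z" "asc z y x = - asc x y z"
    using asc_skew(1) [of y x z] asc_skew(2) [of x z y] asc_cyclic(2) [of z x y] asc_cyclic(2) [of z y x] by simp_all
  show "x * (y * z) - y * (x * z) = (x * y - y * x) * z - 2 *\<^sub>R asc x y z"
    using r(1) by (simp add: scaleR_2) (simp add: asc_def ca_mult_simps algebra_simps)
  show "(z * y) * x - (z * x) * y = - (z * (x * y - y * x)) - 2 *\<^sub>R asc x y z"
    using r(3,4) by (simp add: scaleR_2) (simp add: asc_def ca_mult_simps algebra_simps)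
  show "(x * z) * y - x * (z * y) = - asc x y z" "x * (z * y) - (x * z) * y = - asc y x z"
  proof -
    have "(x * z) * y - x * (z * y) = asc x z y"
      by (simp add: asc_def)
    then show "(x * z) * y - x * (z * y) = - asc x y z"
      using r(2) by simp
    have "x * (z * y) - (x * z) * y = - asc x z y"
      by (simp add: asc_def)
    then show "x * (z * y) - (x * z) * y = - asc y x z"
      using r(1,2) by simp
  qed
qed

text \<open>The commutators of \<open>u k\<close> with \<open>u' k\<close> need not sum to zero.
  Subtracting their mean restores the normalisation, and the derivation part absorbs the difference
  as a third of the sum of the \<open>inner_der\<close>'s. On the Tits side the mean is the trace
  correction in \<open>herm_star\<close>, and the third is
  \<open>herm_ip (he k) (he k) / 6\<close>.\<close>

lemma end3_bracket_H:
  assumes E: "E \<in> derivations (*)" "E' \<in> derivations (*)"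
    and s: "\<And>i. u i + u (i + 1) + u (i + 2) = 0" "\<And>i. u' i + u' (i + 1) + u' (i + 2) = (0 :: 'a::composition_algebra)"
  shows "end3_bracket (tri_H E u) (tri_H E' u') =
    tri_H (commutator E E' + (1/3) *\<^sub>R (\<Sum>k\<in>UNIV. inner_der (u k) (u' k)))
      (\<lambda>i. E (u' i) - E' (u i) + (u i * u' i - u' i * u i) - (1/3) *\<^sub>R (\<Sum>k\<in>UNIV. u k * u' k - u' k * u k))"
    (is "_ = tri_H ?E ?w")
proof (rule tri_eqI, rule ext)
  fix i x
  define S where "S = (\<Sum>k\<in>UNIV. u k * u' k - u' k * u k)"
  define p p' q q' where pq: "p = u (i + 1)" "p' = u' (i + 1)" "q = u (i + 2)" "q' = u' (i + 2)"
  \<comment> \<open>Eliminating \<open>u i\<close> and \<open>u' i\<close> makes the mixed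
    associators \<open>asc p q' x\<close> and \<open>asc q p' x\<close> appear on both
    sides.\<close>
  have ui: "u i = - (p + q)" "u' i = - (p' + q')"
    using s(1) [of i] s(2) [of i] by (simp_all only: pq eq_neg_iff_add_eq_0 add.assoc)
  note lin = linear_add [OF linear_derivation [OF E(1)]] linear_diff [OF linear_derivation [OF E(1)]]
    linear_add [OF linear_derivation [OF E(2)]] linear_diff [OF linear_derivation [OF E(2)]]
  have 1: "tri_comp (end3_bracket (tri_H E u) (tri_H E' u')) i x =
    commutator E E' x + (E p' - E' p) * x - x * (E q' - E' q) +
    ((p * (p' * x) - p' * (p * x)) + ((x * q') * q - (x * q) * q') + ((p * x) * q' - p * (x * q')) + (p' * (x * q) - (p' * x) * q))"
    unfolding tri_comp_bracket commutator_def fun_diff_def o_apply tri_comp_H pq [symmetric]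
    by (simp add: lin E derivation_mult ca_mult_simps)
  have D: "(\<Sum>k\<in>UNIV. inner_der (u k) (u' k)) x =
      S * x - x * S - 3 *\<^sub>R (2 *\<^sub>R asc p p' x + 2 *\<^sub>R asc q q' x + asc p q' x + asc q p' x)"
  proof -
    have "(\<Sum>k\<in>UNIV. inner_der (u k) (u' k)) x = S * x - x * S - 3 *\<^sub>R (asc (u i) (u' i) x + asc p p' x + asc q q' x)"
      unfolding S_def sum_three [of _ i]
      by (simp add: inner_der_asc pq ca_mult_simps scaleR_add_right)
    moreover have "asc (u i) (u' i) x + asc p p' x + asc q q' x = 2 *\<^sub>R asc p p' x + 2 *\<^sub>R asc q q' x + asc p q' x + asc q p' x"
      unfolding ui asc_lin by (simp add: scaleR_2)
    ultimately show ?thesis by simp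
  qed
  have 2: "tri_comp (tri_H ?E ?w) i x = commutator E E' x + (E p' - E' p) * x - x * (E q' - E' q) +
     ((p * p' - p' * p) * x - x * (q * q' - q' * q) - (2 *\<^sub>R asc p p' x + 2 *\<^sub>R asc q q' x + asc p q' x + asc q p' x))"
    unfolding tri_comp_H pq [symmetric] S_def [symmetric] plus_fun_apply scaleR_fun_apply D
    by (simp add: ca_mult_simps scaleR_diff_right)
  show "tri_comp (end3_bracket (tri_H E u) (tri_H E' u')) i x = tri_comp (tri_H ?E ?w) i x"
    unfolding 1 2 lmul_rmul_asc(1) [of p p'] lmul_rmul_asc(2) [of x q' q] lmul_rmul_asc(3) [of p x q'] lmul_rmul_asc(4) [of p' x q]
    by (simp add: algebra_simps)
qed

text \<open>The triple is found from the values of the components at \<open>1\<close>. The 2/3 in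
  front of \<open>inner_der\<close> is what Tits's bracket gives for two elements of
  \<open>hP i\<close>: \<open>herm_ip\<close> contributes a factor 4, divided by 6.\<close>

lemma tri_E_tau: "tri_E (tau i x y) = (2/3) *\<^sub>R inner_der (im_part x) (im_part (y :: 'a::composition_algebra))" (is ?E)
  and tri_u_tau:
    "tri_u (tau i x y) i = - (2/3) *\<^sub>R (im_part x * im_part y - im_part y * im_part x)" (is ?u0)
    "tri_u (tau i x y) (i + 1) = 2 *\<^sub>R (rp x *\<^sub>R im_part y - rp y *\<^sub>R im_part x) +
       (1/3) *\<^sub>R (im_part x * im_part y - im_part y * im_part x)" (is ?u1)
    "tri_u (tau i x y) (i + 2) = - 2 *\<^sub>R (rp x *\<^sub>R im_part y - rp y *\<^sub>R im_part x) +
       (1/3) *\<^sub>R (im_part x * im_part y - im_part y * im_part x)" (is ?u2)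
proof -
  define s t a b where st: "s = rp x" "t = rp y" "a = im_part x" "b = im_part y"
  have im: "a \<in> im_space" "b \<in> im_space"
    by (simp_all add: st im_part_im_space)
  have xy: "x = s *\<^sub>R 1 + a" "y = t *\<^sub>R 1 + b"
    by (simp_all add: st rp_im_decomp)
  have ab: "ip a 1 = 0" "ip b 1 = 0"
    using im by (simp_all add: im_space_def)
  define c m where cm: "c = a * b - b * a" "m = s *\<^sub>R b - t *\<^sub>R a"
  have d: "tri_comp (tau i x y) i 1 = 4 *\<^sub>R m" "tri_comp (tau i x y) (i + 1) 1 = c - 2 *\<^sub>R m"
    "tri_comp (tau i x y) (i + 2) 1 = - c - 2 *\<^sub>R m"
    by (simp_all add: tri_comp_tau cm xy K_simps cj_im [OF im(1)] cj_im [OF im(2)] ab scaleR_2)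
      (simp_all add: algebra_simps)
  have u0: "tri_u (tau i x y) i = - (2/3) *\<^sub>R c"
    using scaleR_add_left [of "1/3" "1/3" c] by (simp add: tri_u_def d scaleR_diff_right)
  have "4 *\<^sub>R m - (- c - 2 *\<^sub>R m) = c + 6 *\<^sub>R m" "(c - 2 *\<^sub>R m) - 4 *\<^sub>R m = c - 6 *\<^sub>R m"
    using scaleR_add_left [of 4 2 m] by simp_all
  then have "tri_u (tau i x y) (i + 1) = (1/3) *\<^sub>R (c + 6 *\<^sub>R m)" "tri_u (tau i x y) (i + 2) = (1/3) *\<^sub>R (c - 6 *\<^sub>R m)"
    by (simp_all add: tri_u_def d)
  then have u1: "tri_u (tau i x y) (i + 1) = 2 *\<^sub>R m + (1/3) *\<^sub>R c" and u2: "tri_u (tau i x y) (i + 2) = - 2 *\<^sub>R m + (1/3) *\<^sub>R c"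
    by (simp_all add: scaleR_diff_right scaleR_add_right)
  show ?u0 ?u1 ?u2
    using u0 u1 u2 unfolding cm st by simp_all
  show ?E
  proof
    fix z
    \<comment> \<open>The triality identity of \<open>T_elem a b\<close> at the product
      \<open>z * 1\<close> rewrites the inner products in \<open>S_map\<close> as nested
      multiplications, to which \<open>lmul_rmul_asc\<close> applies.\<close>
    have "(4 *\<^sub>R S_map a b) (z * 1) = z * ((rmul b \<circ> rmul (cj a)) - (rmul a \<circ> rmul (cj b))) 1 +
      ((lmul b \<circ> lmul (cj a)) - (lmul a \<circ> lmul (cj b))) z * 1"
      using T_elem_Tri [of a b] by (simp only: Tri_def T_elem_def mem_Collect_eq case_prod_conv)
    then have S: "4 *\<^sub>R (ip a z *\<^sub>R b - ip b z *\<^sub>R a) = (a * (b * z) - b * (a * z)) - z * c"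
      by (simp add: S_map_def lmul_def rmul_def cj_im im K_simps cm)
    have z: "z = rp z *\<^sub>R 1 + im_part z"
      by (simp add: rp_im_decomp)
    have mz: "m * z + z * m = (2 * rp z) *\<^sub>R m - (2 * ip m z) *\<^sub>R 1"
    proof -
      have mi: "m \<in> im_space"
        unfolding cm by (intro im_space_closed im)
      have "m * z + z * m = (2 * rp z) *\<^sub>R m + (m * im_part z + im_part z * m)"
        by (subst (1 2) z) (simp only: ca_mult_simps mult_one_l mult_one_r mult_2 scaleR_add_left add_ac)
      then show ?thesis
        using mult_im_anticommute [OF mi im_part_im_space [of z]] mi
        by (simp add: im_part_def ip_simps im_space_def)
    qed
    have "tri_E (tau i x y) z = 4 *\<^sub>R (ip x z *\<^sub>R y - ip y z *\<^sub>R x) - (2 *\<^sub>R m + (1/3) *\<^sub>R c) * z + z * (- 2 *\<^sub>R m + (1/3) *\<^sub>R c)"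
      by (subst tri_E_eq [OF tau_Tri, of _ _ _ _ i]) (simp only: tri_comp_tau u1 u2)
    also have "\<dots> = 4 *\<^sub>R (ip x z *\<^sub>R y - ip y z *\<^sub>R x) - 2 *\<^sub>R (m * z + z * m) - (1/3) *\<^sub>R (c * z - z * c)"
      by (simp add: ca_mult_simps ca_neg algebra_simps)
    also have "4 *\<^sub>R (ip x z *\<^sub>R y - ip y z *\<^sub>R x) = 4 *\<^sub>R (ip a z *\<^sub>R b - ip b z *\<^sub>R a) + 4 *\<^sub>R (rp z *\<^sub>R m - ip m z *\<^sub>R 1)"
      by (simp add: xy cm K_simps rp_def ip_commute [of 1] algebra_simps)
    also have "\<dots> = (a * (b * z) - b * (a * z)) - z * c + 4 *\<^sub>R (rp z *\<^sub>R m - ip m z *\<^sub>R 1)"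
      by (simp only: S)
    also have "\<dots> - 2 *\<^sub>R (m * z + z * m) - (1/3) *\<^sub>R (c * z - z * c) = (2/3) *\<^sub>R (c * z - z * c - 3 *\<^sub>R asc a b z)"
    proof -
      have "(c * z - z * c) - (1/3) *\<^sub>R (c * z - z * c) = (2/3) *\<^sub>R (c * z - z * c)"
        using scaleR_diff_left [of 1 "1/3" "c * z - z * c"] by simp
      then show ?thesis
        unfolding mz lmul_rmul_asc(1) cm(1) [symmetric] by (simp add: scaleR_diff_right)
    qed
    finally show "tri_E (tau i x y) z = ((2/3) *\<^sub>R inner_der (im_part x) (im_part y)) z"
      by (simp add: inner_der_asc cm st)
  qed
qed

section \<open>The isomorphism\<close>

definition tits1 :: "('a::composition_algebra herm3, 'b::composition_algebra) tensor \<Rightarrow> ('a herm3, 'b) tensor \<Rightarrow> 'a herm3 \<Rightarrow> 'a herm3" where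
  "tits1 = tensor_lift2 (\<lambda>A x B y. ip x y *\<^sub>R commutator (jordan A) (jordan B))"

definition tits2 :: "('a::composition_algebra herm3, 'b::composition_algebra) tensor \<Rightarrow> ('a herm3, 'b) tensor \<Rightarrow> ('a herm3, 'b) tensor" where
  "tits2 = tensor_lift2 (\<lambda>A x B y. herm_star A B \<otimes> ((1/2) *\<^sub>R (x * y - y * x)))"

definition tits3 :: "('a::composition_algebra herm3, 'b::composition_algebra) tensor \<Rightarrow> ('a herm3, 'b) tensor \<Rightarrow> 'b \<Rightarrow> 'b" where
  "tits3 = tensor_lift2 (\<lambda>A x B y. (herm_ip A B / 6) *\<^sub>R inner_der x y)"

lemma tits_bracket_eq: "tits_bracket (D, u, E) (D', v, E') = (commutator D D' - tits1 u v,
    tensor_map D id v - tensor_map D' id u + tensor_map id E v - tensor_map id E' u + tits2 u v,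
    commutator E E' + tits3 u v)"
  by (simp add: tits1_def tits2_def tits3_def)

lemma tits_pure:
  "tits1 (A \<otimes> x) (B \<otimes> y) = ip x y *\<^sub>R commutator (jordan A) (jordan B)"
  "tits2 (A \<otimes> x) (B \<otimes> y) = herm_star A B \<otimes> ((1/2) *\<^sub>R (x * y - y * x))"
  "tits3 (A \<otimes> x) (B \<otimes> y) = (herm_ip A B / 6) *\<^sub>R inner_der x y"
  unfolding tits1_def tits2_def tits3_def by (rule tits_tensor_lift2)+

lemma bilinear_tits: "bilinear tits1" "bilinear tits2" "bilinear tits3"
  unfolding tits1_def tits2_def tits3_def by (rule tits_tensor_lift2)+

lemmas tits_lin =
  bilinear_ladd [OF bilinear_tits(1)] bilinear_radd [OF bilinear_tits(1)] bilinear_lmul [OF bilinear_tits(1)] bilinear_rmul [OF bilinear_tits(1)]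
  bilinear_ladd [OF bilinear_tits(2)] bilinear_radd [OF bilinear_tits(2)] bilinear_lmul [OF bilinear_tits(2)] bilinear_rmul [OF bilinear_tits(2)]
  bilinear_ladd [OF bilinear_tits(3)] bilinear_radd [OF bilinear_tits(3)] bilinear_lmul [OF bilinear_tits(3)] bilinear_rmul [OF bilinear_tits(3)]
  bilinear_lneg [OF bilinear_tits(1)] bilinear_rneg [OF bilinear_tits(1)] bilinear_lneg [OF bilinear_tits(2)]
  bilinear_rneg [OF bilinear_tits(2)] bilinear_lneg [OF bilinear_tits(3)] bilinear_rneg [OF bilinear_tits(3)]

lemmas tits_zero [simp] =
  bilinear_lzero [OF bilinear_tits(1)] bilinear_rzero [OF bilinear_tits(1)] bilinear_lzero [OF bilinear_tits(2)]
  bilinear_rzero [OF bilinear_tits(2)] bilinear_lzero [OF bilinear_tits(3)] bilinear_rzero [OF bilinear_tits(3)]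

lemma tensor_bilinear_eqI:
  assumes f: "bilinear f" and g: "bilinear g" and eq: "\<And>a b c d. f (a \<otimes> b) (c \<otimes> d) = g (a \<otimes> b) (c \<otimes> d)"
  shows "f u v = g u v"
proof -
  have l: "linear (\<lambda>u. f u v)" "linear (\<lambda>u. g u v)" "linear (f u)" "linear (g u)" for u v
    using f g unfolding bilinear_def by blast+
  have "(\<lambda>u. f u (c \<otimes> d)) = (\<lambda>u. g u (c \<otimes> d))" for c d
    by (rule tensor_linear_eqI [OF l(1,2)]) (rule eq)
  then have "f u = g u"
    by (intro tensor_linear_eqI [OF l(3,4)]) (simp add: fun_eq_iff)
  then show ?thesis by simp
qed

lemma commutator_skew: "commutator g f = - commutator f g"
  by (simp add: commutator_def)

lemma herm_star_commute: "herm_star B A = herm_star A B"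
  by (simp add: herm_star_def jordan_commute [of B])

lemma herm_ip_commute: "herm_ip B A = herm_ip A B"
  by (simp add: herm_ip_def jordan_commute [of B])

lemma inner_der_skew: "inner_der y x = - inner_der x y"
  by (rule ext) (simp add: inner_der_asc asc_skew(1) [of y x] ca_mult_simps algebra_simps)

lemma tits_skew: "tits1 v u = - tits1 u v" "tits2 v u = - tits2 u v" "tits3 v u = - tits3 u v"
proof -
  show "tits1 v u = - tits1 u v"
  proof (rule tensor_bilinear_eqI [of "\<lambda>u v. tits1 v u" "\<lambda>u v. - tits1 u v" u v])
    show "bilinear (\<lambda>u v. tits1 v u)" "bilinear (\<lambda>u v. - tits1 u v)"
      by (auto simp: bilinear_def tits_lin intro!: linearI)
  qed (simp add: tits_pure ip_commute, metis commutator_skew scaleR_minus_right)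
  show "tits2 v u = - tits2 u v"
  proof (rule tensor_bilinear_eqI [of "\<lambda>u v. tits2 v u" "\<lambda>u v. - tits2 u v" u v])
    show "bilinear (\<lambda>u v. tits2 v u)" "bilinear (\<lambda>u v. - tits2 u v)"
      by (auto simp: bilinear_def tits_lin intro!: linearI)
    show "tits2 (C \<otimes> y) (A \<otimes> x) = - tits2 (A \<otimes> x) (C \<otimes> y)" for A C and x y :: 'b
      by (simp add: tits_pure herm_star_commute [of C] tensor_simps(8) [symmetric])
        (simp add: scaleR_minus_right [symmetric])
  qed
  show "tits3 v u = - tits3 u v"
  proof (rule tensor_bilinear_eqI [of "\<lambda>u v. tits3 v u" "\<lambda>u v. - tits3 u v" u v])
    show "bilinear (\<lambda>u v. tits3 v u)" "bilinear (\<lambda>u v. - tits3 u v)"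
      by (auto simp: bilinear_def tits_lin intro!: linearI)
    show "tits3 (C \<otimes> y) (A \<otimes> x) = - tits3 (A \<otimes> x) (C \<otimes> y)" for A C and x y
      using inner_der_skew [of y x] by (simp add: tits_pure herm_ip_commute [of C])
  qed
qed

lemma tits_bracket_skew: "tits_bracket b a = - tits_bracket a b"
proof -
  obtain D u E D' v E' where ab: "a = (D, u, E)" "b = (D', v, E')"
    by (cases a; cases b)
  show ?thesis
    unfolding ab tits_bracket_eq tits_skew [of v u] commutator_skew [of D' D] commutator_skew [of E' E]
    by simp
qed

text \<open>The type admits arbitrary functions, but bilinearity of \<open>tits_bracket\<close>
  relies on linear maps inside \<open>commutator\<close> and \<open>tensor_map\<close>. On this set
  the bracket is bilinear before anything is known about Tits's algebra.\<close>

definition tits_linear :: "('a::composition_algebra, 'b::composition_algebra) tits set" where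
  "tits_linear = {D. linear D} \<times> UNIV \<times> {E. linear E}"

lemma tits_bracket_lin_left:
  assumes "a \<in> tits_linear" "b \<in> tits_linear" "c \<in> tits_linear"
  shows "tits_bracket (a + b) c = tits_bracket a c + tits_bracket b c"
    "tits_bracket (r *\<^sub>R a) c = r *\<^sub>R tits_bracket a c"
proof -
  obtain D u E D' v E' D'' w E'' where abc: "a = (D, u, E)" "b = (D', v, E')" "c = (D'', w, E'')"
    by (cases a; cases b; cases c)
  have l: "linear D" "linear E" "linear D'" "linear E'" "linear D''" "linear E''"
    using assms by (auto simp: abc tits_linear_def)
  have c: "commutator (D + D') D'' = commutator D D'' + commutator D' D''" "commutator (r *\<^sub>R D) D'' = r *\<^sub>R commutator D D''"
    "commutator (E + E') E'' = commutator E E'' + commutator E' E''" "commutator (r *\<^sub>R E) E'' = r *\<^sub>R commutator E E''"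
    using l(5,6) by (auto simp: commutator_def fun_eq_iff linear_add linear_scale algebra_simps)
  note tm = tensor_map_add_left tensor_map_add_right tensor_map_scaleR_left tensor_map_scaleR_right
    linear_add [OF linear_tensor_map] linear_scale [OF linear_tensor_map]
  show "tits_bracket (a + b) c = tits_bracket a c + tits_bracket b c"
    "tits_bracket (r *\<^sub>R a) c = r *\<^sub>R tits_bracket a c"
    unfolding abc by (simp_all add: tits_bracket_eq c tits_lin tm l linear_id del: tits_bracket.simps) (simp_all add: algebra_simps)
qed

lemma tits_bracket_lin_right:
  assumes "a \<in> tits_linear" "b \<in> tits_linear" "c \<in> tits_linear"
  shows "tits_bracket c (a + b) = tits_bracket c a + tits_bracket c b"
    "tits_bracket c (r *\<^sub>R a) = r *\<^sub>R tits_bracket c a"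
  using tits_bracket_lin_left [OF assms]
  by (simp_all add: tits_bracket_skew [of c] del: tits_bracket.simps)

lemma tits_bracket_scaleR:
  assumes "a \<in> tits_linear" "c \<in> tits_linear"
  shows "tits_bracket (r *\<^sub>R a) c = r *\<^sub>R tits_bracket a c"
    "tits_bracket c (r *\<^sub>R a) = r *\<^sub>R tits_bracket c a"
  using tits_bracket_lin_left(2) [OF assms(1,1,2)] tits_bracket_lin_right(2) [OF assms(1,1,2)] .

text \<open>Splitting the second tensor factor as \<open>\<real> 1 + im_space\<close>, the coefficient of \<open>1\<close> becomes a derivation
  and the imaginary part stays a tensor.\<close>

definition iso_off :: "('a::composition_algebra, 'b::composition_algebra) tensor^3 \<Rightarrow> 3 \<Rightarrow> 'a" where
  "iso_off v i = tensor_lift (\<lambda>x y. rp y *\<^sub>R x) (v $ i)"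

definition iso_offt :: "('a::composition_algebra, 'b::composition_algebra) tensor^3 \<Rightarrow> ('a herm3, 'b) tensor" where
  "iso_offt v = (\<Sum>i\<in>UNIV. tensor_map (hP i) im_part (v $ i))"

definition iso_diag :: "'b::composition_algebra end3 \<Rightarrow> ('a::composition_algebra herm3, 'b) tensor" where
  "iso_diag U = (\<Sum>i\<in>UNIV. he i \<otimes> tri_u U i)"

fun magic_iso :: "('a::composition_algebra, 'b::composition_algebra) triality \<Rightarrow> ('a, 'b) tits" where
  "magic_iso (T, U, v) = (hT T - (\<Sum>i\<in>UNIV. hD i (iso_off v i)), iso_diag U - iso_offt v, tri_E U)"

section \<open>The linear map and its values on generators\<close>

lemma bilinear_rp_scaleR: "bilinear (\<lambda>(x :: 'a::composition_algebra) (y :: 'b::composition_algebra). rp y *\<^sub>R x)"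
  unfolding bilinear_def
  by (auto intro!: linearI simp: linear_add [OF linear_rp] linear_scale [OF linear_rp] algebra_simps)

lemma iso_off_lin: "iso_off (v + w) i = iso_off v i + iso_off w i" "iso_off (r *\<^sub>R v) i = r *\<^sub>R iso_off v i"
  by (simp_all add: iso_off_def linear_add [OF linear_tensor_lift [OF bilinear_rp_scaleR]]
      linear_scale [OF linear_tensor_lift [OF bilinear_rp_scaleR]])

lemma iso_offt_lin: "iso_offt (v + w) = iso_offt v + iso_offt w" "iso_offt (r *\<^sub>R v) = r *\<^sub>R iso_offt v"
  by (simp_all add: iso_offt_def linear_add [OF linear_tensor_map] linear_scale [OF linear_tensor_map]
      linear_hP linear_im_part sum.distrib scaleR_sum_right)

lemma tri_u_lin: "tri_u (U + V) i = tri_u U i + tri_u V i" "tri_u (r *\<^sub>R U) i = r *\<^sub>R tri_u U i"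
  by (simp_all add: tri_u_def tri_comp_add tri_comp_scaleR scaleR_add_right scaleR_diff_right mult.commute)

lemma tri_E_lin: "tri_E (U + V) = tri_E U + tri_E V" "tri_E (r *\<^sub>R U) = r *\<^sub>R tri_E U"
  by (rule ext; simp add: tri_E_def tri_u_lin tri_comp_add tri_comp_scaleR lmul_def rmul_def ca_mult_simps algebra_simps)+

lemma iso_diag_lin: "iso_diag (U + V) = iso_diag U + iso_diag V" "iso_diag (r *\<^sub>R U) = r *\<^sub>R iso_diag U"
  by (simp_all add: iso_diag_def tri_u_lin tensor_simps sum.distrib scaleR_sum_right)

lemma linear_iso: "linear magic_iso"
proof (rule linearI)
  show "magic_iso (a + b) = magic_iso a + magic_iso b" for a b :: "('a, 'b) triality"
    by (cases a; cases b) (simp add: hT_lin hD_arg_lin iso_off_lin iso_offt_lin iso_diag_lin tri_E_lin sum.distrib algebra_simps)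
  show "magic_iso (r *\<^sub>R a) = r *\<^sub>R magic_iso a" for r and a :: "('a, 'b) triality"
    by (cases a) (simp add: hT_lin hD_arg_lin iso_off_lin iso_offt_lin iso_diag_lin tri_E_lin scaleR_sum_right algebra_simps)
qed

lemma iso_off_F: "iso_off (F i (x \<otimes> y)) j = (if j = i then rp y *\<^sub>R x else 0)"
  by (simp add: iso_off_def F_nth tensor_lift_pure [OF bilinear_rp_scaleR] linear_0 [OF linear_tensor_lift [OF bilinear_rp_scaleR]])

lemma iso_offt_F: "iso_offt (F i (x \<otimes> y)) = hP i x \<otimes> im_part y"
proof -
  have "tensor_map (hP j) im_part (F i (x \<otimes> y) $ j) = (if j = i then hP i x \<otimes> im_part y else 0)" for j
    by (simp add: F_nth tensor_map_pure linear_hP linear_im_part linear_0 [OF linear_tensor_map])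
  then show ?thesis by (simp add: iso_offt_def)
qed

lemma iso_zero [simp]: "iso_off 0 i = 0" "iso_offt 0 = 0" "hT 0 = 0" "iso_diag 0 = 0" "tri_E 0 = 0"
  using iso_off_lin(2) [of 0 0] iso_offt_lin(2) [of 0 0] hT_lin(2) [of 0 0] iso_diag_lin(2) [of 0 0] tri_E_lin(2) [of 0 0]
  by simp_all

lemma iso_Tri: "magic_iso (T, U, 0) = (hT T, iso_diag U, tri_E U)"
  by (simp add: hD_arg_lin)

lemma iso_F: "magic_iso (0, 0, F i (x \<otimes> y)) = (- (rp y *\<^sub>R hD i x), - (hP i x \<otimes> im_part y), 0)"
proof -
  have "hD j (iso_off (F i (x \<otimes> y)) j) = (if j = i then rp y *\<^sub>R hD i x else 0)" for j
    by (simp add: iso_off_F hD_arg_lin)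
  then show ?thesis by (simp add: iso_offt_F)
qed

lemma iso_tits_linear:
  assumes "T \<in> Tri" "U \<in> Tri"
  shows "magic_iso (T, U, v) \<in> tits_linear"
proof -
  have "hT T - (\<Sum>i\<in>UNIV. hD i (iso_off v i)) \<in> derivations jordan"
    by (intro subspace_diff subspace_sum subspace_derivations bilinear_jordan hT_derivation hD_derivation assms)
  then show ?thesis
    using linear_derivation linear_derivation [OF tri_E_derivation [OF assms(2)]] by (auto simp: tits_linear_def)
qed

section \<open>Compatibility with brackets on generators\<close>

lemma herm_ip_table:
  "herm_ip (he i) (he j) = (if i = j then 2 else 0)" "herm_ip (he i) (hP j x) = 0" "herm_ip (hP j x) (he i) = 0"
  "herm_ip (hP i x) (hP i y) = 4 * ip x y" "herm_ip (hP i x) (hP (i + 1) y) = 0"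
proof -
  have "(\<Sum>k\<in>UNIV. if k = i then if i = j then 2 else 0 else 0) = (if i = j then 2 else (0::real))" for i j :: 3
    by simp
  moreover have "herm_ip (he i :: 'a herm3) (he j) = (\<Sum>k\<in>UNIV. if k = i then if i = j then 2 else 0 else 0)"
    unfolding herm_ip_eq by (rule sum.cong) auto
  ultimately show "herm_ip (he i :: 'a herm3) (he j) = (if i = j then 2 else 0)" by simp
  show "herm_ip (he i) (hP j x) = 0" "herm_ip (hP j x) (he i) = 0" "herm_ip (hP i x) (hP i y) = 4 * ip x y"
    "herm_ip (hP i x) (hP (i + 1) y) = 0"
    by (simp_all add: herm_ip_eq sum_three [of _ i])
qed

lemma herm_star_table:
  "herm_star (he i) (he j) = (if i = j then 2 *\<^sub>R he i - (2/3) *\<^sub>R herm_one else 0)"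
  "herm_star (he i) (hP j x) = jordan (he i) (hP j x)"
  "herm_star (hP i x) (hP i y) = (2 * ip x y) *\<^sub>R (he (i + 1) + he (i + 2)) - (4/3 * ip x y) *\<^sub>R herm_one"
  "herm_star (hP i x) (hP (i + 1) y) = hP (i + 2) (cj y * cj x)"
  unfolding herm_star_def herm_ip_def [symmetric] herm_ip_table by (simp_all add: jordan_table)

lemma iso_bracket_Tri_Tri:
  assumes Tr: "T \<in> Tri" "U \<in> Tri" "T' \<in> Tri" "U' \<in> Tri"
  shows "magic_iso (triality_bracket (T, U, 0) (T', U', 0)) =
    tits_bracket (magic_iso (T, U, 0)) (magic_iso (T', U', 0) :: ('a::composition_algebra, 'b::composition_algebra) tits)"
proof -
  define E E' u u' where Eu: "E = tri_E U" "E' = tri_E U'" "u = tri_u U" "u' = tri_u U'"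
  note der = tri_E_derivation [OF Tr(2), folded Eu(1)] tri_E_derivation [OF Tr(4), folded Eu(2)]
  have sum: "u i + u (i + 1) + u (i + 2) = 0" "u' i + u' (i + 1) + u' (i + 2) = 0" for i
    unfolding Eu by (rule tri_u_sum)+
  define c where "c k = u k * u' k - u' k * u k" for k
  define w where "w i = E (u' i) - E' (u i) + c i - (1/3) *\<^sub>R (\<Sum>k\<in>UNIV. c k)" for i
  define F where "F = commutator E E' + (1/3) *\<^sub>R (\<Sum>k\<in>UNIV. inner_der (u k) (u' k))"
  have "end3_bracket U U' = end3_bracket (tri_H E u) (tri_H E' u')"
    unfolding Eu by (simp add: tri_H_tri_E Tr)
  also have "\<dots> = tri_H F w"
    unfolding F_def w_def c_def by (rule end3_bracket_H [OF der sum])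
  finally have H: "end3_bracket U U' = tri_H F w" .
  have F1: "F 1 = 0"
    by (simp add: F_def commutator_def derivation_one [OF der(1)] derivation_one [OF der(2)] sum_3 inner_der_asc asc_def
      linear_0 [OF linear_derivation [OF der(1)]] linear_0 [OF linear_derivation [OF der(2)]] mult_one_l mult_one_r)
  \<comment> \<open>Needed to read off the coordinates of \<open>tri_H F w\<close> by
    \<open>tri_H_inject\<close>: linear maps preserve sum zero, and the mean has been subtracted
    from the commutators.\<close>
  have wsum: "w 1 + w 2 + w 3 = 0"
  proof -
    have "E (u' 1) + E (u' 2) + E (u' 3) = E (u' 1 + u' 2 + u' 3)" "E' (u 1) + E' (u 2) + E' (u 3) = E' (u 1 + u 2 + u 3)"
      by (simp_all add: linear_add [OF linear_derivation [OF der(1)]] linear_add [OF linear_derivation [OF der(2)]])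
    then have z: "E (u' 1) + E (u' 2) + E (u' 3) = 0" "E' (u 1) + E' (u 2) + E' (u 3) = 0"
      using sum(1) [of 1] sum(2) [of 1]
      by (simp_all add: linear_0 [OF linear_derivation [OF der(1)]] linear_0 [OF linear_derivation [OF der(2)]])
    define S where "S = (\<Sum>k\<in>UNIV. c k)"
    have "S = (1/3) *\<^sub>R S + ((1/3) *\<^sub>R S + (1/3) *\<^sub>R S)"
      by (simp add: scaleR_left_distrib [symmetric])
    moreover have "w 1 + w 2 + w 3 = (E (u' 1) + E (u' 2) + E (u' 3)) - (E' (u 1) + E' (u 2) + E' (u 3)) + (c 1 + c 2 + c 3)
      - ((1/3) *\<^sub>R S + ((1/3) *\<^sub>R S + (1/3) *\<^sub>R S))"
      by (simp add: w_def S_def [symmetric])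
    ultimately show ?thesis
      using z by (simp add: S_def sum_3)
  qed
  have t1: "tits1 (iso_diag U) (iso_diag U' :: ('a herm3, 'b) tensor) = 0"
    by (simp add: iso_diag_def sum_3 tits_lin tits_pure commutator_jordan_he_he)
  \<comment> \<open>Distinct idempotents contribute nothing, and \<open>he i\<close> with itself
    contributes \<open>c i\<close> tensored with \<open>he i\<close> minus a third of the identity;
    collecting along each \<open>he i\<close> produces the mean.\<close>
  have t2: "tits2 (iso_diag U) (iso_diag U' :: ('a herm3, 'b) tensor) = (\<Sum>i\<in>UNIV. he i \<otimes> (c i - (1/3) *\<^sub>R (\<Sum>k\<in>UNIV. c k)))"
  proof -
    fix m :: 3
    have one: "herm_one = (he m + he (m + 1) + he (m + 2) :: 'a herm3)"
      by (rule herm_one_eq)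
    show ?thesis
      unfolding iso_diag_def sum_three [of _ m] Eu(3,4) [symmetric]
      by (simp add: tits_lin tits_pure herm_star_table c_def [symmetric])
        (simp add: one tensor_simps scaleR_add_right scaleR_diff_right)
  qed
  have t3: "tits3 (iso_diag U) (iso_diag U' :: ('a herm3, 'b) tensor) = (1/3) *\<^sub>R (\<Sum>k\<in>UNIV. inner_der (u k) (u' k))"
    by (simp add: iso_diag_def sum_3 tits_lin tits_pure herm_ip_table Eu scaleR_add_right)
  have tm: "tensor_map (hT T) id (iso_diag U') = 0" "tensor_map (hT T') id (iso_diag U) = 0"
    "tensor_map id E (iso_diag U' :: ('a herm3, 'b) tensor) = (\<Sum>i\<in>UNIV. he i \<otimes> E (u' i))"
    "tensor_map id E' (iso_diag U :: ('a herm3, 'b) tensor) = (\<Sum>i\<in>UNIV. he i \<otimes> E' (u i))"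
    using Tr linear_derivation [OF der(1)] linear_derivation [OF der(2)]
    by (simp_all add: iso_diag_def linear_sum [OF linear_tensor_map] linear_hT linear_id tensor_map_pure hT_basis Eu)
  have "magic_iso (triality_bracket (T, U, 0) (T', U', 0)) = (hT (end3_bracket T T'), iso_diag (tri_H F w), tri_E (tri_H F w))"
    by (simp only: triality_bracket_Tri [OF Tr] iso_Tri H)
  also have "\<dots> = (hT (end3_bracket T T'), \<Sum>i\<in>UNIV. he i \<otimes> w i, F)"
    by (simp add: iso_diag_def tri_H_inject [of F w, OF F1 wsum])
  also have "\<dots> = tits_bracket (magic_iso (T, U, 0)) (magic_iso (T', U', 0))"
    unfolding iso_Tri tits_bracket_eq t1 t2 t3 Eu(1,2) [symmetric] tm commutator_hT_hT F_def
    by (simp add: w_def tensor_simps sum.distrib sum_subtractf)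
  finally show ?thesis .
qed

text \<open>The second triality acts on \<open>y\<close> by \<open>E\<close> and by multiplications
  with \<open>u\<close>. On the imaginary part of \<open>y\<close>, the real parts of these
  multiplications are matched by commutators of the \<open>he\<close>'s with \<open>hP i x\<close>,
  the imaginary parts by Jordan products; the value at \<open>1\<close> is matched by
  \<open>- hD i x\<close> acting on the idempotents.\<close>

lemma iso_bracket_Tri_F:
  assumes T: "T \<in> Tri" and U: "U \<in> Tri"
  shows "magic_iso (triality_bracket (T, U, 0) (0, 0, F i (x \<otimes> y))) = tits_bracket (magic_iso (T, U, 0)) (magic_iso (0, 0, F i (x \<otimes> y)))"
proof -
  define E u s b where Eu: "E = tri_E U" "u = tri_u U" "s = rp y" "b = im_part y"
  have E: "E \<in> derivations (*)"
    unfolding Eu by (rule tri_E_derivation [OF U])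
  have im: "u i \<in> im_space" "b \<in> im_space" for i
    by (simp_all add: Eu tri_u_im U im_part_im_space)
  have y: "y = s *\<^sub>R 1 + b"
    by (simp add: Eu rp_im_decomp)
  have "tri_comp U i y = tri_comp (tri_H E u) i y"
    unfolding Eu tri_H_tri_E [OF U] ..
  then have Uy: "tri_comp U i y = E b + s *\<^sub>R (u (i + 1) - u (i + 2)) + (u (i + 1) * b - b * u (i + 2))"
    by (simp add: tri_comp_H y linear_add [OF linear_derivation [OF E]] linear_scale [OF linear_derivation [OF E]]
        derivation_one [OF E] ca_mult_simps mult_one_l mult_one_r algebra_simps)
  have Eb: "E b \<in> im_space"
    by (rule derivation_in_im [OF E])
  have rpU: "rp (tri_comp U i y) = ip (u (i + 2)) b - ip (u (i + 1)) b"
    using im Eb unfolding Uy by (simp add: linear_add [OF linear_rp] linear_diff [OF linear_rp] linear_scale [OF linear_rp]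
        rp_im_mult im_space_iff [symmetric] ip_commute [of b]) (simp add: im_space_iff)
  have imU: "im_part (tri_comp U i y) = E b + s *\<^sub>R (u (i + 1) - u (i + 2)) +
      ((1/2) *\<^sub>R (u (i + 1) * b - b * u (i + 1)) + (1/2) *\<^sub>R (u (i + 2) * b - b * u (i + 2)))"
    using im Eb unfolding Uy by (simp add: linear_add [OF linear_im_part] linear_diff [OF linear_im_part] linear_scale [OF linear_im_part]
        rp_im_mult) (simp add: algebra_simps)
  have lhs: "triality_bracket (T, U, 0) (0, 0, F i (x \<otimes> y)) =
      (0, 0, F i (tri_comp T i x \<otimes> y)) + (0, 0, F i (x \<otimes> tri_comp U i y))"
    by (simp add: triality_bracket_eq end3_bracket_zero_right T U tri_act_F tri_act_zero F_simps del: triality_bracket.simps)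
  have c: "commutator (hT T) (- (s *\<^sub>R hD i x)) = - (s *\<^sub>R hD i (tri_comp T i x))"
    unfolding commutator_hT_hD [OF T, symmetric]
    by (simp add: commutator_def fun_eq_iff linear_neg [OF linear_hT [OF T]] linear_scale [OF linear_hT [OF T]] scaleR_diff_right)
  have t1: "tits1 (iso_diag U) (- (hP i x \<otimes> b)) = (ip (u (i + 2)) b - ip (u (i + 1)) b) *\<^sub>R hD i x"
    unfolding iso_diag_def sum_three [of _ i] Eu(2) [symmetric]
    by (simp add: tits_lin tits_pure commutator_jordan_he_hP scaleR_diff_left)
  have t2: "tits2 (iso_diag U) (- (hP i x \<otimes> b)) = - (hP i x \<otimes> ((1/2) *\<^sub>R (u (i + 1) * b - b * u (i + 1)) + (1/2) *\<^sub>R (u (i + 2) * b - b * u (i + 2))))"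
    unfolding iso_diag_def sum_three [of _ i] Eu(2) [symmetric]
    by (simp add: tits_lin tits_pure herm_star_table jordan_table tensor_simps)
  have t3: "tits3 (iso_diag U) (- (hP i x \<otimes> b)) = 0"
    unfolding iso_diag_def sum_three [of _ i] by (simp add: tits_lin tits_pure herm_ip_table)
  have lneg: "linear (- (s *\<^sub>R hD i x))"
    by (rule linearI) (simp_all add: hD_lin algebra_simps)
  have tm: "tensor_map (hT T) id (- (hP i x \<otimes> b)) = - (hP i (tri_comp T i x) \<otimes> b)"
    "tensor_map (- (s *\<^sub>R hD i x)) id (iso_diag U) = hP i x \<otimes> (s *\<^sub>R (u (i + 1) - u (i + 2)))"
    "tensor_map id E (- (hP i x \<otimes> b)) = - (hP i x \<otimes> E b)"
      using linear_derivation [OF E]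
      by (simp_all add: linear_neg [OF linear_tensor_map] linear_hT T linear_id tensor_map_pure hT_basis)
        (simp add: iso_diag_def linear_add [OF linear_tensor_map [OF lneg linear_id]] linear_id lneg tensor_map_pure sum_three [of _ i]
          hD_basis Eu(2) tensor_simps scaleR_diff_right)
  have z: "commutator E 0 = 0" "tensor_map id 0 (iso_diag U) = 0"
    by (simp_all add: commutator_zero linear_derivation [OF E] tensor_map_zero)
  have "magic_iso (triality_bracket (T, U, 0) (0, 0, F i (x \<otimes> y))) =
     (- (s *\<^sub>R hD i (tri_comp T i x)), - (hP i (tri_comp T i x) \<otimes> b), 0) +
     (- (rp (tri_comp U i y) *\<^sub>R hD i x), - (hP i x \<otimes> im_part (tri_comp U i y)), 0)"
    unfolding lhs linear_add [OF linear_iso] iso_F Eu(3,4) ..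
  also have "\<dots> = tits_bracket (magic_iso (T, U, 0)) (magic_iso (0, 0, F i (x \<otimes> y)))"
    unfolding rpU imU iso_Tri iso_F tits_bracket_eq Eu(3,4) [symmetric] Eu(1) [symmetric] c t1 t2 t3 tm z
    by (simp add: tensor_simps algebra_simps)
  finally show ?thesis .
qed

lemma linear_scaled_hD: "linear (- (s *\<^sub>R hD i x))"
  by (rule linearI) (simp_all add: hD_lin algebra_simps)

lemma commutator_scaled:
  assumes "linear f" "linear g"
  shows "commutator (- (s *\<^sub>R f)) (- (t *\<^sub>R g)) = (s * t) *\<^sub>R commutator f g"
  by (simp add: commutator_def fun_eq_iff linear_neg [OF assms(1)] linear_scale [OF assms(1)]
      linear_neg [OF assms(2)] linear_scale [OF assms(2)] scaleR_diff_right mult.commute)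

lemma tits_bracket_hP_hP:
  "tits_bracket (- (s *\<^sub>R hD i x), - (hP i x \<otimes> a), 0) (- (t *\<^sub>R hD j y), - (hP j y \<otimes> b), 0) =
    ((s * t) *\<^sub>R commutator (hD i x) (hD j y) - ip a b *\<^sub>R commutator (jordan (hP i x)) (jordan (hP j y)),
     s *\<^sub>R (hD i x (hP j y) \<otimes> b) - t *\<^sub>R (hD j y (hP i x) \<otimes> a) +
       herm_star (hP i x) (hP j y) \<otimes> ((1/2) *\<^sub>R (a * b - b * a)),
     (herm_ip (hP i x) (hP j y) / 6) *\<^sub>R inner_der a b)"
  unfolding tits_bracket_eq commutator_scaled [OF linear_hD linear_hD]
  by (simp add: tits_lin tits_pure commutator_zero tensor_map_zero linear_neg [OF linear_tensor_map] linear_scaled_hD linear_id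
      tensor_map_pure tensor_simps)

lemma iso_bracket_F_same:
  "magic_iso (triality_bracket (0, 0, F i (x\<^sub>1 \<otimes> x\<^sub>2)) (0, 0, F i (y\<^sub>1 \<otimes> y\<^sub>2))) =
   tits_bracket (magic_iso (0, 0, F i (x\<^sub>1 \<otimes> x\<^sub>2))) (magic_iso (0, 0, F i (y\<^sub>1 \<otimes> y\<^sub>2)))"
proof -
  define s t a b where st: "s = rp x\<^sub>2" "t = rp y\<^sub>2" "a = im_part x\<^sub>2" "b = im_part y\<^sub>2"
  define r where "r = ip x\<^sub>1 y\<^sub>1"
  \<comment> \<open>The commutator coefficients -2/3, 1/3, 1/3 of \<open>tri_u_tau\<close> form
    \<open>he (i + 1) + he (i + 2)\<close> minus two thirds of the identity, the shape of
    \<open>herm_star\<close> on two elements of \<open>hP i\<close>; the other term is the value of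
    \<open>hD i\<close> there.\<close>
  have d: "iso_diag (tau i x\<^sub>2 y\<^sub>2) = (2 *\<^sub>R (he (i + 1) - he (i + 2))) \<otimes> (s *\<^sub>R b - t *\<^sub>R a) +
      (he (i + 1) + he (i + 2) - (2/3) *\<^sub>R (he i + he (i + 1) + he (i + 2))) \<otimes> (a * b - b * a)"
  proof -
    have e: "(he (i + 1) + he (i + 2)) - (2/3) *\<^sub>R (he i + he (i + 1) + he (i + 2)) =
       - (2/3) *\<^sub>R he i + (1/3) *\<^sub>R he (i + 1) + (1/3) *\<^sub>R he (i + 2)"
      by (rule herm_eqI_cyclic [of _ i]) simp_all
    show ?thesis
      unfolding iso_diag_def sum_three [of _ i] tri_u_tau st [symmetric] e
      by (simp add: tensor_simps algebra_simps)
  qed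
  have "magic_iso (triality_bracket (0, 0, F i (x\<^sub>1 \<otimes> x\<^sub>2)) (0, 0, F i (y\<^sub>1 \<otimes> y\<^sub>2))) =
    (ip x\<^sub>2 y\<^sub>2 *\<^sub>R hT (tau i x\<^sub>1 y\<^sub>1), r *\<^sub>R iso_diag (tau i x\<^sub>2 y\<^sub>2), r *\<^sub>R tri_E (tau i x\<^sub>2 y\<^sub>2))"
    unfolding triality_bracket_F_same iso_Tri hT_lin iso_diag_lin tri_E_lin r_def ..
  also have "\<dots> = tits_bracket (magic_iso (0, 0, F i (x\<^sub>1 \<otimes> x\<^sub>2))) (magic_iso (0, 0, F i (y\<^sub>1 \<otimes> y\<^sub>2)))"
    unfolding iso_F tits_bracket_hP_hP st [symmetric] ip_rp_im [of x\<^sub>2 y\<^sub>2] d tri_E_tau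
      commutator_hD_hD_same commutator_jordan_hP_hP_same herm_star_table herm_ip_table hD_basis r_def [symmetric]
      herm_one_eq [of i] ip_commute [of y\<^sub>1 x\<^sub>1]
    by (simp add: tensor_simps algebra_simps)
  finally show ?thesis .
qed

text \<open>Here \<open>commutator_hD_hD_next\<close> and
  \<open>commutator_jordan_hP_hP_next\<close> have the same sign, so Tits's bracket forms
  \<open>s * t - ip a b\<close>, the real part of the conjugate product; the imaginary part is
  matched in the tensor component.\<close>

lemma iso_bracket_F_next:
  "magic_iso (triality_bracket (0, 0, F i (x\<^sub>1 \<otimes> x\<^sub>2)) (0, 0, F (i + 1) (y\<^sub>1 \<otimes> y\<^sub>2))) =
   tits_bracket (magic_iso (0, 0, F i (x\<^sub>1 \<otimes> x\<^sub>2))) (magic_iso (0, 0, F (i + 1) (y\<^sub>1 \<otimes> y\<^sub>2)))"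
proof -
  define s t a b where st: "s = rp x\<^sub>2" "t = rp y\<^sub>2" "a = im_part x\<^sub>2" "b = im_part y\<^sub>2"
  have im: "a \<in> im_space" "b \<in> im_space"
    by (simp_all add: st im_part_im_space)
  have xy: "x\<^sub>2 = s *\<^sub>R 1 + a" "y\<^sub>2 = t *\<^sub>R 1 + b"
    by (simp_all add: st rp_im_decomp)
  have e: "cj y\<^sub>2 * cj x\<^sub>2 = (s * t) *\<^sub>R 1 - t *\<^sub>R a - s *\<^sub>R b + b * a"
    by (simp add: xy cj_simps cj_im im ca_mult_simps ca_neg mult_one_l mult_one_r algebra_simps)
  have r: "rp (cj y\<^sub>2 * cj x\<^sub>2) = s * t - ip a b"
    using im unfolding e by (simp add: linear_add [OF linear_rp] linear_diff [OF linear_rp] linear_scale [OF linear_rp]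
        rp_im_mult im_space_iff ip_commute)
  have m: "im_part (cj y\<^sub>2 * cj x\<^sub>2) = - (t *\<^sub>R a) - s *\<^sub>R b - (1/2) *\<^sub>R (a * b - b * a)"
    using im unfolding e by (simp add: linear_add [OF linear_im_part] linear_diff [OF linear_im_part] linear_scale [OF linear_im_part]
        rp_im_mult scaleR_diff_right)
  have "magic_iso (triality_bracket (0, 0, F i (x\<^sub>1 \<otimes> x\<^sub>2)) (0, 0, F (i + 1) (y\<^sub>1 \<otimes> y\<^sub>2))) =
    (- (rp (cj y\<^sub>2 * cj x\<^sub>2) *\<^sub>R hD (i + 2) (cj y\<^sub>1 * cj x\<^sub>1)), - (hP (i + 2) (cj y\<^sub>1 * cj x\<^sub>1) \<otimes> im_part (cj y\<^sub>2 * cj x\<^sub>2)), 0)"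
    unfolding triality_bracket_F_cyclic iso_F ..
  also have "\<dots> = tits_bracket (magic_iso (0, 0, F i (x\<^sub>1 \<otimes> x\<^sub>2))) (magic_iso (0, 0, F (i + 1) (y\<^sub>1 \<otimes> y\<^sub>2)))"
    unfolding iso_F tits_bracket_hP_hP st [symmetric] r m
      commutator_hD_hD_next commutator_jordan_hP_hP_next herm_star_table herm_ip_table hD_basis hD_basis_shift
    by (simp add: tensor_simps algebra_simps)
  finally show ?thesis .
qed

section \<open>Compatibility with brackets on all elements\<close>

lemma triality_bracket_skew: "triality_bracket b a = - triality_bracket a b"
proof -
  obtain T U v T' U' w where ab: "a = (T, U, v)" "b = (T', U', w)"
    by (cases a; cases b)
  show ?thesis
    unfolding ab triality_bracket_eq end3_bracket_skew [of T' T] end3_bracket_skew [of U' U]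
      beta1_skew [of w v] beta2_skew [of w v] crs_skew [of w v]
    by simp
qed

lemma triality_vec_lin:
  "((0, 0, v + w) :: ('a::composition_algebra, 'b::composition_algebra) triality) = (0, 0, v) + (0, 0, w)"
  "((0, 0, r *\<^sub>R v) :: ('a, 'b) triality) = r *\<^sub>R (0, 0, v)"
  by simp_all

lemma iso_bracket_F_F: "magic_iso (triality_bracket (0, 0, v) (0, 0, w)) = tits_bracket (magic_iso (0, 0, v)) (magic_iso (0, 0, w))"
proof (rule F_bilinear_eqI [of "\<lambda>v w. magic_iso (triality_bracket (0, 0, v) (0, 0, w))" "\<lambda>v w. tits_bracket (magic_iso (0, 0, v)) (magic_iso (0, 0, w))"])
  have L: "(0, 0, v) \<in> triality_algebra" for v :: "('a, 'b) tensor^3"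
    by (simp add: triality_algebra_def Tri_closed)
  have l: "magic_iso (0, 0, v) \<in> tits_linear" for v :: "('a, 'b) tensor^3"
    by (intro iso_tits_linear Tri_closed)
  interpret lie_algebra_on "triality_algebra :: ('a, 'b) triality set" triality_bracket
    by (rule lie_algebra_on_triality)
  show "bilinear (\<lambda>v w :: ('a, 'b) tensor^3. magic_iso (triality_bracket (0, 0, v) (0, 0, w)))"
    unfolding bilinear_def
    by (intro allI conjI linearI; simp only: triality_vec_lin add_left add_right scaleR_left scaleR_right L
        linear_add [OF linear_iso] linear_scale [OF linear_iso])
  show "bilinear (\<lambda>v w :: ('a, 'b) tensor^3. tits_bracket (magic_iso (0, 0, v)) (magic_iso (0, 0, w)))"
    unfolding bilinear_def
    by (intro allI conjI linearI; simp only: triality_vec_lin linear_add [OF linear_iso] linear_scale [OF linear_iso]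
        tits_bracket_lin_left tits_bracket_lin_right tits_bracket_scaleR l)
  fix i j :: 3 and x\<^sub>1 y\<^sub>1 :: 'a and x\<^sub>2 y\<^sub>2 :: 'b
  show "magic_iso (triality_bracket (0, 0, F i (x\<^sub>1 \<otimes> x\<^sub>2)) (0, 0, F j (y\<^sub>1 \<otimes> y\<^sub>2))) =
    tits_bracket (magic_iso (0, 0, F i (x\<^sub>1 \<otimes> x\<^sub>2))) (magic_iso (0, 0, F j (y\<^sub>1 \<otimes> y\<^sub>2)))"
  proof (cases rule: three_cases [of j i])
    case 3
    then have "i = j + 1" by simp
    then show ?thesis
      using iso_bracket_F_next [of j y\<^sub>1 y\<^sub>2 x\<^sub>1 x\<^sub>2]
      by (simp only: triality_bracket_skew [of "(0, 0, F (j + 1) _)"] tits_bracket_skew [of "magic_iso (0, 0, F (j + 1) _)"]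
          linear_neg [OF linear_iso])
  qed (simp_all only: iso_bracket_F_same iso_bracket_F_next)
qed

lemma iso_bracket_Tri_vec:
  assumes T: "T \<in> Tri" and U: "U \<in> Tri"
  shows "magic_iso (triality_bracket (T, U, 0) (0, 0, v)) = tits_bracket (magic_iso (T, U, 0)) (magic_iso (0, 0, v))"
proof (rule F_linear_eqI [of "\<lambda>v. magic_iso (triality_bracket (T, U, 0) (0, 0, v))" "\<lambda>v. tits_bracket (magic_iso (T, U, 0)) (magic_iso (0, 0, v))"])
  have L: "(0, 0, v) \<in> triality_algebra" "(T, U, 0 :: ('a, 'b) tensor^3) \<in> triality_algebra" for v :: "('a, 'b) tensor^3"
    by (simp_all add: triality_algebra_def Tri_closed T U)
  have l: "magic_iso (0, 0, v) \<in> tits_linear" "magic_iso (T, U, 0 :: ('a, 'b) tensor^3) \<in> tits_linear" for v :: "('a, 'b) tensor^3"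
    by (intro iso_tits_linear Tri_closed T U)+
  interpret lie_algebra_on "triality_algebra :: ('a, 'b) triality set" triality_bracket
    by (rule lie_algebra_on_triality)
  show "linear (\<lambda>v. magic_iso (triality_bracket (T, U, 0) (0, 0, v)))"
    by (intro linearI; simp only: triality_vec_lin add_right scaleR_right L
        linear_add [OF linear_iso] linear_scale [OF linear_iso])
  show "linear (\<lambda>v. tits_bracket (magic_iso (T, U, 0)) (magic_iso (0, 0, v)))"
    by (intro linearI; simp only: triality_vec_lin linear_add [OF linear_iso] linear_scale [OF linear_iso]
        tits_bracket_lin_right tits_bracket_scaleR l)
qed (rule iso_bracket_Tri_F [OF T U])

lemma iso_bracket:
  assumes "a \<in> triality_algebra" "b \<in> (triality_algebra :: ('a::composition_algebra, 'b::composition_algebra) triality set)"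
  shows "magic_iso (triality_bracket a b) = tits_bracket (magic_iso a) (magic_iso b)"
proof -
  interpret lie_algebra_on "triality_algebra :: ('a, 'b) triality set" triality_bracket
    by (rule lie_algebra_on_triality)
  obtain T U v T' U' w where Tr: "T \<in> Tri" "U \<in> Tri" "T' \<in> Tri" "U' \<in> Tri" and ab: "a = (T, U, v)" "b = (T', U', w)"
    using assms by (auto simp: triality_algebra_def)
  define X Y V W where XY: "X = (T, U, 0 :: ('a, 'b) tensor^3)" "Y = (T', U', 0 :: ('a, 'b) tensor^3)"
    "V = (0 :: 'a end3, 0 :: 'b end3, v)" "W = (0 :: 'a end3, 0 :: 'b end3, w)"
  have ab: "a = X + V" "b = Y + W"
    by (simp_all add: ab XY)
  have L: "X \<in> triality_algebra" "V \<in> triality_algebra" "Y \<in> triality_algebra" "W \<in> triality_algebra"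
    "Y + W \<in> triality_algebra"
    by (simp_all add: triality_algebra_def Tri_closed Tr XY)
  have l: "magic_iso X \<in> tits_linear" "magic_iso V \<in> tits_linear" "magic_iso Y \<in> tits_linear" "magic_iso W \<in> tits_linear" "magic_iso (Y + W) \<in> tits_linear"
    by (simp_all add: XY iso_tits_linear Tri_closed Tr del: magic_iso.simps)
  have VY: "magic_iso (triality_bracket V Y) = tits_bracket (magic_iso V) (magic_iso Y)"
    using iso_bracket_Tri_vec [OF Tr(3,4), of v]
    unfolding XY triality_bracket_skew [of "(0, 0, v)"] tits_bracket_skew [of "magic_iso (0, 0, v)"] linear_neg [OF linear_iso]
    by simp
  have "magic_iso (triality_bracket a b) = magic_iso (triality_bracket X Y) + magic_iso (triality_bracket X W) +
      (magic_iso (triality_bracket V Y) + magic_iso (triality_bracket V W))"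
    by (simp only: ab add_left add_right L linear_add [OF linear_iso])
  also have "\<dots> = tits_bracket (magic_iso X) (magic_iso Y) + tits_bracket (magic_iso X) (magic_iso W) + (tits_bracket (magic_iso V) (magic_iso Y) + tits_bracket (magic_iso V) (magic_iso W))"
    unfolding VY unfolding XY by (simp only: iso_bracket_Tri_Tri Tr iso_bracket_Tri_vec iso_bracket_F_F)
  also have "\<dots> = tits_bracket (magic_iso X + magic_iso V) (magic_iso Y + magic_iso W)"
    using l by (simp only: linear_add [OF linear_iso, symmetric] tits_bracket_lin_left tits_bracket_lin_right)
      (simp only: linear_add [OF linear_iso] tits_bracket_lin_left tits_bracket_lin_right)
  finally show ?thesis
    by (simp only: ab linear_add [OF linear_iso])
qed

section \<open>Bijectivity\<close>

lemma hdiag_lift: "bilinear (\<lambda>(A :: 'a::composition_algebra herm3) (x :: 'b::real_vector). hdiag A j *\<^sub>R x)"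
  by (auto simp: bilinear_def algebra_simps intro!: linearI)

lemma linear_hoff: "linear (\<lambda>A. hoff A j)"
  by (rule linearI) simp_all

text \<open>Used for injectivity: the derivation component of the map determines the coefficient of
  \<open>1\<close> and the tensor component determines the rest.\<close>

lemma tensor_rp_im:
  fixes t :: "('a::composition_algebra, 'b::composition_algebra) tensor"
  shows "t = tensor_map id im_part t + tensor_lift (\<lambda>x y. rp y *\<^sub>R x) t \<otimes> 1"
proof -
  note l = linear_tensor_lift [OF bilinear_rp_scaleR]
  have "(\<lambda>t :: ('a, 'b) tensor. t) = (\<lambda>t. tensor_map id im_part t + tensor_lift (\<lambda>x y. rp y *\<^sub>R x) t \<otimes> 1)"
  proof (rule tensor_linear_eqI)
    show "linear (\<lambda>t :: ('a, 'b) tensor. tensor_map id im_part t + tensor_lift (\<lambda>x y. rp y *\<^sub>R x) t \<otimes> 1)"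
      by (rule linearI) (simp_all add: linear_add [OF l] linear_scale [OF l] linear_add [OF linear_tensor_map]
        linear_scale [OF linear_tensor_map] linear_id linear_im_part tensor_simps scaleR_add_right)
    show "a \<otimes> b = tensor_map id im_part (a \<otimes> b) + tensor_lift (\<lambda>x y. rp y *\<^sub>R x) (a \<otimes> b) \<otimes> 1" for a :: 'a and b :: 'b
    proof -
      have "a \<otimes> b = a \<otimes> (im_part b + rp b *\<^sub>R 1)"
        by (simp only: add.commute [of "im_part b"] rp_im_decomp)
      moreover have "tensor_map id im_part (a \<otimes> b) + tensor_lift (\<lambda>x y. rp y *\<^sub>R x) (a \<otimes> b) \<otimes> 1 =
          a \<otimes> (im_part b + rp b *\<^sub>R 1)"
        by (simp add: tensor_map_pure linear_id linear_im_part tensor_lift_pure [OF bilinear_rp_scaleR] tensor_simps)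
      ultimately show ?thesis
        by (simp only:)
    qed
  qed (simp add: linear_ident)
  then show ?thesis by (rule fun_cong)
qed

lemma iso_inj:
  assumes a: "a \<in> (triality_algebra :: ('a::composition_algebra, 'b::composition_algebra) triality set)" and 0: "magic_iso a = 0"
  shows "a = 0"
proof -
  obtain T U v where Tr: "T \<in> Tri" "U \<in> Tri" and av: "a = (T, U, v)"
    using a by (auto simp: triality_algebra_def)
  have 1: "hT T - (\<Sum>i\<in>UNIV. hD i (iso_off v i)) = 0" and 2: "iso_diag U - iso_offt v = 0" and 3: "tri_E U = 0"
    using 0 by (simp_all add: av zero_prod_def)
  have z: "iso_off v i = 0" for i
  proof -
    \<comment> \<open>\<open>hT T\<close> kills the idempotents, and among the \<open>hD\<close>
      terms only the one of index \<open>i\<close> moves \<open>he (i + 2)\<close> into the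
      \<open>i\<close>-th off-diagonal space.\<close>
    have "hoff ((hT T - (\<Sum>i\<in>UNIV. hD i (iso_off v i))) (he (i + 2))) i = 0"
      unfolding 1 by simp
    then show ?thesis
      by (simp add: sum_three [of _ i] hT_basis [OF Tr(1)] hD_basis hD_basis_shift)
  qed
  have T0: "T = 0"
  proof (rule tri_eqI, rule ext)
    fix i x
    have "hoff (hT T (hP i x)) i = 0"
      using 1 by (simp add: z hD_arg_lin)
    then show "tri_comp T i x = tri_comp 0 i x"
      by (simp add: hT_basis [OF Tr(1)] tri_comp_zero)
  qed
  have "tri_u U j = 0" for j
  proof -
    \<comment> \<open>Reading off the \<open>j\<close>-th diagonal entry kills the off-diagonal
      tensors and isolates \<open>tri_u U j\<close>.\<close>
    let ?f = "tensor_lift (\<lambda>(A :: 'a herm3) (x :: 'b). hdiag A j *\<^sub>R x)"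
    note l = linear_tensor_lift [OF hdiag_lift [of j]]
    have "?f (iso_offt v) = 0"
      by (rule F_linear_eqI [of "\<lambda>v. ?f (iso_offt v)" "\<lambda>v. 0"])
        (auto intro!: linearI simp: iso_offt_lin linear_add [OF l] linear_scale [OF l] iso_offt_F tensor_lift_pure [OF hdiag_lift] linear_zero)
    moreover have "?f (iso_diag U) = tri_u U j"
      by (simp add: iso_diag_def sum_three [of _ j] linear_add [OF l] tensor_lift_pure [OF hdiag_lift])
    ultimately show ?thesis
      using 2 by simp
  qed
  then have "tri_comp (tri_H (tri_E U) (tri_u U)) i x = 0" for i x
    by (simp add: tri_comp_H 3)
  then have U0: "U = 0"
    unfolding tri_H_tri_E [OF Tr(2)] by (intro tri_eqI ext) (simp add: tri_comp_zero)
  have "v $ j = 0" for j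
  proof -
    note l = linear_tensor_map [OF linear_hoff [of j] linear_id]
    have "tensor_map (\<lambda>A. hoff A j) id (iso_offt v) = tensor_map id im_part (v $ j)"
    proof (rule F_linear_eqI [of "\<lambda>v. tensor_map (\<lambda>A. hoff A j) id (iso_offt v)" "\<lambda>v. tensor_map id im_part (v $ j)"])
      show "linear (\<lambda>v :: ('a, 'b) tensor^3. tensor_map (\<lambda>A. hoff A j) id (iso_offt v))"
        by (rule linearI) (simp_all add: iso_offt_lin linear_add [OF l] linear_scale [OF l])
      show "linear (\<lambda>v :: ('a, 'b) tensor^3. tensor_map id im_part (v $ j))"
        by (rule linearI) (simp_all add: linear_add [OF linear_tensor_map] linear_scale [OF linear_tensor_map] linear_id linear_im_part)
      show "tensor_map (\<lambda>A. hoff A j) id (iso_offt (F i (x \<otimes> y))) = tensor_map id im_part (F i (x \<otimes> y) $ j)" for i and x :: 'a and y :: 'b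
        by (simp add: iso_offt_F tensor_map_pure linear_hoff linear_id linear_im_part F_nth linear_0 [OF linear_tensor_map])
    qed
    moreover have "tensor_map (\<lambda>A. hoff A j) id (0 :: ('a herm3, 'b) tensor) = 0"
      by (rule linear_0 [OF l])
    ultimately have "tensor_map id im_part (v $ j) = 0"
      using 2 U0 by simp
    then show ?thesis
      using tensor_rp_im [of "v $ j"] z [of j] by (simp add: iso_off_def)
  qed
  then have "v = 0"
    by (simp add: vec_eq_iff)
  then show ?thesis
    by (simp add: av T0 U0 zero_prod_def)
qed

definition tits_mid :: "('a::composition_algebra herm3, 'b::composition_algebra) tensor set" where
  "tits_mid = span {A \<otimes> x | A x. A \<in> herm_traceless \<and> x \<in> im_space}"

lemma tits_mid_pure: "\<lbrakk>(\<Sum>i\<in>UNIV. hdiag A i) = 0; x \<in> im_space\<rbrakk> \<Longrightarrow> A \<otimes> x \<in> tits_mid"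
  unfolding tits_mid_def by (rule span_base) (auto simp: herm_traceless_iff)

lemma iso_into:
  assumes a: "a \<in> triality_algebra"
  shows "magic_iso a \<in> tits_algebra"
proof -
  obtain T U v where Tr: "T \<in> Tri" "U \<in> Tri" and av: "a = (T, U, v)"
    using a by (auto simp: triality_algebra_def)
  have 1: "hT T - (\<Sum>i\<in>UNIV. hD i (iso_off v i)) \<in> derivations jordan"
    by (intro subspace_diff subspace_sum subspace_derivations bilinear_jordan hT_derivation hD_derivation Tr)
  have sub: "subspace tits_mid"
    by (simp add: tits_mid_def)
  have "v \<in> {v. iso_offt v \<in> tits_mid}"
  proof (rule F_subspace_UNIV)
    show "subspace {v. iso_offt v \<in> (tits_mid :: ('a herm3, 'b) tensor set)}"
      using sub by (auto simp: subspace_def iso_offt_lin)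
    show "F i (x \<otimes> y) \<in> {v. iso_offt v \<in> tits_mid}" for i and x :: 'a and y :: 'b
      by (simp add: iso_offt_F tits_mid_pure im_part_im_space)
  qed
  moreover have "iso_diag U \<in> (tits_mid :: ('a herm3, 'b) tensor set)"
  proof -
    fix i :: 3
    \<comment> \<open>A single \<open>he i\<close> is not traceless; eliminating one
      \<open>tri_u\<close> by sum zero leaves differences of idempotents, which are.\<close>
    have "tri_u U (i + 2) = - (tri_u U i + tri_u U (i + 1))"
      using tri_u_sum [of U i] by (simp only: eq_neg_iff_add_eq_0 add.commute)
    then have "iso_diag U = ((he i - he (i + 2)) \<otimes> tri_u U i + (he (i + 1) - he (i + 2)) \<otimes> tri_u U (i + 1) :: ('a herm3, 'b) tensor)"
      by (simp add: iso_diag_def sum_three [of _ i] tensor_simps)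
    moreover have "(he i - he (i + 2)) \<otimes> tri_u U i \<in> (tits_mid :: ('a herm3, 'b) tensor set)"
      "(he (i + 1) - he (i + 2)) \<otimes> tri_u U (i + 1) \<in> (tits_mid :: ('a herm3, 'b) tensor set)"
      by (intro tits_mid_pure tri_u_im Tr; simp add: sum_three [of _ i])+
    ultimately show "iso_diag U \<in> (tits_mid :: ('a herm3, 'b) tensor set)"
      using subspace_add [OF sub] by simp
  qed
  ultimately have "iso_diag U - iso_offt v \<in> tits_mid"
    using subspace_diff [OF sub] by simp
  then show ?thesis
    using 1 tri_E_derivation [OF Tr(2)] by (simp add: av tits_algebra_def tits_mid_def)
qed

text \<open>The image is a subspace, so each summand of the target is treated on its own, and the
  middle one only on its spanning pure tensors.\<close>

lemma iso_onto:
  assumes "p \<in> (tits_algebra :: ('a::composition_algebra, 'b::composition_algebra) tits set)"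
  shows "p \<in> magic_iso ` triality_algebra"
proof -
  let ?R = "magic_iso ` triality_algebra :: ('a, 'b) tits set"
  interpret lie_algebra_on "triality_algebra :: ('a, 'b) triality set" triality_bracket
    by (rule lie_algebra_on_triality)
  have R: "subspace ?R"
    by (rule linear_subspace_image [OF linear_iso subspace])
  obtain D u E where p: "p = (D, u, E)" and D: "D \<in> derivations jordan" and u: "u \<in> tits_mid" and E: "E \<in> derivations (*)"
    using assms by (auto simp: tits_algebra_def tits_mid_def)
  have "(D, 0, 0) \<in> ?R"
  proof -
    obtain T z where T: "T \<in> Tri" and Dz: "D = hT T - (\<Sum>i\<in>UNIV. hD i (z i))"
      using derivation_jordan_decomp [OF D] by blast
    \<comment> \<open>\<open>1\<close> has real coefficient 1 and imaginary part 0, so this vector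
      contributes only to the derivation component.\<close>
    define v where "v = (\<chi> i. z i \<otimes> (1 :: 'b))"
    have "iso_off v i = z i" for i
      by (simp add: iso_off_def v_def tensor_lift_pure [OF bilinear_rp_scaleR])
    moreover have "iso_offt v = 0"
      by (simp add: iso_offt_def v_def tensor_map_pure linear_hP linear_im_part)
    ultimately have "magic_iso (T, 0, v) = (D, 0, 0)"
      by (simp add: Dz)
    moreover have "(T, 0, v) \<in> triality_algebra"
      by (simp add: triality_algebra_def T Tri_closed)
    ultimately show ?thesis by (metis imageI)
  qed
  moreover have "(0, u, 0) \<in> ?R"
  proof -
    have "subspace {u. (0, u, 0) \<in> ?R}"
      unfolding subspace_def mem_Collect_eq
    proof (intro conjI ballI allI)
      show "(0, 0, 0) \<in> ?R"
        using subspace_0 [OF R] by (simp add: zero_prod_def)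
      show "(0, x + y, 0) \<in> ?R" if "x \<in> {u. (0, u, 0) \<in> ?R}" "y \<in> {u. (0, u, 0) \<in> ?R}" for x y
        using subspace_add [OF R, of "(0, x, 0)" "(0, y, 0)"] that by simp
      show "(0, c *\<^sub>R x, 0) \<in> ?R" if "x \<in> {u. (0, u, 0) \<in> ?R}" for c x
        using subspace_scale [OF R, of "(0, x, 0)" c] that by simp
    qed
    moreover have "(0, A \<otimes> x, 0) \<in> ?R" if A: "(\<Sum>i\<in>UNIV. hdiag A i) = 0" and x: "x \<in> im_space" for A x
    proof -
      \<comment> \<open>The diagonal of \<open>A\<close> becomes an imaginary triple, trace zero
        giving sum zero; the off-diagonal entries are negated in \<open>v\<close> to cancel the sign
        in \<open>magic_iso\<close>.\<close>
      define w where "w i = hdiag A i *\<^sub>R x" for i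
      define v where "v = (\<chi> i. - (hoff A i \<otimes> x))"
      have E0: "(0 :: 'b \<Rightarrow> 'b) \<in> derivations (*)"
        by (simp add: derivations_def linear_zero zero_fun_def)
      have "(\<Sum>k\<in>UNIV. w k) = 0"
        by (simp add: w_def scaleR_sum_left [symmetric] A)
      then have w: "w i \<in> im_space" "w 1 + w 2 + w 3 = 0" "w i + w (i + 1) + w (i + 2) = 0" for i
        using x sum_three [of w i] by (simp_all add: w_def im_space_closed sum_3)
      have "iso_off v i = 0" for i
        using x by (simp add: iso_off_def v_def linear_neg [OF linear_tensor_lift [OF bilinear_rp_scaleR]]
            tensor_lift_pure [OF bilinear_rp_scaleR] im_space_iff)
      moreover have "iso_offt v = - (\<Sum>i\<in>UNIV. hP i (hoff A i)) \<otimes> x"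
        using x by (simp add: iso_offt_def v_def linear_neg [OF linear_tensor_map] linear_hP linear_im_part tensor_map_pure
            sum_negf sum_3 tensor_simps)
      moreover have "tri_u (tri_H 0 w) i = w i" for i
        by (rule tri_H_inject(1)) (simp_all add: w)
      then have "iso_diag (tri_H 0 w) = (\<Sum>i\<in>UNIV. hdiag A i *\<^sub>R he i) \<otimes> x"
        by (simp add: iso_diag_def sum_3 tensor_simps w_def)
      moreover have "tri_E (tri_H 0 w) = 0"
        by (rule tri_H_inject(2)) (simp_all add: w)
      ultimately have "magic_iso (0, tri_H 0 w, v) = (0, ((\<Sum>i\<in>UNIV. hdiag A i *\<^sub>R he i) + (\<Sum>i\<in>UNIV. hP i (hoff A i))) \<otimes> x, 0)"
        by (simp add: tensor_simps hD_arg_lin)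
      also have "\<dots> = (0, A \<otimes> x, 0)"
        by (simp add: herm_basis [symmetric])
      finally have "magic_iso (0, tri_H 0 w, v) = (0, A \<otimes> x, 0)" .
      moreover have "(0, tri_H 0 w, v) \<in> triality_algebra"
        using tri_H_Tri [OF E0, of w] by (simp add: triality_algebra_def Tri_closed w)
      ultimately show ?thesis by (metis imageI)
    qed
    ultimately show ?thesis
      using u span_minimal [of "{A \<otimes> x | A x. A \<in> herm_traceless \<and> x \<in> im_space}" "{u. (0, u, 0) \<in> ?R}"]
      unfolding tits_mid_def herm_traceless_iff by blast
  qed
  moreover have "(0, 0, E) \<in> ?R"
  proof -
    have "magic_iso (0, tri_H E (\<lambda>_. 0), 0) = (0, 0, E)"
      by (simp add: iso_Tri iso_diag_def tri_H_inject derivation_one [OF E] del: magic_iso.simps)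
    moreover have "(0, tri_H E (\<lambda>_. 0), 0) \<in> triality_algebra"
      by (simp add: triality_algebra_def Tri_closed tri_H_Tri E im_space_closed)
    ultimately show ?thesis by (metis imageI)
  qed
  ultimately have "(D, 0, 0) + (0, u, 0) + (0, 0, E) \<in> ?R"
    using subspace_add [OF R] by blast
  then show ?thesis by (simp add: p)
qed

text \<open>Surjectivity of \<open>g\<close> lets every axiom on \<open>L\<close> be read as the
  image of the same axiom on \<open>L'\<close>. The isomorphism asked for runs from \<open>L\<close>
  to \<open>L'\<close>, hence the inverse of \<open>g\<close>.\<close>

lemma lie_isomorphic_inverse:
  assumes L': "lie_algebra_on L' br'" and g: "linear g" and bij: "bij_betw g L' L"
    and hom: "\<And>a b. a \<in> L' \<Longrightarrow> b \<in> L' \<Longrightarrow> g (br' a b) = br (g a) (g b)"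
  shows "lie_isomorphic L br L' br'"
proof -
  interpret lie_algebra_on L' br' by (rule L')
  note lin = linear_add [OF g] linear_scale [OF g] linear_0 [OF g]
  have L: "L = g ` L'"
    using bij by (simp add: bij_betw_def)
  note cl = subspace_add [OF subspace] subspace_scale [OF subspace]
  have "lie_algebra_on L br"
  proof
    show "subspace L"
      unfolding L by (rule linear_subspace_image [OF g subspace])
    fix x y z r
    assume "x \<in> L" "y \<in> L"
    then obtain a b where x: "x = g a" "a \<in> L'" and y: "y = g b" "b \<in> L'"
      unfolding L by blast
    note ab = x(2) y(2)
    show "br x y \<in> L"
      unfolding x y L hom [OF ab, symmetric] using closed [OF ab] by (rule imageI)
    show "br (r *\<^sub>R x) y = r *\<^sub>R br x y" "br x (r *\<^sub>R y) = r *\<^sub>R br x y"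
      unfolding x y by (simp_all only: lin(2) [symmetric] hom [symmetric] ab cl scaleR_left scaleR_right)
    show "br x x = 0"
      unfolding x by (simp only: hom [symmetric] ab alternating lin(3))
    assume "z \<in> L"
    then obtain c where z: "z = g c" "c \<in> L'"
      unfolding L by blast
    show "br (x + y) z = br x z + br y z" "br x (y + z) = br x y + br x z"
      unfolding x y z by (simp_all only: lin(1) [symmetric] hom [symmetric] ab z(2) cl add_left add_right)
    show "br x (br y z) + br y (br z x) + br z (br x y) = 0"
      unfolding x y z by (simp only: lin [symmetric] hom [symmetric] ab z(2) closed jacobi)
  qed
  moreover
  define f where "f = inv_into L' g"
  have f: "f (g a) = a" if "a \<in> L'" for a
    using that bij by (simp add: f_def bij_betw_def inv_into_f_f)
  have "bij_betw f L L'"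
    unfolding f_def by (rule bij_betw_inv_into [OF bij])
  moreover have "f (g a + g b) = f (g a) + f (g b)" "f (r *\<^sub>R g a) = r *\<^sub>R f (g a)" "f (br (g a) (g b)) = br' (f (g a)) (f (g b))"
    if "a \<in> L'" "b \<in> L'" for a b r
    using that by (simp_all add: f cl closed lin(1,2) [symmetric] hom [symmetric])
  ultimately show ?thesis
    unfolding lie_isomorphic_def L using L' by blast
qed

theorem theorem3:
  shows "lie_isomorphic
    (tits_algebra :: ('a::composition_algebra, 'b::composition_algebra) tits set) tits_bracket
    (triality_algebra :: ('a, 'b) triality set) triality_bracket"
proof (rule lie_isomorphic_inverse [OF lie_algebra_on_triality linear_iso])
  interpret lie_algebra_on "triality_algebra :: ('a, 'b) triality set" triality_bracket
    by (rule lie_algebra_on_triality)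
  have "inj_on magic_iso (triality_algebra :: ('a, 'b) triality set)"
  proof (rule inj_onI)
    fix a b :: "('a, 'b) triality"
    assume ab: "a \<in> triality_algebra" "b \<in> triality_algebra" "magic_iso a = magic_iso b"
    then have "a - b \<in> triality_algebra" "magic_iso (a - b) = 0"
      by (simp_all add: subspace_diff [OF subspace] linear_diff [OF linear_iso])
    then show "a = b"
      using iso_inj by fastforce
  qed
  then show "bij_betw magic_iso triality_algebra (tits_algebra :: ('a, 'b) tits set)"
    unfolding bij_betw_def using iso_into iso_onto by blast
qed (rule iso_bracket)

end
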